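(* Let $\Sigma\le S_n$ be a Young subgroup and $G\le\Sigma$ a subgroup of index $\ell=[\Sigma:G]$. Then a set of universal secondaries exists: there are $\theta_1,\dots,\theta_\ell\in\mathbb{Z}[V]^G$ forming a set of secondary invariants for $\mathbb{Q}[V]^G$ over $\mathbb{Q}[V]^\Sigma$ such that, for every good prime $p$ (that is, every prime $p$ for which $\mathbb{F}_p[V]^G$ is Cohen-Macaulay), $\mathbb{F}_p[V]^G=\bigoplus_{i=1}^\ell\mathbb{F}_p[V]^\Sigma\,\overline{\theta}_i$, where $\overline{\theta}_i$ is the reduction of $\theta_i$ modulo $p$.
   Context: $\Sigma=S_{k_1}\times\cdots\times S_{k_r}$ with $k_1+\dots+k_r=n$. For a commutative ring $R$, $R[V]=R[x_1,\dots,x_n]$, on which $S_n$ acts by permuting the variables; $R[V]^H$ is the subring of $H$-invariants. $R[V]^\Sigma$ is a polynomial ring over $R$, and $R[V]^G$ is called Cohen-Macaulay if it is free as an $R[V]^\Sigma$-module. A set of secondary invariants (secondaries) for $\mathbb{Q}[V]^G$ is a minimal set of homogeneous generators of $\mathbb{Q}[V]^G$ as a $\mathbb{Q}[V]^\Sigma$-module; it has exactly $\ell$ elements and is a module basis. *)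

theory Defs
  imports
    "HOL-Algebra.Algebra"
    "HOL-Algebra.Algebraic_Closure_Type"
    "HOL-Number_Theory.Residues"
begin

definition module_span :: "('a, 'r) ring_scheme \<Rightarrow> ('a, 'b, 'm) module_scheme \<Rightarrow> 'b set \<Rightarrow> 'b set"
  where "module_span A M B =
    {(\<Oplus>\<^bsub>M\<^esub>b\<in>F. c b \<odot>\<^bsub>M\<^esub> b) | F c. finite F \<and> F \<subseteq> B \<and> c \<in> F \<rightarrow> carrier A}"

definition module_basis :: "('a, 'r) ring_scheme \<Rightarrow> ('a, 'b, 'm) module_scheme \<Rightarrow> 'b set \<Rightarrow> bool"
  where "module_basis A M B \<longleftrightarrow>
    B \<subseteq> carrier M \<and> module_span A M B = carrier M \<and>
    (\<forall>F c. finite F \<and> F \<subseteq> B \<and> c \<in> F \<rightarrow> carrier A \<and>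
       (\<Oplus>\<^bsub>M\<^esub>b\<in>F. c b \<odot>\<^bsub>M\<^esub> b) = \<zero>\<^bsub>M\<^esub> \<longrightarrow> (\<forall>b\<in>F. c b = \<zero>\<^bsub>A\<^esub>))"

definition free_module :: "('a, 'r) ring_scheme \<Rightarrow> ('a, 'b, 'm) module_scheme \<Rightarrow> bool"
  where "free_module A M \<longleftrightarrow> (\<exists>B. module_basis A M B)"

definition cyclic_submodule ::
    "('a, 'r) ring_scheme \<Rightarrow> ('a, 'b, 'm) module_scheme \<Rightarrow> 'b \<Rightarrow> 'b set"
  where "cyclic_submodule A M x = {a \<odot>\<^bsub>M\<^esub> x | a. a \<in> carrier A}"

definition internal_direct_sum ::
    "('a, 'r) ring_scheme \<Rightarrow> ('a, 'b, 'm) module_scheme \<Rightarrow> 'i set \<Rightarrow> ('i \<Rightarrow> 'b set) \<Rightarrow> bool"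
  where "internal_direct_sum A M I N \<longleftrightarrow>
    finite I \<and> (\<forall>i\<in>I. submodule (N i) A M) \<and>
    (\<forall>x\<in>carrier M. \<exists>!y. y \<in> (\<Pi>\<^sub>E i\<in>I. N i) \<and> x = (\<Oplus>\<^bsub>M\<^esub>i\<in>I. y i))"

text \<open>
  As in \<^theory>\<open>HOL-Algebra.Indexed_Polynomials\<close>, a monomial is a multiset of variable indices
  and a polynomial is its coefficient function. The carrier below is the library's set of
  polynomials in the variables with index in \<open>{1..n}\<close>; the library does not provide the
  multiplication of two polynomials.
\<close>

type_synonym 'a mpoly = "nat multiset \<Rightarrow> 'a"

definition mpoly_ring :: "('a, 'r) ring_scheme \<Rightarrow> nat \<Rightarrow> 'a mpoly ring"
  where "mpoly_ring R n =
    \<lparr> carrier = ring.indexed_pset R {1..n} (carrier R),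
      monoid.mult = (\<lambda>P Q m. \<Oplus>\<^bsub>R\<^esub>a\<in>{a. a \<subseteq># m}. P a \<otimes>\<^bsub>R\<^esub> Q (m - a)),
      monoid.one = ring.indexed_const R \<one>\<^bsub>R\<^esub>,
      ring.zero = ring.indexed_const R \<zero>\<^bsub>R\<^esub>,
      ring.add = ring.indexed_padd R \<rparr>"

text \<open>
  The permutation \<open>\<sigma>\<close> sends the variable with index \<open>i\<close> to the one with index \<open>\<sigma> i\<close>. It
  sends the monomial \<open>m\<close> to \<open>image_mset \<sigma> m\<close>, so the coefficient of \<open>\<sigma> P\<close> at \<open>m\<close> is that of
  \<open>P\<close> at the preimage of \<open>m\<close>.
\<close>

definition permute_vars :: "(nat \<Rightarrow> nat) \<Rightarrow> 'a mpoly \<Rightarrow> 'a mpoly"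
  where "permute_vars \<sigma> P = (\<lambda>m. P (image_mset (Hilbert_Choice.inv \<sigma>) m))"

definition inv_ring :: "('a, 'r) ring_scheme \<Rightarrow> nat \<Rightarrow> (nat \<Rightarrow> nat) set \<Rightarrow> 'a mpoly ring"
  where "inv_ring R n H =
    (mpoly_ring R n) \<lparr> carrier :=
      {P \<in> carrier (mpoly_ring R n). \<forall>\<sigma>\<in>H. permute_vars \<sigma> P = P} \<rparr>"

text \<open>
  The invariants of \<open>H\<close> with multiplication as scalar multiplication. This is used as a module
  over the invariants of any group of permutations containing \<open>H\<close>.
\<close>

definition inv_module ::
    "('a, 'r) ring_scheme \<Rightarrow> nat \<Rightarrow> (nat \<Rightarrow> nat) set \<Rightarrow> ('a mpoly, 'a mpoly) module"
  where "inv_module R n H =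
    \<lparr> carrier = carrier (inv_ring R n H),
      monoid.mult = monoid.mult (inv_ring R n H),
      monoid.one = monoid.one (inv_ring R n H),
      ring.zero = ring.zero (inv_ring R n H),
      ring.add = ring.add (inv_ring R n H),
      module.smult = monoid.mult (inv_ring R n H) \<rparr>"

definition homogeneous :: "('a, 'r) ring_scheme \<Rightarrow> 'a mpoly \<Rightarrow> bool"
  where "homogeneous R P \<longleftrightarrow> (\<exists>d. \<forall>m. P m \<noteq> \<zero>\<^bsub>R\<^esub> \<longrightarrow> size m = d)"

text \<open>
  The blocks \<open>B\<close> of the partition need not be intervals; the \<open>k\<^sub>i\<close> in
  \<open>S\<^bsub>k\<^sub>1\<^esub> \<times> \<dots> \<times> S\<^bsub>k\<^sub>r\<^esub>\<close> are their cardinalities.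
\<close>

definition young_subgroup :: "nat \<Rightarrow> (nat \<Rightarrow> nat) set \<Rightarrow> bool"
  where "young_subgroup n \<Sigma> \<longleftrightarrow>
    (\<exists>\<P>. partition_on {1..n} \<P> \<and> \<Sigma> = {\<sigma> \<in> carrier (sym_group n). \<forall>B\<in>\<P>. \<sigma> ` B = B})"

definition secondary_invariants ::
    "('a, 'r) ring_scheme \<Rightarrow> nat \<Rightarrow> (nat \<Rightarrow> nat) set \<Rightarrow> (nat \<Rightarrow> nat) set \<Rightarrow> 'a mpoly set \<Rightarrow> bool"
  where "secondary_invariants R n \<Sigma> G T \<longleftrightarrow>
    T \<subseteq> carrier (inv_ring R n G) \<and> (\<forall>P\<in>T. homogeneous R P) \<and>
    module_span (inv_ring R n \<Sigma>) (inv_module R n G) T = carrier (inv_module R n G) \<and>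
    (\<forall>T'. T' \<subset> T \<longrightarrow>
       module_span (inv_ring R n \<Sigma>) (inv_module R n G) T' \<noteq> carrier (inv_module R n G))"

definition cohen_macaulay ::
    "('a, 'r) ring_scheme \<Rightarrow> nat \<Rightarrow> (nat \<Rightarrow> nat) set \<Rightarrow> (nat \<Rightarrow> nat) set \<Rightarrow> bool"
  where "cohen_macaulay R n \<Sigma> G \<longleftrightarrow> free_module (inv_ring R n \<Sigma>) (inv_module R n G)"

abbreviation rat_ring :: "rat ring"
  where "rat_ring \<equiv> ring_of_type_algebra"

definition good_prime :: "nat \<Rightarrow> (nat \<Rightarrow> nat) set \<Rightarrow> (nat \<Rightarrow> nat) set \<Rightarrow> nat \<Rightarrow> bool"
  where "good_prime n \<Sigma> G p \<longleftrightarrow> Factorial_Ring.prime p \<and> cohen_macaulay (residue_ring (int p)) n \<Sigma> G"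

definition to_rat :: "int mpoly \<Rightarrow> rat mpoly"
  where "to_rat P = (\<lambda>m. of_int (P m))"

definition reduce_mod :: "nat \<Rightarrow> int mpoly \<Rightarrow> int mpoly"
  where "reduce_mod p P = (\<lambda>m. P m mod int p)"

end

theory Submission
  imports Defs "HOL-Library.Poly_Mapping" "HOL-Library.Multiset_Order"
begin

text \<open>
  Write \<open>A\<close> for the integral invariants of \<open>\<Sigma>\<close>, \<open>M\<close> for those of \<open>G\<close>, and \<open>A\<^sub>+\<close> for the elements of \<open>A\<close>
  without constant term. The graded group \<open>M / A\<^sub>+ M\<close> is finitely generated in each degree, and the
  \<open>\<theta>\<^sub>i\<close> are homogeneous lifts of a basis of its quotient by torsion. They depend on no prime; the
  point is that a good prime cannot meet the torsion.

  Every field \<open>K\<close> that occurs is the fraction field of \<open>\<int>/q\<close> with \<open>q\<close> zero or prime, and every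
  coefficient of an invariant over \<open>K\<close> is a quotient of reductions of integers. So the argument
  takes place in integer polynomials modulo \<open>q\<close>, where an equation may be multiplied by any integer
  that \<open>q\<close> does not divide, and both characteristics are treated at once. It has four parts.

  \<^item> Rank. At most \<open>\<ell>\<close> elements of \<open>M\<close> are \<open>A\<close>-independent modulo \<open>q\<close>, and fewer than \<open>\<ell>\<close> elements
    never span \<open>M\<close> up to scalars (\<open>card_independent_le\<close>, \<open>card_spanning_ge\<close>). Both bounds come from
    the \<open>\<ell>\<close> conjugates of an element of \<open>M\<close> under \<open>\<Sigma>\<close>. Hence \<open>\<ell>\<close> spanning elements are
    independent (\<open>independent_of_spanning\<close>).

  \<^item> Characteristic zero. Elements of \<open>M\<close> that are independent modulo the torsion-closure of
    \<open>A\<^sub>+ M\<close> are independent over \<open>A\<close>. The reason is that the polynomial ring is free over \<open>A\<close>, by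
    Chevalley's divided difference argument (\<open>chevalley\<close>), which applies because a Young subgroup is generated
    by transpositions. So there are at most \<open>\<ell>\<close> elements \<open>\<theta>\<^sub>i\<close>; by the graded Nakayama lemma
    (\<open>graded_nakayama\<close>) they generate over \<open>\<rat>\<close>, so there are exactly \<open>\<ell>\<close>
    (\<open>universal_generators\<close>).

  \<^item> Good primes. Let \<open>p\<close> be good. A basis over \<open>F\<^sub>p\<close> has at most \<open>\<ell>\<close> elements, and its image spans
    \<open>M / (A\<^sub>+ M + p M)\<close> over \<open>F\<^sub>p\<close>, whose dimension is therefore at most \<open>\<ell>\<close>. But the \<open>\<ell>\<close> images of
    the \<open>\<theta>\<^sub>i\<close> are independent there, since they are independent modulo \<open>p\<close> even in the quotient of
    \<open>M / A\<^sub>+ M\<close> by torsion. So they span it, and by the Nakayama lemma the \<open>\<theta>\<^sub>i\<close> generate over \<open>F\<^sub>p\<close>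
    (\<open>generators_mod_good_prime\<close>). Being \<open>\<ell>\<close> in number, they are independent.

  \<^item> Transfer. Coefficientwise application of a ring homomorphism from \<open>\<int>\<close> carries these statements
    to the invariants over \<open>F\<^sub>p\<close> and \<open>\<rat>\<close> (\<open>coeff_hom\<close>).
\<close>

section \<open>Integer polynomials\<close>

text \<open>
  Monomials are multisets of variable indices, so the coefficient function of a \<open>zpoly\<close> is already
  a polynomial in the sense of \<open>mpoly\<close>, while the type is an integral domain: the multiset order is a
  linear order on monomials compatible with multiplication.
\<close>

type_synonym zpoly = "nat multiset \<Rightarrow>\<^sub>0 int"

abbreviation coef :: "zpoly \<Rightarrow> nat multiset \<Rightarrow> int"
  where "coef \<equiv> Poly_Mapping.lookup"

abbreviation monoms :: "zpoly \<Rightarrow> nat multiset set"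
  where "monoms \<equiv> Poly_Mapping.keys"

abbreviation zterm :: "nat multiset \<Rightarrow> int \<Rightarrow> zpoly"
  where "zterm \<equiv> Poly_Mapping.single"

lemma of_int_eq_zterm: "of_int k = zterm {#} k"
  using single_of_int[where ?'a="nat multiset" and ?'b=int and k=k] by simp

lemma coef_of_int_mult [simp]: "coef (of_int k * f) m = k * coef f m"
proof -
  have "coef (of_int k * f) m = coef (Poly_Mapping.map ((*) k) f) m"
    by (simp add: mult_map_scale_conv_mult of_int_eq_zterm)
  also have "\<dots> = k * coef f m"
    by (simp add: Poly_Mapping.map.rep_eq when_def)
  finally show ?thesis .
qed

lemma sum_zterms: "f = (\<Sum>m\<in>monoms f. zterm m (coef f m))"
proof (rule poly_mapping_eqI)
  fix m
  show "coef f m = coef (\<Sum>m\<in>monoms f. zterm m (coef f m)) m"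
    by (simp add: lookup_sum lookup_single when_def sum.delta' in_keys_iff)
qed

lemma zpoly_induct [case_names zero add]:
  fixes f :: zpoly
  assumes "P 0" and "\<And>m c g. m \<in> monoms f \<Longrightarrow> P g \<Longrightarrow> P (zterm m c + g)"
  shows "P f"
proof -
  have "P (\<Sum>m\<in>S. zterm m (coef f m))" if "finite S" "S \<subseteq> monoms f" for S
    using that by (induction S) (auto intro: assms)
  from this[of "monoms f"] show ?thesis by (simp flip: sum_zterms)
qed

lemma zterm_eq: "zterm m c = of_int c * zterm m 1"
  by (simp add: of_int_eq_zterm mult_single)

lemma finite_submultisets: "finite {a. a \<subseteq># m}" for m :: "'a multiset"
proof (rule finite_subset)
  show "{a. a \<subseteq># m} \<subseteq> (\<Union>k\<le>size m. multisets_of_size (set_mset m) k)"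
    using set_mset_mono size_mset_mono by (fastforce simp: multisets_of_size_def)
qed auto

lemma coef_mult:
  fixes f g :: zpoly
  shows "coef (f * g) m = (\<Sum>a\<in>{a. a \<subseteq># m}. coef f a * coef g (m - a))"
proof (induction f rule: zpoly_induct)
  case (add m' c f)
  have "coef (zterm m' c * g) m = (if m' \<subseteq># m then c * coef g (m - m') else 0)"
  proof (induction g rule: zpoly_induct)
    case (add k d g)
    have "m' + k = m \<longleftrightarrow> m' \<subseteq># m \<and> k = m - m'"
      by (metis add_diff_cancel_left' mset_subset_eq_add_left subset_mset.add_diff_inverse)
    then show ?case using add
      by (auto simp: distrib_left lookup_add mult_single lookup_single when_def)
  qed simp
  moreover have "(\<Sum>a | a \<subseteq># m. (if m' = a then c else 0) * coef g (m - a)) =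
      (if m' \<subseteq># m then c * coef g (m - m') else 0)"
    using finite_submultisets[of m] by (simp add: if_distrib if_distribR sum.delta cong: if_cong)
  ultimately show ?case using add
    by (simp add: distrib_right lookup_add lookup_single when_def sum.distrib)
qed simp

section \<open>Divisibility by an integer\<close>

lemma of_int_dvd_zpoly_iff: "of_int q dvd f \<longleftrightarrow> (\<forall>m. q dvd coef f m)" for f :: zpoly
proof
  assume *: "\<forall>m. q dvd coef f m"
  have "of_int q dvd (\<Sum>m\<in>monoms f. zterm m (coef f m))"
  proof (rule dvd_sum)
    fix m
    obtain k where "coef f m = q * k" using * by auto
    then have "zterm m (coef f m) = of_int q * zterm m k"
      by (simp add: of_int_eq_zterm mult_single)
    then show "of_int q dvd zterm m (coef f m)" by simp
  qed
  then show "of_int q dvd f" by (simp flip: sum_zterms)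
qed (auto simp: dvd_def)

text \<open>
  The integers \<open>q\<close> for which \<open>\<int>/q\<close> is a domain. Congruence modulo such a \<open>q\<close> is equality over
  the fraction field of \<open>\<int>/q\<close>: over \<open>\<rat>\<close> up to a common denominator for \<open>q = 0\<close>, over a prime field
  otherwise.
\<close>

definition prime_or_zero :: "int \<Rightarrow> bool"
  where "prime_or_zero q \<longleftrightarrow> \<not> q dvd 1 \<and> (\<forall>a b. q dvd a * b \<longrightarrow> q dvd a \<or> q dvd b)"

lemma prime_or_zero_0: "prime_or_zero 0"
  by (simp add: prime_or_zero_def)

lemma prime_or_zero_prime: "Factorial_Ring.prime p \<Longrightarrow> prime_or_zero (int p)"
  by (auto simp: prime_or_zero_def prime_dvd_mult_iff not_prime_unit)

text \<open>
  Gauss's lemma. If \<open>q\<close> divides neither factor, let \<open>u\<close> and \<open>v\<close> be the largest monomials of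
  the factors whose coefficient is not divisible by \<open>q\<close>. Every other contribution to the coefficient
  of the product at \<open>u + v\<close> involves a monomial above \<open>u\<close> or above \<open>v\<close>, so it vanishes modulo \<open>q\<close>.
\<close>

lemma prime_or_zero_dvd_zpoly:
  fixes f g :: zpoly
  assumes q: "prime_or_zero q" and dvd: "of_int q dvd f * g"
  shows "of_int q dvd f \<or> of_int q dvd g"
proof (rule ccontr)
  assume *: "\<not> ?thesis"
  define S where "S h = {m. \<not> q dvd coef h m}" for h
  have fin: "finite (S h)" for h
    by (rule finite_subset[of _ "monoms h"]) (auto simp: S_def in_keys_iff)
  have ne: "S f \<noteq> {}" "S g \<noteq> {}" using * by (auto simp: S_def of_int_dvd_zpoly_iff)
  define u v where "u = Max (S f)" and "v = Max (S g)"
  have u: "u \<in> S f" and v: "v \<in> S g" unfolding u_def v_def by (intro Max_in fin ne)+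
  have uv: "\<And>a. a \<in> S f \<Longrightarrow> a \<le> u" "\<And>a. a \<in> S g \<Longrightarrow> a \<le> v"
    unfolding u_def v_def by (auto intro: Max_ge fin)
  have "q dvd coef f a * coef g (u + v - a)" if "a \<subseteq># u + v" "a \<noteq> u" for a
  proof (rule ccontr)
    assume "\<not> ?thesis"
    then have "a \<in> S f" "u + v - a \<in> S g" by (auto simp: S_def)
    then have "a < u" "u + v - a \<le> v" using uv that(2) by (auto simp: order.strict_iff_order)
    then have "a + (u + v - a) < u + v" by (rule add_less_le_mono)
    then show False using that by simp
  qed
  then have "q dvd (\<Sum>a\<in>{a. a \<subseteq># u + v} - {u}. coef f a * coef g (u + v - a))"
    by (intro dvd_sum) auto
  moreover have "q dvd coef (f * g) (u + v)" using dvd by (auto simp: of_int_dvd_zpoly_iff)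
  moreover have "coef (f * g) (u + v) = coef f u * coef g v +
      (\<Sum>a\<in>{a. a \<subseteq># u + v} - {u}. coef f a * coef g (u + v - a))"
    unfolding coef_mult using sum.remove[OF finite_submultisets[of "u + v"],
        of u "\<lambda>a. coef f a * coef g (u + v - a)"] by simp
  ultimately have "q dvd coef f u * coef g v"
    by (simp add: dvd_add_left_iff)
  then show False using q u v by (auto simp: prime_or_zero_def S_def)
qed

lemma of_int_dvd_of_int_zpoly: "of_int q dvd (of_int k :: zpoly) \<longleftrightarrow> q dvd k"
  unfolding of_int_dvd_zpoly_iff by (auto simp: lookup_of_int when_def dest: spec[of _ "{#}"])

section \<open>Permutations of the variables\<close>

definition permute_poly :: "(nat \<Rightarrow> nat) \<Rightarrow> zpoly \<Rightarrow> zpoly"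
  where "permute_poly \<sigma> f = Poly_Mapping.map_key (image_mset (Hilbert_Choice.inv \<sigma>)) f"

lemma inj_image_mset_inv: "bij \<sigma> \<Longrightarrow> inj (image_mset (Hilbert_Choice.inv \<sigma>))"
  by (intro multiset.inj_map bij_is_inj bij_imp_bij_inv)

lemma coef_permute_poly:
  "bij \<sigma> \<Longrightarrow> coef (permute_poly \<sigma> f) m = coef f (image_mset (Hilbert_Choice.inv \<sigma>) m)"
  by (simp add: permute_poly_def map_key.rep_eq inj_image_mset_inv)

lemma permute_poly_zterm [simp]:
  assumes "bij \<sigma>" shows "permute_poly \<sigma> (zterm m c) = zterm (image_mset \<sigma> m) c"
proof -
  have "image_mset (Hilbert_Choice.inv \<sigma>) (image_mset \<sigma> m) = m"
    using assms by (simp add: multiset.map_comp bij_is_inj)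
  then show ?thesis
    using map_key_single[OF inj_image_mset_inv[OF assms], of "image_mset \<sigma> m" c]
    by (simp add: permute_poly_def)
qed

lemma permute_poly_0 [simp]: "bij \<sigma> \<Longrightarrow> permute_poly \<sigma> 0 = 0"
  by (simp add: permute_poly_def inj_image_mset_inv)

lemma permute_poly_add [simp]:
  "bij \<sigma> \<Longrightarrow> permute_poly \<sigma> (f + g) = permute_poly \<sigma> f + permute_poly \<sigma> g"
  by (simp add: permute_poly_def inj_image_mset_inv map_key_plus)

lemma permute_poly_minus [simp]:
  assumes "bij \<sigma>" shows "permute_poly \<sigma> (f - g) = permute_poly \<sigma> f - permute_poly \<sigma> g"
  using permute_poly_add[OF assms, of "f - g" g] by (simp add: eq_diff_eq)

lemma permute_poly_uminus [simp]: "bij \<sigma> \<Longrightarrow> permute_poly \<sigma> (- f) = - permute_poly \<sigma> f"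
  using permute_poly_minus[of \<sigma> 0 f] by simp

lemma permute_poly_of_int [simp]: "bij \<sigma> \<Longrightarrow> permute_poly \<sigma> (of_int k) = of_int k"
  by (simp add: of_int_eq_zterm)

lemma permute_poly_1 [simp]: "bij \<sigma> \<Longrightarrow> permute_poly \<sigma> 1 = 1"
  using permute_poly_of_int[of \<sigma> 1] by simp

lemma permute_poly_mult [simp]:
  assumes \<sigma>: "bij \<sigma>" shows "permute_poly \<sigma> (f * g) = permute_poly \<sigma> f * permute_poly \<sigma> g"
proof (induction f rule: zpoly_induct)
  case (add m c f)
  have "permute_poly \<sigma> (zterm m c * g) = permute_poly \<sigma> (zterm m c) * permute_poly \<sigma> g"
  proof (induction g rule: zpoly_induct)
    case (add k d g)
    then show ?case by (simp add: distrib_left mult_single \<sigma>)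
  qed (simp add: \<sigma>)
  with add show ?case by (simp add: distrib_right \<sigma>)
qed (simp add: \<sigma>)

lemma permute_poly_sum:
  "bij \<sigma> \<Longrightarrow> permute_poly \<sigma> (\<Sum>i\<in>I. f i) = (\<Sum>i\<in>I. permute_poly \<sigma> (f i))"
  by (induction I rule: infinite_finite_induct) auto

lemma permute_poly_prod:
  "bij \<sigma> \<Longrightarrow> permute_poly \<sigma> (\<Prod>i\<in>I. f i) = (\<Prod>i\<in>I. permute_poly \<sigma> (f i))"
  by (induction I rule: infinite_finite_induct) auto

lemma permute_poly_power: "bij \<sigma> \<Longrightarrow> permute_poly \<sigma> (f ^ k) = permute_poly \<sigma> f ^ k"
  by (induction k) auto

lemma permute_poly_comp:
  assumes "bij \<sigma>" "bij \<tau>"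
  shows "permute_poly (\<sigma> \<circ> \<tau>) f = permute_poly \<sigma> (permute_poly \<tau> f)"
  using assms by (intro poly_mapping_eqI)
    (simp add: coef_permute_poly bij_comp o_inv_distrib multiset.map_comp)

lemma permute_poly_id [simp]: "permute_poly id f = f"
  by (intro poly_mapping_eqI) (simp add: coef_permute_poly)

lemma permute_poly_inv_cancel [simp]:
  assumes "bij \<sigma>"
  shows "permute_poly \<sigma> (permute_poly (Hilbert_Choice.inv \<sigma>) f) = f"
    and "permute_poly (Hilbert_Choice.inv \<sigma>) (permute_poly \<sigma> f) = f"
  using permute_poly_comp[OF assms bij_imp_bij_inv[OF assms], of f]
    permute_poly_comp[OF bij_imp_bij_inv[OF assms] assms, of f] assms
  by (auto simp: surj_iff[THEN iffD1, OF bij_is_surj] inj_iff[THEN iffD1, OF bij_is_inj])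

lemma of_int_dvd_permute_poly:
  assumes "bij \<sigma>" "of_int q dvd f" shows "of_int q dvd permute_poly \<sigma> f"
  using assms by (auto simp: dvd_def)

lemma monoms_permute_poly: "bij \<sigma> \<Longrightarrow> m \<in> monoms (permute_poly \<sigma> f) \<longleftrightarrow>
    image_mset (Hilbert_Choice.inv \<sigma>) m \<in> monoms f"
  by (simp add: in_keys_iff coef_permute_poly)

section \<open>Homogeneous components\<close>

text \<open>
  The homogeneous component of degree \<open>d\<close>. Homogeneity of degree \<open>d\<close> is expressed by
  \<open>hcomp d f = f\<close>, which makes zero homogeneous of every degree.
\<close>

definition hcomp :: "nat \<Rightarrow> zpoly \<Rightarrow> zpoly"
  where "hcomp d f = (\<Sum>m\<in>{m\<in>monoms f. size m = d}. zterm m (coef f m))"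

lemma coef_hcomp: "coef (hcomp d f) m = (if size m = d then coef f m else 0)"
  by (simp add: hcomp_def lookup_sum lookup_single when_def sum.delta' in_keys_iff)

lemma monoms_hcomp: "monoms (hcomp d f) = {m\<in>monoms f. size m = d}"
  by (auto simp: in_keys_iff coef_hcomp split: if_splits)

lemma hcomp_add: "hcomp d (f + g) = hcomp d f + hcomp d g"
  by (intro poly_mapping_eqI) (simp add: coef_hcomp lookup_add)

lemma hcomp_diff: "hcomp d (f - g) = hcomp d f - hcomp d g"
  by (intro poly_mapping_eqI) (simp add: coef_hcomp lookup_minus)

lemma hcomp_0 [simp]: "hcomp d 0 = 0"
  by (intro poly_mapping_eqI) (simp add: coef_hcomp)

lemma hcomp_of_int_mult: "hcomp d (of_int k * f) = of_int k * hcomp d f"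
  by (intro poly_mapping_eqI) (simp add: coef_hcomp)

lemma hcomp_sum: "hcomp d (\<Sum>i\<in>I. f i) = (\<Sum>i\<in>I. hcomp d (f i))"
  by (induction I rule: infinite_finite_induct) (auto simp: hcomp_add)

lemma hcomp_zterm: "hcomp d (zterm m c) = (if size m = d then zterm m c else 0)"
  by (intro poly_mapping_eqI) (auto simp: coef_hcomp lookup_single when_def)

lemma hcomp_permute: "bij \<sigma> \<Longrightarrow> hcomp d (permute_poly \<sigma> f) = permute_poly \<sigma> (hcomp d f)"
  by (intro poly_mapping_eqI) (auto simp: coef_hcomp coef_permute_poly)

lemma sum_hcomp:
  assumes "\<And>m. m \<in> monoms f \<Longrightarrow> size m \<le> D"
  shows "f = (\<Sum>d\<le>D. hcomp d f)"
proof (rule poly_mapping_eqI)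
  fix m
  show "coef f m = coef (\<Sum>d\<le>D. hcomp d f) m"
    using assms[of m] by (auto simp: lookup_sum coef_hcomp sum.delta' in_keys_iff)
qed

lemma hcomp_mult: "hcomp d (f * g) = (\<Sum>e\<le>d. hcomp e f * hcomp (d - e) g)"
proof (induction f rule: zpoly_induct)
  case (add m c f)
  have "hcomp d (zterm m c * g) = (\<Sum>e\<le>d. hcomp e (zterm m c) * hcomp (d - e) g)"
  proof (induction g rule: zpoly_induct)
    case (add k b g)
    have "(\<Sum>e\<le>d. hcomp e (zterm m c) * hcomp (d - e) (zterm k b)) =
        (\<Sum>e\<le>d. if e = size m then zterm m c * hcomp (d - e) (zterm k b) else 0)"
      by (intro sum.cong) (auto simp: hcomp_zterm)
    also have "\<dots> = hcomp d (zterm m c * zterm k b)"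
      by (auto simp: sum.delta' hcomp_zterm mult_single)
    finally show ?case using add by (simp add: distrib_left hcomp_add sum.distrib)
  qed simp
  with add show ?case by (simp add: distrib_right hcomp_add sum.distrib)
qed simp

section \<open>Linear algebra modulo a prime element\<close>

definition is_subring :: "'r::comm_ring_1 set \<Rightarrow> bool"
  where "is_subring S \<longleftrightarrow> 1 \<in> S \<and> (\<forall>x\<in>S. \<forall>y\<in>S. x - y \<in> S \<and> x * y \<in> S)"

lemma is_subringD:
  assumes "is_subring S"
  shows "1 \<in> S" "0 \<in> S" "\<And>x y. x \<in> S \<Longrightarrow> y \<in> S \<Longrightarrow> x - y \<in> S"
    "\<And>x y. x \<in> S \<Longrightarrow> y \<in> S \<Longrightarrow> x * y \<in> S"
    "\<And>x. x \<in> S \<Longrightarrow> - x \<in> S" "\<And>x y. x \<in> S \<Longrightarrow> y \<in> S \<Longrightarrow> x + y \<in> S"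
proof -
  show 1: "1 \<in> S" and d: "\<And>x y. x \<in> S \<Longrightarrow> y \<in> S \<Longrightarrow> x - y \<in> S"
    and "\<And>x y. x \<in> S \<Longrightarrow> y \<in> S \<Longrightarrow> x * y \<in> S"
    using assms by (auto simp: is_subring_def)
  show 0: "0 \<in> S" using d[OF 1 1] by simp
  show m: "\<And>x. x \<in> S \<Longrightarrow> - x \<in> S" using d[OF 0] by simp
  show "\<And>x y. x \<in> S \<Longrightarrow> y \<in> S \<Longrightarrow> x + y \<in> S" using d[OF _ m] by simp
qed

lemma is_subring_sum:
  "is_subring S \<Longrightarrow> (\<And>i. i \<in> I \<Longrightarrow> f i \<in> S) \<Longrightarrow> (\<Sum>i\<in>I. f i) \<in> S"
  by (induction I rule: infinite_finite_induct) (auto intro: is_subringD)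

lemma is_subring_prod:
  "is_subring S \<Longrightarrow> (\<And>i. i \<in> I \<Longrightarrow> f i \<in> S) \<Longrightarrow> (\<Prod>i\<in>I. f i) \<in> S"
  by (induction I rule: infinite_finite_induct) (auto intro: is_subringD)

lemma is_subring_power: "is_subring S \<Longrightarrow> x \<in> S \<Longrightarrow> x ^ k \<in> S"
  by (induction k) (auto intro: is_subringD)

lemma is_subring_of_int: "is_subring S \<Longrightarrow> of_int k \<in> S"
proof (induction k rule: int_induct[of _ 0])
qed (auto intro: is_subringD)

text \<open>
  Gaussian elimination without division: a homogeneous system with fewer equations than unknowns has
  a solution that is nontrivial modulo a prime element. The unknowns range over a subring so
  that the lemma applies to integers, to polynomials and to invariants alike.
\<close>

lemma underdetermined_system:
  fixes q :: "'r::comm_ring_1"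
  assumes prime: "\<And>x y. q dvd x * y \<Longrightarrow> q dvd x \<or> q dvd y" and unit: "\<not> q dvd 1"
    and S: "is_subring S"
    and "finite I" "finite J" "card I < card J" and "\<And>j i. j \<in> J \<Longrightarrow> i \<in> I \<Longrightarrow> t j i \<in> S"
  shows "\<exists>z. (\<forall>j\<in>J. z j \<in> S) \<and> (\<exists>j\<in>J. \<not> q dvd z j) \<and> (\<forall>i\<in>I. q dvd (\<Sum>j\<in>J. z j * t j i))"
  using assms(4-)
proof (induction I arbitrary: J t rule: finite_induct)
  case empty
  then have "J \<noteq> {}" by auto
  then show ?case using S unit by (intro exI[of _ "\<lambda>_. 1"]) (auto intro: is_subringD)
next
  case (insert i0 I)
  show ?case
  proof (cases "\<forall>j\<in>J. q dvd t j i0")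
    case True
    have "\<exists>z. (\<forall>j\<in>J. z j \<in> S) \<and> (\<exists>j\<in>J. \<not> q dvd z j) \<and> (\<forall>i\<in>I. q dvd (\<Sum>j\<in>J. z j * t j i))"
      using insert by (intro insert.IH) auto
    with True show ?thesis by (auto intro!: dvd_sum)
  next
    case False
    then obtain j0 where j0: "j0 \<in> J" "\<not> q dvd t j0 i0" by auto
    define t' where "t' j i = t j0 i0 * t j i - t j i0 * t j0 i" for j i
    have "\<exists>z. (\<forall>j\<in>J - {j0}. z j \<in> S) \<and> (\<exists>j\<in>J - {j0}. \<not> q dvd z j) \<and>
      (\<forall>i\<in>I. q dvd (\<Sum>j\<in>J - {j0}. z j * t' j i))"
      using insert.prems insert.hyps j0
      by (intro insert.IH) (auto simp: t'_def intro!: is_subringD[OF S])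
    then obtain z where z: "\<And>j. j \<in> J \<Longrightarrow> j \<noteq> j0 \<Longrightarrow> z j \<in> S"
      "\<exists>j\<in>J - {j0}. \<not> q dvd z j" "\<And>i. i \<in> I \<Longrightarrow> q dvd (\<Sum>j\<in>J - {j0}. z j * t' j i)" by auto
    define z' where "z' j = (if j = j0 then - (\<Sum>j\<in>J - {j0}. z j * t j i0) else z j * t j0 i0)" for j
    have eq: "(\<Sum>j\<in>J. z' j * t j i) = (\<Sum>j\<in>J - {j0}. z j * t' j i)" for i
    proof -
      have "(\<Sum>j\<in>J. z' j * t j i) = z' j0 * t j0 i + (\<Sum>j\<in>J - {j0}. z' j * t j i)"
        using insert.prems j0 by (intro sum.remove) auto
      also have "\<dots> = (\<Sum>j\<in>J - {j0}. z j * t' j i)"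
        by (simp add: z'_def t'_def sum_distrib_right sum_distrib_left sum_subtractf algebra_simps)
      finally show ?thesis .
    qed
    show ?thesis
    proof (intro exI[of _ z'] conjI ballI)
      show "z' j \<in> S" if "j \<in> J" for j
        using that z j0 insert.prems
        by (auto simp: z'_def intro!: is_subringD[OF S] is_subring_sum[OF S])
      obtain j1 where "j1 \<in> J" "j1 \<noteq> j0" "\<not> q dvd z j1" using z(2) by auto
      then show "\<exists>j\<in>J. \<not> q dvd z' j"
        using prime[of "z j1" "t j0 i0"] j0 by (auto simp: z'_def intro!: bexI[of _ j1])
      show "q dvd (\<Sum>j\<in>J. z' j * t j i)" if "i \<in> insert i0 I" for i
        unfolding eq using that z(3) by (auto simp: t'_def)
    qed
  qed
qed

text \<open>
  A polynomial over a domain with more roots than its degree is zero; here the domain is the quotient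
  by \<open>q\<close>, and the roots are split off one at a time by synthetic division.
\<close>

lemma poly_coeffs_dvd_of_many_roots:
  fixes P :: "'r::comm_ring_1 Polynomial.poly"
  assumes prime: "\<And>x y. q dvd x * y \<Longrightarrow> q dvd x \<or> q dvd y"
    and "finite Y" "Polynomial.degree P < card Y"
    and "\<And>y. y \<in> Y \<Longrightarrow> q dvd Polynomial.poly P y"
    and "\<And>y y'. y \<in> Y \<Longrightarrow> y' \<in> Y \<Longrightarrow> y \<noteq> y' \<Longrightarrow> \<not> q dvd y - y'"
  shows "q dvd Polynomial.coeff P i"
  using assms(2-)
proof (induction Y arbitrary: P i rule: finite_induct)
  case (insert y Y)
  define s where "s = synthetic_div P y"
  have P: "P = [:- y, 1:] * s + [:Polynomial.poly P y:]"
    unfolding s_def by (simp only: synthetic_div_correct')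
  have s: "q dvd Polynomial.coeff s i" for i
  proof (cases "Y = {}")
    case True
    then have "Polynomial.degree P = 0" using insert by simp
    then have "s = 0" by (simp add: s_def synthetic_div_eq_0_iff)
    then show ?thesis by simp
  next
    case False
    then have "card Y > 0" using insert by (simp add: card_gt_0_iff)
    then have deg: "Polynomial.degree s < card Y"
      using insert by (simp add: s_def degree_synthetic_div)
    show ?thesis
    proof (rule insert.IH[OF deg])
      fix x assume x: "x \<in> Y"
      have "Polynomial.poly P x = (x - y) * Polynomial.poly s x + Polynomial.poly P y"
        by (subst P) (simp add: algebra_simps)
      moreover have "q dvd Polynomial.poly P x" "q dvd Polynomial.poly P y"
        using insert.prems x by auto
      ultimately have "q dvd (x - y) * Polynomial.poly s x"
        by (simp add: dvd_add_left_iff)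
      moreover have "\<not> q dvd x - y" using insert.prems(3)[of x y] insert.hyps x by auto
      ultimately show "q dvd Polynomial.poly s x" using prime by blast
    qed (use insert.prems in auto)
  qed
  have "q dvd Polynomial.poly P y" using insert.prems by auto
  then show ?case
    by (subst P) (auto intro!: dvd_add dvd_diff dvd_mult s simp: coeff_pCons split: nat.split)
qed simp

section \<open>Bases of torsion-free quotients\<close>

text \<open>
  Let \<open>L/P\<close> be torsion-free. A generating family with a nontrivial relation can be replaced by a
  smaller one. If only one coefficient of the relation is nonzero, torsion-freeness puts that
  generator into \<open>P\<close>. Otherwise adding plus or minus one generator to another, as in the Euclidean
  algorithm, decreases the sum of the absolute values of the coefficients.
\<close>

lemma shrink_generators:
  fixes P L :: "'r::comm_ring_1 set" and z :: "'i \<Rightarrow> int" and g :: "'i \<Rightarrow> 'r"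
  assumes Padd: "\<And>x y. x \<in> P \<Longrightarrow> y \<in> P \<Longrightarrow> x + y \<in> P"
    and Pm: "\<And>k x. x \<in> P \<Longrightarrow> of_int k * x \<in> P"
    and sat: "\<And>k x. k \<noteq> 0 \<Longrightarrow> of_int k * x \<in> P \<Longrightarrow> x \<in> P"
    and Xadd: "\<And>x y. x \<in> L \<Longrightarrow> y \<in> L \<Longrightarrow> x + y \<in> L"
    and Xm: "\<And>k x. x \<in> L \<Longrightarrow> of_int k * x \<in> L"
    and I: "finite I" and "\<And>i. i \<in> I \<Longrightarrow> g i \<in> L"
    and "\<And>x. x \<in> L \<Longrightarrow> \<exists>w. x - (\<Sum>i\<in>I. of_int (w i) * g i) \<in> P"
    and "(\<Sum>i\<in>I. of_int (z i) * g i) \<in> P" and "\<exists>i\<in>I. z i \<noteq> 0"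
  shows "\<exists>i\<in>I. \<exists>g'. (\<forall>j\<in>I - {i}. g' j \<in> L) \<and>
    (\<forall>x\<in>L. \<exists>w. x - (\<Sum>j\<in>I - {i}. of_int (w j) * g' j) \<in> P)"
  using assms(7-)
proof (induction "\<Sum>i\<in>I. nat \<bar>z i\<bar>" arbitrary: g z rule: less_induct)
  case less
  obtain i1 where i1: "i1 \<in> I" "z i1 \<noteq> 0" using less.prems by auto
  show ?case
  proof (cases "\<forall>i\<in>I. i \<noteq> i1 \<longrightarrow> z i = 0")
    case True
    have "(\<Sum>i\<in>I. of_int (z i) * g i) = of_int (z i1) * g i1"
      using I i1 True by (subst sum.remove[of _ i1]) (auto intro!: sum.neutral)
    then have g1: "g i1 \<in> P" using less.prems(3) sat i1 by auto
    show ?thesis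
    proof (intro bexI[of _ i1] exI[of _ g] conjI ballI)
      fix x assume "x \<in> L"
      then obtain w where "x - (\<Sum>i\<in>I. of_int (w i) * g i) \<in> P" using less.prems(2) by blast
      from Padd[OF this Pm[OF g1, of "w i1"]] I i1
      have "x - (\<Sum>i\<in>I - {i1}. of_int (w i) * g i) \<in> P"
        by (subst (asm) sum.remove[of _ i1]) (auto simp: algebra_simps)
      then show "\<exists>w. x - (\<Sum>i\<in>I - {i1}. of_int (w i) * g i) \<in> P" by blast
    qed (use less.prems i1 in auto)
  next
    case False
    then obtain i2 where i2: "i2 \<in> I" "i2 \<noteq> i1" "z i2 \<noteq> 0" by auto
    obtain i j where ij: "i \<in> I" "j \<in> I" "i \<noteq> j" "z i \<noteq> 0" "z j \<noteq> 0" "\<bar>z j\<bar> \<le> \<bar>z i\<bar>"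
      using i1 i2 by (metis nle_le)
    \<comment> \<open>With this sign, \<open>\<bar>z i - s * z j\<bar> = \<bar>z i\<bar> - \<bar>z j\<bar>\<close>.\<close>
    define s where "s = sgn (z i) * sgn (z j)"
    define g' where "g' = g(j := g j + of_int s * g i)"
    define tr where "tr w = w(i := w i - s * w j)" for w :: "'i \<Rightarrow> int"
    have split: "(\<Sum>k\<in>I. h k) = h i + (h j + (\<Sum>k\<in>I - {i} - {j}. h k))" for h :: "'i \<Rightarrow> 'c::comm_monoid_add"
      using I ij by (simp add: sum.remove[of I i] sum.remove[of "I - {i}" j])
    have tr: "(\<Sum>k\<in>I. of_int (tr w k) * g' k) = (\<Sum>k\<in>I. of_int (w k) * g k)" for w
    proof -
      have "(\<Sum>k\<in>I - {i} - {j}. of_int (tr w k) * g' k) = (\<Sum>k\<in>I - {i} - {j}. of_int (w k) * g k)"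
        by (intro sum.cong) (auto simp: tr_def g'_def)
      then show ?thesis unfolding split using ij by (simp add: tr_def g'_def algebra_simps)
    qed
    have "(\<Sum>k\<in>I. nat \<bar>tr z k\<bar>) < (\<Sum>k\<in>I. nat \<bar>z k\<bar>)"
    proof -
      have "(\<Sum>k\<in>I - {i} - {j}. nat \<bar>tr z k\<bar>) = (\<Sum>k\<in>I - {i} - {j}. nat \<bar>z k\<bar>)"
        by (intro sum.cong) (auto simp: tr_def)
      moreover have "\<bar>z i - s * z j\<bar> < \<bar>z i\<bar>"
        using ij by (auto simp: s_def sgn_if split: if_splits)
      ultimately show ?thesis unfolding split using ij by (simp add: tr_def)
    qed
    moreover have "g' k \<in> L" if "k \<in> I" for k
      using that ij less.prems(1) by (auto simp: g'_def intro!: Xadd Xm)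
    moreover have "\<exists>w. x - (\<Sum>i\<in>I. of_int (w i) * g' i) \<in> P" if x: "x \<in> L" for x
    proof -
      obtain w where "x - (\<Sum>i\<in>I. of_int (w i) * g i) \<in> P" using less.prems(2)[OF x] by blast
      then show ?thesis by (metis tr)
    qed
    moreover have "(\<Sum>k\<in>I. of_int (tr z k) * g' k) \<in> P" using less.prems tr by simp
    moreover have "\<exists>k\<in>I. tr z k \<noteq> 0" using ij by (intro bexI[of _ j]) (auto simp: tr_def)
    ultimately show ?thesis by (rule less.hyps)
  qed
qed

text \<open>
  A finitely generated torsion-free abelian group \<open>L/P\<close> is free: by the previous lemma a generating
  family with the least number of elements satisfies no relation.
\<close>

lemma saturated_quotient_basis:
  fixes P L :: "'r::comm_ring_1 set"
  assumes P0: "0 \<in> P" and Padd: "\<And>x y. x \<in> P \<Longrightarrow> y \<in> P \<Longrightarrow> x + y \<in> P"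
    and Pm: "\<And>k x. x \<in> P \<Longrightarrow> of_int k * x \<in> P"
    and sat: "\<And>k x. k \<noteq> 0 \<Longrightarrow> of_int k * x \<in> P \<Longrightarrow> x \<in> P"
    and Xadd: "\<And>x y. x \<in> L \<Longrightarrow> y \<in> L \<Longrightarrow> x + y \<in> L"
    and Xm: "\<And>k x. x \<in> L \<Longrightarrow> of_int k * x \<in> L"
    and gens: "finite B0" "B0 \<subseteq> L" "\<And>x. x \<in> L \<Longrightarrow> \<exists>w. x = (\<Sum>b\<in>B0. of_int (w b) * b)"
  obtains B where "finite B" "B \<subseteq> L" "\<And>x. x \<in> L \<Longrightarrow> \<exists>w. x - (\<Sum>b\<in>B. of_int (w b) * b) \<in> P"
    "\<And>z b. (\<Sum>b\<in>B. of_int (z b) * b) \<in> P \<Longrightarrow> b \<in> B \<Longrightarrow> z b = 0"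
proof -
  define gen where "gen I g \<longleftrightarrow> finite I \<and> (\<forall>i\<in>I. g i \<in> L) \<and>
    (\<forall>x\<in>L. \<exists>w. x - (\<Sum>i\<in>I. of_int (w i) * g i) \<in> P)" for I :: "'r set" and g
  have "gen B0 id" unfolding gen_def
  proof (intro conjI ballI)
    fix x assume "x \<in> L"
    then obtain w where "x = (\<Sum>b\<in>B0. of_int (w b) * b)" using gens(3) by blast
    then show "\<exists>w. x - (\<Sum>i\<in>B0. of_int (w i) * id i) \<in> P"
      using P0 by (intro exI[of _ w]) simp
  qed (use gens in auto)
  then obtain I g where g: "gen I g" and min: "\<And>I' g'. gen I' g' \<Longrightarrow> card I \<le> card I'"
    using ex_has_least_nat[of "\<lambda>(I, g). gen I g" "(B0, id)" "\<lambda>(I, g). card I"] by auto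
  have fin: "finite I" and gL: "\<And>i. i \<in> I \<Longrightarrow> g i \<in> L"
    and gs: "\<And>x. x \<in> L \<Longrightarrow> \<exists>w. x - (\<Sum>i\<in>I. of_int (w i) * g i) \<in> P"
    using g by (auto simp: gen_def)
  have indep: "z i = 0" if z: "(\<Sum>i\<in>I. of_int (z i) * g i) \<in> P" and "i \<in> I" for z i
  proof (rule ccontr)
    assume "z i \<noteq> 0"
    then have ex: "\<exists>i\<in>I. z i \<noteq> 0" using \<open>i \<in> I\<close> by blast
    have "\<exists>i\<in>I. \<exists>g'. (\<forall>j\<in>I - {i}. g' j \<in> L) \<and>
      (\<forall>x\<in>L. \<exists>w. x - (\<Sum>j\<in>I - {i}. of_int (w j) * g' j) \<in> P)"
      by (rule shrink_generators[OF Padd Pm sat Xadd Xm fin gL gs z ex])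
    then obtain i g' where i: "i \<in> I" "\<forall>j\<in>I - {i}. g' j \<in> L"
        "\<forall>x\<in>L. \<exists>w. x - (\<Sum>j\<in>I - {i}. of_int (w j) * g' j) \<in> P"
      by (elim bexE exE conjE)
    then have "gen (I - {i}) g'" using fin by (auto simp: gen_def)
    from min[OF this] show False using i fin by (metis card_Diff1_less not_less)
  qed
  have inj: "inj_on g I"
  proof (rule inj_onI, rule ccontr)
    fix i j assume ij: "i \<in> I" "j \<in> I" "g i = g j" "i \<noteq> j"
    define z where "z = (\<lambda>k. if k = i then 1 else if k = j then - 1 else 0 :: int)"
    have "(\<Sum>k\<in>I. of_int (z k) * g k) = (\<Sum>k\<in>{i, j}. of_int (z k) * g k)"
      using ij fin by (intro sum.mono_neutral_right) (auto simp: z_def)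
    also have "\<dots> = 0" using ij by (simp add: z_def)
    finally have "(\<Sum>k\<in>I. of_int (z k) * g k) = 0" .
    then have "z i = 0" using P0 ij by (intro indep) auto
    then show False by (simp add: z_def)
  qed
  show ?thesis
  proof (rule that[of "g ` I"])
    show "\<exists>w. x - (\<Sum>b\<in>g ` I. of_int (w b) * b) \<in> P" if x: "x \<in> L" for x
    proof -
      obtain w where "x - (\<Sum>i\<in>I. of_int (w i) * g i) \<in> P" using gs[OF x] by blast
      then show ?thesis
        by (intro exI[of _ "\<lambda>b. w (the_inv_into I g b)"])
          (simp add: sum.reindex[OF inj] the_inv_into_f_f[OF inj])
    qed
    show "z b = 0" if "(\<Sum>b\<in>g ` I. of_int (z b) * b) \<in> P" "b \<in> g ` I" for z b
      using indep[of "\<lambda>i. z (g i)"] that by (auto simp: sum.reindex[OF inj])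
  qed (use fin gL in auto)
qed

section \<open>Integral invariants of permutation groups\<close>

definition zpolys :: "nat \<Rightarrow> zpoly set"
  where "zpolys n = {f. \<forall>m\<in>monoms f. set_mset m \<subseteq> {1..n}}"

definition zinvariants :: "nat \<Rightarrow> (nat \<Rightarrow> nat) set \<Rightarrow> zpoly set"
  where "zinvariants n H = {f \<in> zpolys n. \<forall>\<sigma>\<in>H. permute_poly \<sigma> f = f}"

lemma zpolys_add: "f \<in> zpolys n \<Longrightarrow> g \<in> zpolys n \<Longrightarrow> f + g \<in> zpolys n"
  using keys_add[of f g] by (fastforce simp: zpolys_def)

lemma zpolys_mult:
  assumes "f \<in> zpolys n" "g \<in> zpolys n" shows "f * g \<in> zpolys n"
  unfolding zpolys_def
proof safe
  fix m i assume m: "m \<in> monoms (f * g)" "i \<in># m"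
  then obtain a b where "m = a + b" "a \<in> monoms f" "b \<in> monoms g" using keys_mult[of f g] by auto
  then have "set_mset a \<subseteq> {1..n}" "set_mset b \<subseteq> {1..n}" "i \<in># a \<or> i \<in># b"
    using assms m by (auto simp: zpolys_def simp del: atLeastAtMost_iff)
  then show "i \<in> {1..n}" by blast
qed

lemma zpolys_zterm [simp]: "zterm m c \<in> zpolys n \<longleftrightarrow> c = 0 \<or> set_mset m \<subseteq> {1..n}"
  by (auto simp: zpolys_def)

lemma is_subring_zpolys: "is_subring (zpolys n)"
  unfolding is_subring_def
proof safe
  show "1 \<in> zpolys n" by (simp add: zpolys_def)
  show "f - g \<in> zpolys n" if "f \<in> zpolys n" "g \<in> zpolys n" for f g
  proof -
    have "- g \<in> zpolys n" using that(2) unfolding zpolys_def by (simp only: keys_minus mem_Collect_eq)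
    from zpolys_add[OF that(1) this] show ?thesis by (simp only: add_uminus_conv_diff)
  qed
qed (rule zpolys_mult)

lemma zpolys_permute_poly:
  assumes "\<sigma> permutes {1..n}" "f \<in> zpolys n" shows "permute_poly \<sigma> f \<in> zpolys n"
  unfolding zpolys_def
proof safe
  fix m i assume m: "m \<in> monoms (permute_poly \<sigma> f)" "i \<in># m"
  have "image_mset (Hilbert_Choice.inv \<sigma>) m \<in> monoms f"
    using m assms by (simp add: monoms_permute_poly permutes_bij)
  then have "set_mset (image_mset (Hilbert_Choice.inv \<sigma>) m) \<subseteq> {1..n}"
    using assms unfolding zpolys_def by blast
  then have "Hilbert_Choice.inv \<sigma> i \<in> {1..n}" using m by (auto simp del: atLeastAtMost_iff)
  then show "i \<in> {1..n}" using permutes_in_image[OF permutes_inv[OF assms(1)]] by blast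
qed

lemma zpolys_hcomp: "f \<in> zpolys n \<Longrightarrow> hcomp d f \<in> zpolys n"
  by (auto simp: zpolys_def monoms_hcomp)

lemma zpolys_of_int_dvd:
  assumes "of_int q * f \<in> zpolys n" "q \<noteq> 0" shows "f \<in> zpolys n"
proof -
  have "monoms (of_int q * f) = monoms f" using assms by (auto simp: in_keys_iff)
  with assms show ?thesis by (simp add: zpolys_def)
qed

text \<open>
  The exponent of \<open>x\<^sub>i\<close> is \<open>i\<close>. These exponents are distinct, so the monomial
  \<open>x\<^sub>1 x\<^sub>2\<^sup>2 \<dots> x\<^sub>n\<^sup>n\<close> is moved by every permutation other than the identity.
\<close>

definition staircase :: "nat \<Rightarrow> nat multiset"
  where "staircase n = (\<Sum>i\<in>{1..n}. replicate_mset i i)"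

lemma count_staircase: "i \<in> {1..n} \<Longrightarrow> count (staircase n) i = i"
  by (simp add: staircase_def count_sum sum.delta)

lemma set_staircase: "set_mset (staircase n) \<subseteq> {1..n}"
  by (auto simp: staircase_def set_mset_sum)

lemma count_image_mset_bij: "bij \<sigma> \<Longrightarrow> count (image_mset \<sigma> m) (\<sigma> i) = count m i"
  by (induction m) (auto simp: bij_is_inj inj_eq)

lemma staircase_free:
  assumes "\<sigma> permutes {1..n}" "\<tau> permutes {1..n}"
    and eq: "image_mset \<sigma> (staircase n) = image_mset \<tau> (staircase n)"
  shows "\<sigma> = \<tau>"
proof
  fix i
  show "\<sigma> i = \<tau> i"
  proof (cases "i \<in> {1..n}")
    case True
    define j where "j = Hilbert_Choice.inv \<tau> (\<sigma> i)"
    have \<tau>j: "\<tau> j = \<sigma> i" using assms by (simp add: j_def permutes_inverses)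
    have "\<sigma> i \<in> {1..n}" using permutes_in_image[OF assms(1)] True by blast
    then have j: "j \<in> {1..n}" unfolding j_def
      using permutes_in_image[OF permutes_inv[OF assms(2)]] by blast
    have "i = count (image_mset \<sigma> (staircase n)) (\<sigma> i)"
      using count_image_mset_bij[OF permutes_bij[OF assms(1)], of "staircase n" i]
      by (simp only: count_staircase[OF True])
    also have "\<dots> = j"
      using j assms count_image_mset_bij[of \<tau> "staircase n" j]
      by (simp add: eq \<tau>j permutes_bij count_staircase del: atLeastAtMost_iff)
    finally show ?thesis using \<tau>j by simp
  qed (use assms in \<open>simp add: permutes_not_in\<close>)
qed

locale perm_group =
  fixes n :: nat and H :: "(nat \<Rightarrow> nat) set"
  assumes permutes: "\<sigma> \<in> H \<Longrightarrow> \<sigma> permutes {1..n}"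
    and id_mem: "id \<in> H"
    and comp_mem: "\<sigma> \<in> H \<Longrightarrow> \<tau> \<in> H \<Longrightarrow> \<sigma> \<circ> \<tau> \<in> H"
    and inv_mem: "\<sigma> \<in> H \<Longrightarrow> Hilbert_Choice.inv \<sigma> \<in> H"
begin

lemma bij: "\<sigma> \<in> H \<Longrightarrow> bij \<sigma>"
  using permutes permutes_bij by blast

lemma finite_group: "finite H"
  by (rule finite_subset[OF _ finite_permutations[of "{1..n}"]]) (auto dest: permutes)

lemma card_pos: "card H > 0"
  using finite_group id_mem by (auto simp: card_gt_0_iff)

lemma invariantsD: "f \<in> zinvariants n H \<Longrightarrow> \<sigma> \<in> H \<Longrightarrow> permute_poly \<sigma> f = f"
  by (simp add: zinvariants_def)

lemma invariants_zpolys: "f \<in> zinvariants n H \<Longrightarrow> f \<in> zpolys n"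
  by (simp add: zinvariants_def)

lemma is_subring_invariants: "is_subring (zinvariants n H)"
  using is_subring_zpolys[of n] by (auto simp: is_subring_def zinvariants_def bij)

lemmas invariants_1 = is_subringD(1)[OF is_subring_invariants]
  and invariants_0 = is_subringD(2)[OF is_subring_invariants]
  and invariants_diff = is_subringD(3)[OF is_subring_invariants]
  and invariants_mult = is_subringD(4)[OF is_subring_invariants]
  and invariants_uminus = is_subringD(5)[OF is_subring_invariants]
  and invariants_add = is_subringD(6)[OF is_subring_invariants]
  and invariants_sum = is_subring_sum[OF is_subring_invariants]
  and invariants_of_int = is_subring_of_int[OF is_subring_invariants]
  and invariants_power = is_subring_power[OF is_subring_invariants]

lemma invariants_hcomp: "f \<in> zinvariants n H \<Longrightarrow> hcomp d f \<in> zinvariants n H"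
  by (auto simp: zinvariants_def zpolys_hcomp bij simp flip: hcomp_permute)

lemma invariants_of_int_dvd:
  assumes "of_int q * f \<in> zinvariants n H" "q \<noteq> 0" shows "f \<in> zinvariants n H"
  using assms zpolys_of_int_dvd by (auto simp: zinvariants_def bij)

lemma reindex_left: "\<tau> \<in> H \<Longrightarrow> bij_betw ((\<circ>) \<tau>) H H"
  by (rule bij_betw_byWitness[where f' = "(\<circ>) (Hilbert_Choice.inv \<tau>)"])
    (auto simp: comp_mem inv_mem fun_eq_iff bij bij_is_inj bij_is_surj surj_f_inv_f)

definition trace :: "zpoly \<Rightarrow> zpoly"
  where "trace f = (\<Sum>\<sigma>\<in>H. permute_poly \<sigma> f)"

lemma trace_mem: assumes "f \<in> zpolys n" shows "trace f \<in> zinvariants n H"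
proof -
  have "permute_poly \<tau> (trace f) = trace f" if \<tau>: "\<tau> \<in> H" for \<tau>
  proof -
    have "permute_poly \<tau> (trace f) = (\<Sum>\<sigma>\<in>H. permute_poly (\<tau> \<circ> \<sigma>) f)"
      using \<tau> by (simp add: trace_def permute_poly_sum bij permute_poly_comp)
    also have "\<dots> = trace f"
      unfolding trace_def by (rule sum.reindex_bij_betw[OF reindex_left[OF \<tau>]])
    finally show ?thesis .
  qed
  then show ?thesis using assms
    by (auto simp: zinvariants_def trace_def
        intro!: is_subring_sum[OF is_subring_zpolys] zpolys_permute_poly permutes)
qed

lemma norm_mem:
  assumes "f \<in> zpolys n" shows "(\<Prod>\<sigma>\<in>H. permute_poly \<sigma> f) \<in> zinvariants n H"
proof -
  have "permute_poly \<tau> (\<Prod>\<sigma>\<in>H. permute_poly \<sigma> f) = (\<Prod>\<sigma>\<in>H. permute_poly \<sigma> f)" if \<tau>: "\<tau> \<in> H" for \<tau>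
  proof -
    have "permute_poly \<tau> (\<Prod>\<sigma>\<in>H. permute_poly \<sigma> f) = (\<Prod>\<sigma>\<in>H. permute_poly (\<tau> \<circ> \<sigma>) f)"
      using \<tau> by (simp add: permute_poly_prod bij permute_poly_comp)
    also have "\<dots> = (\<Prod>\<sigma>\<in>H. permute_poly \<sigma> f)"
      by (rule prod.reindex_bij_betw[OF reindex_left[OF \<tau>]])
    finally show ?thesis .
  qed
  then show ?thesis using assms
    by (auto simp: zinvariants_def
        intro!: is_subring_prod[OF is_subring_zpolys] zpolys_permute_poly permutes)
qed

lemma trace_add: "trace (f + g) = trace f + trace g"
  by (simp add: trace_def bij sum.distrib)

lemma trace_sum: "trace (\<Sum>i\<in>I. f i) = (\<Sum>i\<in>I. trace (f i))"
  by (induction I rule: infinite_finite_induct) (auto simp: trace_add, auto simp: trace_def bij)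

lemma trace_mult: "a \<in> zinvariants n H \<Longrightarrow> trace (a * f) = a * trace f"
  by (simp add: trace_def bij invariantsD sum_distrib_left)

lemma trace_invariant: "f \<in> zinvariants n H \<Longrightarrow> trace f = of_nat (card H) * f"
  by (simp add: trace_def invariantsD)

text \<open>
  The trace of the staircase monomial is a sum of distinct monomials with coefficient one. So it is
  nonzero modulo every prime, and conjugates of it by different cosets of \<open>H\<close> have no monomial in
  common.
\<close>

lemma coef_permute_trace_staircase:
  assumes "\<rho> permutes {1..n}" "\<tau> permutes {1..n}"
  shows "coef (permute_poly \<tau> (trace (zterm (staircase n) 1))) (image_mset \<rho> (staircase n)) =
    (if \<exists>\<sigma>\<in>H. \<rho> = \<tau> \<circ> \<sigma> then 1 else 0)"
proof -
  have eq: "image_mset \<rho> (staircase n) = image_mset (\<tau> \<circ> \<sigma>) (staircase n) \<longleftrightarrow> \<rho> = \<tau> \<circ> \<sigma>"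
    if "\<sigma> \<in> H" for \<sigma>
    using staircase_free[of \<rho> n "\<tau> \<circ> \<sigma>"] that assms permutes permutes_compose by blast
  have "coef (permute_poly \<tau> (trace (zterm (staircase n) 1))) (image_mset \<rho> (staircase n)) =
    (\<Sum>\<sigma>\<in>H. if \<rho> = \<tau> \<circ> \<sigma> then 1 else 0)"
    using assms eq
    by (simp add: trace_def permute_poly_sum permutes_bij bij lookup_sum lookup_single when_def
        multiset.map_comp cong: sum.cong)
  also have "\<dots> = (if \<exists>\<sigma>\<in>H. \<rho> = \<tau> \<circ> \<sigma> then 1 else 0)"
  proof (cases "\<exists>\<sigma>\<in>H. \<rho> = \<tau> \<circ> \<sigma>")
    case True
    then obtain \<sigma> where \<sigma>: "\<sigma> \<in> H" "\<rho> = \<tau> \<circ> \<sigma>" by blast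
    have "\<rho> = \<tau> \<circ> \<sigma>' \<longleftrightarrow> \<sigma>' = \<sigma>" for \<sigma>'
      using \<sigma> permutes_inj[OF assms(2)] by (auto simp: fun_eq_iff inj_def)
    then show ?thesis using \<sigma> finite_group by (auto simp: sum.delta)
  qed (auto intro!: sum.neutral)
  finally show ?thesis .
qed

end

section \<open>The rank of the invariants\<close>

lemma prime_or_zero_dvd_prod:
  fixes f :: "'i \<Rightarrow> zpoly"
  assumes "prime_or_zero q" "of_int q dvd (\<Prod>i\<in>I. f i)"
  shows "\<exists>i\<in>I. of_int q dvd f i"
  using assms(2)
proof (induction I rule: infinite_finite_induct)
  case (insert i I)
  then show ?case using prime_or_zero_dvd_zpoly[OF assms(1), of "f i"] by auto
qed (use assms(1) of_int_dvd_of_int_zpoly[of q 1] in \<open>auto simp: prime_or_zero_def\<close>)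

definition independent_mod :: "int \<Rightarrow> zpoly set \<Rightarrow> zpoly set \<Rightarrow> bool"
  where "independent_mod q A B \<longleftrightarrow> (\<forall>c. (\<forall>b\<in>B. c b \<in> A) \<longrightarrow>
    of_int q dvd (\<Sum>b\<in>B. c b * b) \<longrightarrow> (\<forall>b\<in>B. of_int q dvd c b))"

text \<open>
  \<open>T\<close> is a transversal of the right cosets of \<open>G\<close> in \<open>\<Sigma>\<close>; its cardinality is the index \<open>\<ell>\<close>.
\<close>

locale group_pair = S: perm_group n \<Sigma> + G: perm_group n G
  for n :: nat and \<Sigma> G :: "(nat \<Rightarrow> nat) set" +
  fixes T :: "(nat \<Rightarrow> nat) set"
  assumes subset: "G \<subseteq> \<Sigma>" and T_subset: "T \<subseteq> \<Sigma>"
    and T_cover: "\<sigma> \<in> \<Sigma> \<Longrightarrow> \<exists>t\<in>T. \<exists>g\<in>G. \<sigma> = g \<circ> t"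
    and T_unique: "t \<in> T \<Longrightarrow> g \<in> G \<Longrightarrow> g \<circ> t \<in> T \<Longrightarrow> g \<circ> t = t"
begin

abbreviation "A \<equiv> zinvariants n \<Sigma>"
abbreviation "M \<equiv> zinvariants n G"

lemma A_subset_M: "a \<in> A \<Longrightarrow> a \<in> M"
  using subset by (auto simp: zinvariants_def)

lemma finite_T: "finite T"
  using T_subset S.finite_group finite_subset by blast

lemma card_T_pos: "card T > 0"
  using T_cover[OF S.id_mem] finite_T by (auto simp: card_gt_0_iff)

text \<open>
  Elements of \<open>M\<close> have at most \<open>\<ell>\<close> conjugates under \<open>\<Sigma>\<close>, one for each \<open>t \<in> T\<close>. The inverse turns
  the right coset of \<open>\<sigma>\<^sup>-\<^sup>1\<close> into the left coset of \<open>\<sigma>\<close>, on which the action is constant.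
\<close>

lemma permute_eq_coset:
  assumes "\<sigma> \<in> \<Sigma>"
  obtains t where "t \<in> T" "\<And>f. f \<in> M \<Longrightarrow> permute_poly \<sigma> f = permute_poly (Hilbert_Choice.inv t) f"
proof -
  obtain t g where tg: "t \<in> T" "g \<in> G" "Hilbert_Choice.inv \<sigma> = g \<circ> t"
    using T_cover[OF S.inv_mem[OF assms]] by blast
  have bij: "bij t" "bij g" using tg T_subset S.bij G.bij by auto
  have "\<sigma> = Hilbert_Choice.inv (Hilbert_Choice.inv \<sigma>)" using assms S.bij by (simp add: inv_inv_eq)
  also have "\<dots> = Hilbert_Choice.inv t \<circ> Hilbert_Choice.inv g"
    using bij tg by (simp add: o_inv_distrib)
  finally have "\<sigma> = \<dots>" .
  then show ?thesis using tg bij G.inv_mem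
    by (intro that[OF tg(1)]) (simp add: permute_poly_comp bij_imp_bij_inv G.invariantsD)
qed

text \<open>
  The upper bound for the rank. If there are more than \<open>\<ell>\<close> elements \<open>b\<close>, then some polynomials \<open>z\<^sub>b\<close>,
  not all zero modulo \<open>q\<close>, satisfy \<open>\<Sum> z\<^sub>b \<sigma>(b) = 0\<close> for all conjugates simultaneously. Applying
  \<open>\<sigma>\<^sup>-\<^sup>1\<close> and summing over \<open>\<Sigma>\<close> gives \<open>\<Sum> Tr(c z\<^sub>b) b = 0\<close> for every \<open>c\<close>, a relation with
  coefficients in \<open>A\<close>. It is nontrivial if \<open>c\<close> is the staircase monomial times the conjugates of
  \<open>z\<^sub>b\<close> other than itself, for one nonzero \<open>z\<^sub>b\<close>: then \<open>Tr(c z\<^sub>b)\<close> is the norm of \<open>z\<^sub>b\<close> times the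
  trace of the staircase monomial.
\<close>

theorem card_independent_le:
  assumes q: "prime_or_zero q" and B: "finite B" "B \<subseteq> M" "independent_mod q A B"
  shows "card B \<le> card T"
proof (rule ccontr)
  assume "\<not> ?thesis"
  then have less: "card T < card B" by simp
  have unit: "\<not> (of_int q :: zpoly) dvd 1"
    using q of_int_dvd_of_int_zpoly[of q 1] by (auto simp: prime_or_zero_def)
  have "\<exists>z. (\<forall>b\<in>B. z b \<in> zpolys n) \<and> (\<exists>b\<in>B. \<not> of_int q dvd z b) \<and>
    (\<forall>t\<in>T. of_int q dvd (\<Sum>b\<in>B. z b * permute_poly (Hilbert_Choice.inv t) b))"
    using B less finite_T T_subset
    by (intro underdetermined_system[OF prime_or_zero_dvd_zpoly[OF q] unit is_subring_zpolys])
      (auto intro!: zpolys_permute_poly S.permutes S.inv_mem intro: G.invariants_zpolys)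
  then obtain z b0 where z: "\<And>b. b \<in> B \<Longrightarrow> z b \<in> zpolys n" and b0: "b0 \<in> B" "\<not> of_int q dvd z b0"
    and sol: "\<And>t. t \<in> T \<Longrightarrow> of_int q dvd (\<Sum>b\<in>B. z b * permute_poly (Hilbert_Choice.inv t) b)"
    by blast
  have sol': "of_int q dvd (\<Sum>b\<in>B. z b * permute_poly \<sigma> b)" if "\<sigma> \<in> \<Sigma>" for \<sigma>
  proof -
    obtain t where "t \<in> T" "\<And>f. f \<in> M \<Longrightarrow> permute_poly \<sigma> f = permute_poly (Hilbert_Choice.inv t) f"
      using permute_eq_coset[OF \<open>\<sigma> \<in> \<Sigma>\<close>] by blast
    with sol[of t] B show ?thesis by (auto cong: sum.cong simp: subset_iff)
  qed
  \<comment> \<open>The cofactor \<open>w\<close> of \<open>z b0\<close> in its norm \<open>N\<close>, which lies in \<open>A\<close>.\<close>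
  define w where "w = (\<Prod>\<sigma>\<in>\<Sigma> - {id}. permute_poly \<sigma> (z b0))"
  define e where "e = zterm (staircase n) 1"
  define N where "N = (\<Prod>\<sigma>\<in>\<Sigma>. permute_poly \<sigma> (z b0))"
  have e: "e \<in> zpolys n" using set_staircase by (simp add: e_def)
  have N: "N \<in> A" unfolding N_def using z b0 by (intro S.norm_mem) auto
  have N_eq: "N = w * z b0"
    using prod.remove[OF S.finite_group S.id_mem, of "\<lambda>\<sigma>. permute_poly \<sigma> (z b0)"]
    by (simp add: N_def w_def mult.commute)
  have w: "w \<in> zpolys n" unfolding w_def using z b0
    by (auto intro!: is_subring_prod[OF is_subring_zpolys] zpolys_permute_poly S.permutes)
  define a where "a b = S.trace (w * e * z b)" for b
  have a: "a b \<in> A" if "b \<in> B" for b unfolding a_def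
    using that w e z by (intro S.trace_mem zpolys_mult)
  have "(\<Sum>b\<in>B. a b * b) =
    (\<Sum>\<sigma>\<in>\<Sigma>. permute_poly \<sigma> (w * e) * permute_poly \<sigma> (\<Sum>b\<in>B. z b * permute_poly (Hilbert_Choice.inv \<sigma>) b))"
    unfolding a_def S.trace_def sum_distrib_right
    by (subst sum.swap) (simp add: S.bij permute_poly_sum sum_distrib_left mult.assoc)
  also have "of_int q dvd \<dots>"
    by (intro dvd_sum dvd_mult of_int_dvd_permute_poly sol' S.bij S.inv_mem)
  finally have "of_int q dvd a b0"
    using B a b0 unfolding independent_mod_def by blast
  moreover have "a b0 = N * S.trace e"
    unfolding S.trace_mult[OF N, symmetric] by (simp add: a_def N_eq ac_simps)
  ultimately consider "of_int q dvd N" | "of_int q dvd S.trace e"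
    using prime_or_zero_dvd_zpoly[OF q] by metis
  then show False
  proof cases
    case 1
    then obtain \<sigma> where \<sigma>: "\<sigma> \<in> \<Sigma>" "of_int q dvd permute_poly \<sigma> (z b0)"
      unfolding N_def using prime_or_zero_dvd_prod[OF q] by blast
    then show False
      using of_int_dvd_permute_poly[OF S.bij[OF S.inv_mem[OF \<sigma>(1)]] \<sigma>(2)] b0 S.bij by simp
  next
    case 2
    then have "q dvd coef (S.trace e) (staircase n)" by (simp add: of_int_dvd_zpoly_iff)
    then have "q dvd 1"
      using S.coef_permute_trace_staircase[of id id] S.id_mem by (auto simp: e_def permutes_id)
    then show False using q by (simp add: prime_or_zero_def)
  qed
qed

text \<open>
  An element of \<open>M\<close> with \<open>\<ell>\<close> conjugates under \<open>\<Sigma>\<close> that stay distinct modulo every prime: a primitive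
  element of the field of fractions of \<open>M\<close> over that of \<open>A\<close>.
\<close>

definition primitive_invariant :: zpoly
  where "primitive_invariant = G.trace (zterm (staircase n) 1)"

lemma primitive_invariant_mem: "primitive_invariant \<in> M"
  unfolding primitive_invariant_def using set_staircase by (intro G.trace_mem) simp

text \<open>
  A relation over \<open>A\<close> among the powers below \<open>\<ell>\<close> is satisfied by all \<open>\<ell>\<close> conjugates as well, which
  is too many roots for a polynomial of degree less than \<open>\<ell>\<close>.
\<close>

lemma powers_independent:
  assumes q: "prime_or_zero q" and c: "\<And>i. i < card T \<Longrightarrow> c i \<in> A"
    and dvd: "of_int q dvd (\<Sum>i<card T. c i * primitive_invariant ^ i)" and "i < card T"
  shows "of_int q dvd c i"
proof -
  define y where "y t = permute_poly (Hilbert_Choice.inv t) primitive_invariant" for t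
  have distinct: "\<not> of_int q dvd y t - y t'" if t: "t \<in> T" "t' \<in> T" "t \<noteq> t'" for t t'
  proof
    assume "of_int q dvd y t - y t'"
    then have "q dvd coef (y t - y t') (image_mset (Hilbert_Choice.inv t) (staircase n))"
      by (simp add: of_int_dvd_zpoly_iff)
    moreover have tt: "t \<in> \<Sigma>" "t' \<in> \<Sigma>" using t T_subset by auto
    moreover have "\<not> (\<exists>\<sigma>\<in>G. Hilbert_Choice.inv t = Hilbert_Choice.inv t' \<circ> \<sigma>)"
    proof safe
      fix \<sigma> assume \<sigma>: "\<sigma> \<in> G" "Hilbert_Choice.inv t = Hilbert_Choice.inv t' \<circ> \<sigma>"
      have "t' = t' \<circ> (Hilbert_Choice.inv t \<circ> t)" using tt S.bij by (simp add: bij_is_inj)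
      also have "\<dots> = \<sigma> \<circ> t" unfolding \<sigma>(2)
        using tt S.bij[of t'] by (simp add: o_assoc bij_is_surj surj_iff[THEN iffD1])
      finally show False using T_unique[of t \<sigma>] t \<sigma> by auto
    qed
    moreover have "\<exists>\<sigma>\<in>G. Hilbert_Choice.inv t = Hilbert_Choice.inv t \<circ> \<sigma>"
      by (intro bexI[OF _ G.id_mem]) simp
    ultimately have "q dvd 1"
      unfolding y_def primitive_invariant_def lookup_minus
      using tt[THEN S.inv_mem, THEN S.permutes]
      by (simp only: G.coef_permute_trace_staircase if_True if_False diff_0_right)
    then show False using q by (simp add: prime_or_zero_def)
  qed
  have inj: "inj_on y T" by (rule inj_onI, rule ccontr) (use distinct in fastforce)
  define P where "P = (\<Sum>i<card T. Polynomial.monom (c i) i)"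
  have coeff: "Polynomial.coeff P j = (if j < card T then c j else 0)" for j
    by (simp add: P_def Polynomial.coeff_sum)
  have deg: "Polynomial.degree P < card (y ` T)"
    unfolding card_image[OF inj] using card_T_pos by (intro degree_lessI) (auto simp: coeff)
  have "of_int q dvd Polynomial.coeff P i"
  proof (rule poly_coeffs_dvd_of_many_roots[OF prime_or_zero_dvd_zpoly[OF q] _ deg])
    fix x assume "x \<in> y ` T"
    then obtain t where t: "t \<in> T" "x = y t" by auto
    then have t': "Hilbert_Choice.inv t \<in> \<Sigma>" using T_subset S.inv_mem by auto
    have "Polynomial.poly P x = (\<Sum>i<card T. c i * x ^ i)"
      by (simp add: P_def Polynomial.poly_sum poly_monom)
    also have "\<dots> = permute_poly (Hilbert_Choice.inv t) (\<Sum>i<card T. c i * primitive_invariant ^ i)"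
      using t' c by (simp add: t y_def permute_poly_sum permute_poly_power S.bij S.invariantsD)
    finally show "of_int q dvd Polynomial.poly P x"
      using of_int_dvd_permute_poly[OF S.bij[OF t'] dvd] by simp
  qed (use finite_T distinct in auto)
  then show ?thesis using assms by (simp add: coeff)
qed

text \<open>
  The lower bound for the rank. If fewer than \<open>\<ell>\<close> elements spanned \<open>M\<close> up to scalars, then
  eliminating them from the expressions for the first \<open>\<ell>\<close> powers of the primitive invariant would
  give a relation between these powers.
\<close>

theorem card_spanning_ge:
  assumes q: "prime_or_zero q" and B: "finite B"
    and span: "\<And>f. f \<in> M \<Longrightarrow> \<exists>s\<in>A. \<not> of_int q dvd s \<and>
      (\<exists>c. (\<forall>b\<in>B. c b \<in> A) \<and> of_int q dvd s * f - (\<Sum>b\<in>B. c b * b))"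
  shows "card T \<le> card B"
proof (rule ccontr)
  assume "\<not> ?thesis"
  then have less: "card B < card T" by simp
  have unit: "\<not> (of_int q :: zpoly) dvd 1"
    using q of_int_dvd_of_int_zpoly[of q 1] by (auto simp: prime_or_zero_def)
  have "\<forall>i. \<exists>s c. s \<in> A \<and> \<not> of_int q dvd s \<and> (\<forall>b\<in>B. c b \<in> A) \<and>
      of_int q dvd s * primitive_invariant ^ i - (\<Sum>b\<in>B. c b * b)"
    using span primitive_invariant_mem by (meson G.invariants_power)
  from choice[OF this] obtain s where "\<forall>i. \<exists>c. s i \<in> A \<and> \<not> of_int q dvd s i \<and>
      (\<forall>b\<in>B. c b \<in> A) \<and> of_int q dvd s i * primitive_invariant ^ i - (\<Sum>b\<in>B. c b * b)" ..
  from choice[OF this] obtain c where sc_all: "\<forall>i. s i \<in> A \<and> \<not> of_int q dvd s i \<and>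
      (\<forall>b\<in>B. c i b \<in> A) \<and> of_int q dvd s i * primitive_invariant ^ i - (\<Sum>b\<in>B. c i b * b)" ..
  then have s: "\<And>i. s i \<in> A" "\<And>i. \<not> of_int q dvd s i"
    and c: "\<And>i b. b \<in> B \<Longrightarrow> c i b \<in> A"
    and sc: "\<And>i. of_int q dvd s i * primitive_invariant ^ i - (\<Sum>b\<in>B. c i b * b)"
    by blast+
  have "\<exists>z. (\<forall>i\<in>{..<card T}. z i \<in> A) \<and> (\<exists>i\<in>{..<card T}. \<not> of_int q dvd z i) \<and>
    (\<forall>b\<in>B. of_int q dvd (\<Sum>i<card T. z i * c i b))"
    using B less c
    by (intro underdetermined_system[OF prime_or_zero_dvd_zpoly[OF q] unit S.is_subring_invariants]) auto
  then obtain z i0 where z: "\<And>i. i < card T \<Longrightarrow> z i \<in> A" and i0: "i0 < card T" "\<not> of_int q dvd z i0"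
    and sol: "\<And>b. b \<in> B \<Longrightarrow> of_int q dvd (\<Sum>i<card T. z i * c i b)" by auto
  let ?y = primitive_invariant
  have "(\<Sum>i<card T. z i * s i * ?y ^ i) =
    (\<Sum>i<card T. z i * (s i * ?y ^ i - (\<Sum>b\<in>B. c i b * b))) + (\<Sum>i<card T. \<Sum>b\<in>B. z i * c i b * b)"
    by (simp add: algebra_simps sum_subtractf sum_distrib_left)
  also have "(\<Sum>i<card T. \<Sum>b\<in>B. z i * c i b * b) = (\<Sum>b\<in>B. (\<Sum>i<card T. z i * c i b) * b)"
    by (subst sum.swap) (simp add: sum_distrib_right)
  also have "of_int q dvd (\<Sum>i<card T. z i * (s i * ?y ^ i - (\<Sum>b\<in>B. c i b * b))) +
      (\<Sum>b\<in>B. (\<Sum>i<card T. z i * c i b) * b)"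
    by (intro dvd_add dvd_sum dvd_mult[OF sc] dvd_mult2[OF sol])
  finally have "of_int q dvd (\<Sum>i<card T. z i * s i * ?y ^ i)" .
  then have "of_int q dvd z i0 * s i0"
    using z s i0 by (intro powers_independent[OF q, of "\<lambda>i. z i * s i"]) (auto intro: S.invariants_mult)
  then show False using prime_or_zero_dvd_zpoly[OF q] i0 s by blast
qed

text \<open>
  In a relation, a basis element with coefficient nonzero modulo \<open>q\<close> could be eliminated up to a
  scalar, leaving fewer than \<open>\<ell>\<close> spanning elements.
\<close>

corollary independent_of_spanning:
  assumes q: "prime_or_zero q" and B: "finite B" "card B \<le> card T"
    and span: "\<And>f. f \<in> M \<Longrightarrow> \<exists>s\<in>A. \<not> of_int q dvd s \<and>
      (\<exists>c. (\<forall>b\<in>B. c b \<in> A) \<and> of_int q dvd s * f - (\<Sum>b\<in>B. c b * b))"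
  shows "independent_mod q A B"
  unfolding independent_mod_def
proof (intro allI impI ballI, rule ccontr)
  fix a b0 assume a: "\<forall>b\<in>B. a b \<in> A" "of_int q dvd (\<Sum>b\<in>B. a b * b)"
    and b0: "b0 \<in> B" "\<not> of_int q dvd a b0"
  have "card T \<le> card (B - {b0})"
  proof (rule card_spanning_ge[OF q])
    fix f assume "f \<in> M"
    then obtain s c where s: "s \<in> A" "\<not> of_int q dvd s" and c: "\<forall>b\<in>B. c b \<in> A"
      and sc: "of_int q dvd s * f - (\<Sum>b\<in>B. c b * b)" using span by blast
    \<comment> \<open>The combination of the two relations in which \<open>b0\<close> cancels.\<close>
    define c' where "c' b = a b0 * c b - c b0 * a b" for b
    have "(\<Sum>b\<in>B - {b0}. c' b * b) = (\<Sum>b\<in>B. c' b * b)"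
      using B b0 by (simp add: sum.remove[of B b0] c'_def mult.commute)
    also have "\<dots> = a b0 * (\<Sum>b\<in>B. c b * b) - c b0 * (\<Sum>b\<in>B. a b * b)"
      by (simp add: c'_def algebra_simps sum_subtractf sum_distrib_left)
    finally have "a b0 * s * f - (\<Sum>b\<in>B - {b0}. c' b * b) =
      a b0 * (s * f - (\<Sum>b\<in>B. c b * b)) + c b0 * (\<Sum>b\<in>B. a b * b)"
      by (simp add: algebra_simps)
    then have "of_int q dvd a b0 * s * f - (\<Sum>b\<in>B - {b0}. c' b * b)"
      using sc a by (auto intro!: dvd_add)
    moreover have "\<not> of_int q dvd a b0 * s" using prime_or_zero_dvd_zpoly[OF q] b0 s by blast
    moreover have "a b0 * s \<in> A" using a b0 s by (auto intro: S.invariants_mult)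
    moreover have "\<forall>b\<in>B - {b0}. c' b \<in> A"
      using a b0 c unfolding c'_def by (auto intro!: S.invariants_diff S.invariants_mult)
    ultimately show "\<exists>s\<in>A. \<not> of_int q dvd s \<and>
      (\<exists>c. (\<forall>b\<in>B - {b0}. c b \<in> A) \<and> of_int q dvd s * f - (\<Sum>b\<in>B - {b0}. c b * b))" by blast
  qed (use B in auto)
  then show False using B b0 by (metis card_Diff1_less not_less order_trans)
qed

end

section \<open>Divided differences\<close>

text \<open>
  A group that contains the transposition of \<open>i\<close> and \<open>\<sigma> i\<close> for each of its elements \<open>\<sigma>\<close> is generated
  by transpositions: composing with such a transposition reduces the number of points moved. So
  invariance of \<open>h\<close> modulo a stable additive subgroup need only be checked for transpositions.
\<close>

lemma permute_poly_diff_mem: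
  assumes Sigma: "perm_group n \<Sigma>"
    and transp: "\<And>\<sigma> i. \<sigma> \<in> \<Sigma> \<Longrightarrow> Transposition.transpose i (\<sigma> i) \<in> \<Sigma>"
    and add: "\<And>f g. f \<in> Q \<Longrightarrow> g \<in> Q \<Longrightarrow> f + g \<in> Q" and zero: "0 \<in> Q"
    and stable: "\<And>\<sigma> f. \<sigma> \<in> \<Sigma> \<Longrightarrow> f \<in> Q \<Longrightarrow> permute_poly \<sigma> f \<in> Q"
    and base: "\<And>i j. i \<noteq> j \<Longrightarrow> Transposition.transpose i j \<in> \<Sigma> \<Longrightarrow>
      permute_poly (Transposition.transpose i j) h - h \<in> Q"
    and "\<sigma> \<in> \<Sigma>"
  shows "permute_poly \<sigma> h - h \<in> Q"
  using \<open>\<sigma> \<in> \<Sigma>\<close>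
proof (induction "card {i. \<sigma> i \<noteq> i}" arbitrary: \<sigma> rule: less_induct)
  case less
  interpret perm_group n \<Sigma> by (rule Sigma)
  show ?case
  proof (cases "\<sigma> = id")
    case False
    then obtain i where i: "\<sigma> i \<noteq> i" by (auto simp: fun_eq_iff)
    define s where "s = Transposition.transpose i (\<sigma> i)"
    define \<tau> where "\<tau> = s \<circ> \<sigma>"
    have s: "s \<in> \<Sigma>" unfolding s_def using less.prems by (rule transp)
    have \<tau>: "\<tau> \<in> \<Sigma>" unfolding \<tau>_def using s less.prems by (rule comp_mem)
    have \<sigma>: "\<sigma> = s \<circ> \<tau>" by (simp add: \<tau>_def s_def o_assoc)
    have "inj \<sigma>" using less.prems bij bij_is_inj by blast
    then have moved: "{k. \<tau> k \<noteq> k} \<subset> {k. \<sigma> k \<noteq> k}"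
      using i by (auto simp: \<tau>_def s_def Transposition.transpose_def inj_eq)
    have "finite {k. \<sigma> k \<noteq> k}"
      by (rule finite_subset[of _ "{1..n}"]) (use permutes[OF less.prems] in \<open>auto simp: permutes_def\<close>)
    then have "permute_poly \<tau> h - h \<in> Q"
      by (intro less.hyps psubset_card_mono moved \<tau>)
    then have "permute_poly s (permute_poly \<tau> h - h) + (permute_poly s h - h) \<in> Q"
      using s i by (intro add stable) (auto simp: s_def intro: base)
    also have "permute_poly s (permute_poly \<tau> h - h) + (permute_poly s h - h) = permute_poly \<sigma> h - h"
      using bij[OF s] bij[OF \<tau>] by (simp add: \<sigma> permute_poly_comp)
    finally show ?thesis .
  qed (use zero in simp)
qed

abbreviation zvar :: "nat \<Rightarrow> zpoly"
  where "zvar i \<equiv> zterm {#i#} 1"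

text \<open>
  Divisibility of \<open>s f - f\<close> by \<open>x\<^sub>i - x\<^sub>j\<close> passes to products, by
  \<open>s(f g) - f g = s(f) (s(g) - g) + (s(f) - f) g\<close>, and is clear for a variable.
\<close>

lemma divided_difference_zterm:
  assumes ij: "i \<in> {1..n}" "j \<in> {1..n}" "i \<noteq> j" and "set_mset m \<subseteq> {1..n}"
  shows "\<exists>g\<in>zpolys n. permute_poly (Transposition.transpose i j) (zterm m 1) - zterm m 1 =
    (zvar i - zvar j) * g \<and> (\<forall>m'\<in>monoms g. size m' < size m)"
  using assms(4)
proof (induction m)
  case empty
  then show ?case by (intro bexI[of _ 0]) (auto simp: zpolys_def)
next
  case (add k m)
  let ?s = "Transposition.transpose i j"
  obtain g where g: "g \<in> zpolys n" "permute_poly ?s (zterm m 1) - zterm m 1 = (zvar i - zvar j) * g"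
    "\<And>m'. m' \<in> monoms g \<Longrightarrow> size m' < size m" using add by auto
  define \<delta> :: int where "\<delta> = (if k = i then - 1 else if k = j then 1 else 0)"
  have \<delta>: "zvar (?s k) - zvar k = (zvar i - zvar j) * of_int \<delta>"
    using ij by (auto simp: \<delta>_def Transposition.transpose_def)
  have split: "zterm (add_mset k m) 1 = zvar k * zterm m 1" by (simp add: mult_single)
  have sk: "?s k \<in> {1..n}" using add.prems ij by (auto simp: Transposition.transpose_def)
  let ?g = "zvar (?s k) * g + of_int \<delta> * zterm m 1"
  have "permute_poly ?s (zterm (add_mset k m) 1) - zterm (add_mset k m) 1 =
    zvar (?s k) * (permute_poly ?s (zterm m 1) - zterm m 1) + (zvar (?s k) - zvar k) * zterm m 1"
    unfolding split by (simp add: algebra_simps)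
  also have "\<dots> = (zvar i - zvar j) * ?g"
    unfolding \<delta> g by (simp add: algebra_simps)
  finally have eq: "permute_poly ?s (zterm (add_mset k m) 1) - zterm (add_mset k m) 1 =
    (zvar i - zvar j) * ?g" .
  have "size m' < size (add_mset k m)" if m': "m' \<in> monoms ?g" for m'
  proof -
    have "m' \<in> monoms (zvar (?s k) * g) \<or> m' \<in> monoms (of_int \<delta> * zterm m 1)"
      using keys_add[of "zvar (?s k) * g" "of_int \<delta> * zterm m 1"] m' by blast
    then show ?thesis
    proof
      assume "m' \<in> monoms (zvar (?s k) * g)"
      then obtain m'' where "m' = {#?s k#} + m''" "m'' \<in> monoms g"
        using keys_mult[of "zvar (?s k)" g] by auto
      then show ?thesis using g(3) by auto
    qed (auto simp: in_keys_iff lookup_single when_def split: if_splits)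
  qed
  moreover have "?g \<in> zpolys n"
    using sk g add.prems
    by (intro zpolys_add zpolys_mult is_subring_of_int[OF is_subring_zpolys]) auto
  ultimately show ?case using eq by blast
qed

text \<open>
  The bound on the degree makes the induction in Chevalley's lemma possible.
\<close>

lemma divided_difference:
  assumes ij: "i \<in> {1..n}" "j \<in> {1..n}" "i \<noteq> j" and h: "h \<in> zpolys n"
    and D: "\<And>m. m \<in> monoms h \<Longrightarrow> size m < Suc D"
  shows "\<exists>g\<in>zpolys n. permute_poly (Transposition.transpose i j) h - h = (zvar i - zvar j) * g \<and>
    (\<forall>m\<in>monoms g. size m < D)"
proof (induction h rule: zpoly_induct)
  case zero
  show ?case by (intro bexI[of _ 0]) (auto simp: zpolys_def)
next
  case (add m c f)
  then obtain g where g: "g \<in> zpolys n" "\<forall>m\<in>monoms g. size m < D"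
    "permute_poly (Transposition.transpose i j) f - f = (zvar i - zvar j) * g" by blast
  have "set_mset m \<subseteq> {1..n}" using h add by (auto simp: zpolys_def)
  from divided_difference_zterm[OF ij this] obtain k where k: "k \<in> zpolys n"
    "permute_poly (Transposition.transpose i j) (zterm m 1) - zterm m 1 = (zvar i - zvar j) * k"
    "\<forall>m'\<in>monoms k. size m' < size m" by blast
  let ?g = "of_int c * k + g"
  have "permute_poly (Transposition.transpose i j) (zterm m c + f) - (zterm m c + f) =
    of_int c * (permute_poly (Transposition.transpose i j) (zterm m 1) - zterm m 1) +
    (permute_poly (Transposition.transpose i j) f - f)"
    by (subst (1 2) zterm_eq) (simp add: algebra_simps)
  also have "\<dots> = (zvar i - zvar j) * ?g"
    unfolding k g by (simp add: algebra_simps)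
  finally have eq: "permute_poly (Transposition.transpose i j) (zterm m c + f) - (zterm m c + f) =
    (zvar i - zvar j) * ?g" .
  have "size m' < D" if "m' \<in> monoms ?g" for m'
  proof -
    have "m' \<in> monoms (of_int c * k) \<or> m' \<in> monoms g"
      using keys_add[of "of_int c * k" g] that by blast
    then show ?thesis
    proof
      assume "m' \<in> monoms (of_int c * k)"
      then have "m' \<in> monoms k" by (auto simp: in_keys_iff)
      with k(3) D[OF add(1)] show ?thesis by fastforce
    qed (use g in auto)
  qed
  moreover have "?g \<in> zpolys n"
    using k g by (intro zpolys_add zpolys_mult is_subring_of_int[OF is_subring_zpolys]) auto
  ultimately show ?case using eq by blast
qed

section \<open>Independence over the invariants of the Young subgroup\<close>

text \<open>
  \<open>A\<^sub>+ W\<close>, where \<open>A\<^sub>+\<close> consists of the elements of \<open>A\<close> without constant term.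
\<close>

inductive_set plus_ideal :: "zpoly set \<Rightarrow> zpoly set \<Rightarrow> zpoly set"
  for A W where
  zero: "0 \<in> plus_ideal A W"
| add: "a \<in> A \<Longrightarrow> coef a {#} = 0 \<Longrightarrow> w \<in> W \<Longrightarrow> f \<in> plus_ideal A W \<Longrightarrow> a * w + f \<in> plus_ideal A W"

lemma plus_ideal_mult_mem: "a \<in> A \<Longrightarrow> coef a {#} = 0 \<Longrightarrow> w \<in> W \<Longrightarrow> a * w \<in> plus_ideal A W"
  using plus_ideal.add[OF _ _ _ plus_ideal.zero] by fastforce

lemma plus_ideal_add: "f \<in> plus_ideal A W \<Longrightarrow> g \<in> plus_ideal A W \<Longrightarrow> f + g \<in> plus_ideal A W"
  by (induction rule: plus_ideal.induct) (auto simp: add.assoc intro: plus_ideal.add)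

lemma plus_ideal_sum:
  "(\<And>i. i \<in> I \<Longrightarrow> f i \<in> plus_ideal A W) \<Longrightarrow> (\<Sum>i\<in>I. f i) \<in> plus_ideal A W"
  by (induction I rule: infinite_finite_induct) (auto intro: plus_ideal_add plus_ideal.zero)

lemma plus_ideal_mult:
  assumes "f \<in> plus_ideal A W" "\<And>w. w \<in> W \<Longrightarrow> v * w \<in> W"
  shows "v * f \<in> plus_ideal A W"
  using assms(1)
proof induction
  case (add a w f)
  have "v * (a * w + f) = a * (v * w) + v * f" by (simp add: algebra_simps)
  with add assms(2) show ?case by (auto intro: plus_ideal.add)
qed (auto intro: plus_ideal.zero)

text \<open>
  The elements that lie in \<open>U\<close> after extension of scalars to the fraction field of \<open>\<int>/q\<close>. For
  \<open>q = 0\<close> this is the closure of \<open>U\<close> under division by integers.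
\<close>

definition satq :: "int \<Rightarrow> zpoly set \<Rightarrow> zpoly set"
  where "satq q U = {f. \<exists>k. \<not> q dvd k \<and> (\<exists>u\<in>U. of_int q dvd of_int k * f - u)}"

lemma satq_0: "satq 0 U = {f. \<exists>k. k \<noteq> 0 \<and> of_int k * f \<in> U}"
  by (auto simp: satq_def)

lemma satqI: "\<not> q dvd k \<Longrightarrow> u \<in> U \<Longrightarrow> of_int q dvd of_int k * f - u \<Longrightarrow> f \<in> satq q U"
  by (auto simp: satq_def)

lemma satq_superset: "prime_or_zero q \<Longrightarrow> f \<in> U \<Longrightarrow> f \<in> satq q U"
  by (rule satqI[of _ 1 f]) (auto simp: prime_or_zero_def)

lemma satq_mult:
  assumes "f \<in> satq q U" "\<And>u. u \<in> U \<Longrightarrow> v * u \<in> U" shows "v * f \<in> satq q U"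
proof -
  obtain k u where k: "\<not> q dvd k" "u \<in> U" "of_int q dvd of_int k * f - u"
    using assms(1) by (auto simp: satq_def)
  have "of_int k * (v * f) - v * u = v * (of_int k * f - u)" by (simp add: algebra_simps)
  then show ?thesis using k assms(2) by (intro satqI[of q k "v * u"]) auto
qed

lemma satq_add:
  assumes q: "prime_or_zero q" and "f \<in> satq q U" "g \<in> satq q U"
    and add: "\<And>x y. x \<in> U \<Longrightarrow> y \<in> U \<Longrightarrow> x + y \<in> U"
    and mult: "\<And>k x. x \<in> U \<Longrightarrow> of_int k * x \<in> U"
  shows "f + g \<in> satq q U"
proof -
  obtain k u where k: "\<not> q dvd k" "u \<in> U" "of_int q dvd of_int k * f - u"
    using assms(2) by (auto simp: satq_def)
  obtain l v where l: "\<not> q dvd l" "v \<in> U" "of_int q dvd of_int l * g - v"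
    using assms(3) by (auto simp: satq_def)
  have "of_int (k * l) * (f + g) - (of_int l * u + of_int k * v) =
    of_int l * (of_int k * f - u) + of_int k * (of_int l * g - v)" by (simp add: algebra_simps)
  also have "of_int q dvd \<dots>" using k l by (intro dvd_add dvd_mult) auto
  finally show ?thesis using q k l
    by (intro satqI[of q "k * l" "of_int l * u + of_int k * v"])
      (auto simp: prime_or_zero_def intro: add mult)
qed

lemma satq_sum:
  assumes q: "prime_or_zero q" and "\<And>i. i \<in> I \<Longrightarrow> f i \<in> satq q U"
    and zero: "0 \<in> U" and add: "\<And>x y. x \<in> U \<Longrightarrow> y \<in> U \<Longrightarrow> x + y \<in> U"
    and mult: "\<And>k x. x \<in> U \<Longrightarrow> of_int k * x \<in> U"
  shows "(\<Sum>i\<in>I. f i) \<in> satq q U"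
  using assms(2)
proof (induction I rule: infinite_finite_induct)
  case (insert i I)
  then show ?case by (auto intro!: satq_add[OF q _ _ add mult])
qed (use satq_superset[OF q zero] in auto)

lemma satq_idem:
  assumes q: "prime_or_zero q" and f: "\<not> q dvd k" "of_int q dvd of_int k * f - w" and w: "w \<in> satq q U"
  shows "f \<in> satq q U"
proof -
  obtain l u where l: "\<not> q dvd l" "u \<in> U" "of_int q dvd of_int l * w - u"
    using w by (auto simp: satq_def)
  have "of_int (l * k) * f - u = of_int l * (of_int k * f - w) + (of_int l * w - u)"
    by (simp add: algebra_simps)
  also have "of_int q dvd \<dots>" using f l by (intro dvd_add dvd_mult) auto
  finally show ?thesis using q f l by (intro satqI[of q "l * k" u]) (auto simp: prime_or_zero_def)
qed

text \<open>
  The additional assumption characterises Young subgroups: a group that contains the transposition of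
  any two points in the same orbit contains all permutations preserving its orbits.
\<close>

locale young_pair = group_pair +
  assumes transpose_mem: "\<sigma> \<in> \<Sigma> \<Longrightarrow> Transposition.transpose i (\<sigma> i) \<in> \<Sigma>"
begin

abbreviation "AV \<equiv> plus_ideal A (zpolys n)"
abbreviation "AM \<equiv> plus_ideal A M"

lemma AV_mult: "v \<in> zpolys n \<Longrightarrow> f \<in> AV \<Longrightarrow> v * f \<in> AV"
  by (rule plus_ideal_mult) (auto intro: zpolys_mult)

lemma AV_of_int: "f \<in> AV \<Longrightarrow> of_int k * f \<in> AV"
  by (rule AV_mult[OF is_subring_of_int[OF is_subring_zpolys]])

lemma AM_mult: "v \<in> M \<Longrightarrow> f \<in> AM \<Longrightarrow> v * f \<in> AM"
  by (rule plus_ideal_mult) (auto intro: G.invariants_mult)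

lemma AM_of_int: "f \<in> AM \<Longrightarrow> of_int k * f \<in> AM"
  by (rule AM_mult[OF G.invariants_of_int])

lemma AM_subset: "f \<in> AM \<Longrightarrow> f \<in> M"
  by (induction rule: plus_ideal.induct)
    (auto intro!: G.invariants_0 G.invariants_add G.invariants_mult intro: A_subset_M)

lemma permute_AV:
  assumes \<sigma>: "\<sigma> \<in> \<Sigma>" and "f \<in> AV" shows "permute_poly \<sigma> f \<in> AV"
  using assms(2)
proof induction
  case (add a w f)
  then show ?case using \<sigma>
    by (auto simp: S.bij S.invariantsD intro!: plus_ideal.add zpolys_permute_poly S.permutes)
qed (auto simp: S.bij \<sigma> intro: plus_ideal.zero)

abbreviation "sat_AV \<equiv> satq 0 AV"

lemma sat_AV_add: "f \<in> sat_AV \<Longrightarrow> g \<in> sat_AV \<Longrightarrow> f + g \<in> sat_AV"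
  by (rule satq_add[OF prime_or_zero_0 _ _ plus_ideal_add AV_of_int])

lemma sat_AV_mult: "v \<in> zpolys n \<Longrightarrow> f \<in> sat_AV \<Longrightarrow> v * f \<in> sat_AV"
  by (rule satq_mult) (auto intro: AV_mult)

lemma sat_AV_0: "0 \<in> sat_AV"
  by (rule satq_superset[OF prime_or_zero_0 plus_ideal.zero])

lemma sat_AV_sum: "(\<And>i. i \<in> I \<Longrightarrow> f i \<in> sat_AV) \<Longrightarrow> (\<Sum>i\<in>I. f i) \<in> sat_AV"
  by (rule satq_sum[OF prime_or_zero_0 _ plus_ideal.zero plus_ideal_add AV_of_int])

lemma permute_sat_AV: "\<sigma> \<in> \<Sigma> \<Longrightarrow> f \<in> sat_AV \<Longrightarrow> permute_poly \<sigma> f \<in> sat_AV"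
  using permute_AV[of \<sigma>] by (fastforce simp: satq_0 S.bij)

text \<open>
  Chevalley's lemma, without homogeneity assumptions: \<open>A\<close> is localised at the elements \<open>u\<close> with
  nonzero constant term instead. By induction on the degree, the divided differences of \<open>h\<^sub>0\<close> lie in
  \<open>A\<^sub>+ \<int>[V]\<close> up to an integer factor, because they satisfy a relation with the same coefficients. So
  does \<open>\<sigma> h\<^sub>0 - h\<^sub>0\<close> for every \<open>\<sigma>\<close>, and hence \<open>Tr h\<^sub>0 - |\<Sigma>| h\<^sub>0\<close>. Finally \<open>Tr h\<^sub>0\<close> itself has no
  constant term: otherwise the trace of the relation would be an excluded relation for \<open>a\<^sub>0\<close>.
\<close>

lemma chevalley:
  assumes "finite I" and a0: "a0 \<in> A" and a: "\<And>i. i \<in> I \<Longrightarrow> a i \<in> A"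
    and not_ideal: "\<And>u b. u \<in> A \<Longrightarrow> coef u {#} \<noteq> 0 \<Longrightarrow> (\<And>i. i \<in> I \<Longrightarrow> b i \<in> A) \<Longrightarrow>
      u * a0 \<noteq> (\<Sum>i\<in>I. b i * a i)"
    and "h0 \<in> zpolys n" "\<And>i. i \<in> I \<Longrightarrow> h i \<in> zpolys n"
    and "a0 * h0 + (\<Sum>i\<in>I. a i * h i) = 0"
    and "\<And>m. m \<in> monoms h0 \<Longrightarrow> size m < D"
  shows "h0 \<in> sat_AV"
  using assms(5-)
proof (induction D arbitrary: h0 h)
  case 0
  then have "monoms h0 = {}" by blast
  then have "h0 = 0" by (simp only: keys_eq_empty)
  then show ?case using sat_AV_0 by simp
next
  case (Suc D)
  have diff: "permute_poly \<sigma> h0 - h0 \<in> sat_AV" if "\<sigma> \<in> \<Sigma>" for \<sigma>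
  proof (rule permute_poly_diff_mem[where Q = sat_AV, OF S.perm_group_axioms])
    fix i j assume ij: "i \<noteq> j" and s: "Transposition.transpose i j \<in> \<Sigma>"
    let ?s = "Transposition.transpose i j"
    have "?s i \<noteq> i" "?s j \<noteq> j" using ij by auto
    with S.permutes[OF s] have ij': "i \<in> {1..n}" "j \<in> {1..n}" unfolding permutes_def by blast+
    obtain g0 where g0: "g0 \<in> zpolys n" "permute_poly ?s h0 - h0 = (zvar i - zvar j) * g0"
      "\<And>m. m \<in> monoms g0 \<Longrightarrow> size m < D"
      using divided_difference[OF ij' ij Suc.prems(1,4)] by blast
    have "\<exists>g\<in>zpolys n. permute_poly ?s (h k) - h k = (zvar i - zvar j) * g" if "k \<in> I" for k
    proof -
      have "size m < Suc (Max (size ` monoms (h k)))" if "m \<in> monoms (h k)" for m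
        using that by (simp add: less_Suc_eq_le)
      from divided_difference[OF ij' ij Suc.prems(2)[OF \<open>k \<in> I\<close>] this] show ?thesis by blast
    qed
    then obtain g where g: "\<And>k. k \<in> I \<Longrightarrow> g k \<in> zpolys n"
      "\<And>k. k \<in> I \<Longrightarrow> permute_poly ?s (h k) - h k = (zvar i - zvar j) * g k" by metis
    have "(zvar i - zvar j) * (a0 * g0 + (\<Sum>k\<in>I. a k * g k)) =
      a0 * (permute_poly ?s h0 - h0) + (\<Sum>k\<in>I. a k * (permute_poly ?s (h k) - h k))"
    proof -
      have "(\<Sum>k\<in>I. a k * (permute_poly ?s (h k) - h k)) =
        (\<Sum>k\<in>I. a k * ((zvar i - zvar j) * g k))" using g by (intro sum.cong) auto
      also have "\<dots> = (zvar i - zvar j) * (\<Sum>k\<in>I. a k * g k)"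
        unfolding sum_distrib_left by (intro sum.cong) (simp_all only: mult.left_commute)
      finally show ?thesis by (simp only: g0(2) distrib_left mult.left_commute)
    qed
    also have "\<dots> = permute_poly ?s (a0 * h0 + (\<Sum>k\<in>I. a k * h k)) - (a0 * h0 + (\<Sum>k\<in>I. a k * h k))"
      using s a0 a by (simp add: permute_poly_sum S.bij S.invariantsD algebra_simps sum_subtractf)
    also have "\<dots> = 0" unfolding Suc.prems(3) using s by (simp add: S.bij)
    finally have "(zvar i - zvar j) * (a0 * g0 + (\<Sum>k\<in>I. a k * g k)) = 0" .
    moreover have "coef (zvar i - zvar j) {#i#} = 1"
      using ij by (simp add: lookup_minus lookup_single)
    then have "zvar i - zvar j \<noteq> 0" by auto
    ultimately have "a0 * g0 + (\<Sum>k\<in>I. a k * g k) = 0" by simp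
    then have "g0 \<in> sat_AV" using g0 g by (intro Suc.IH) auto
    then show "permute_poly ?s h0 - h0 \<in> sat_AV"
      unfolding g0 using ij'
      by (intro sat_AV_mult is_subringD(3)[OF is_subring_zpolys]) auto
  qed (fact transpose_mem sat_AV_add sat_AV_0 permute_sat_AV that)+
  let ?t = "S.trace h0"
  have t: "?t \<in> A" using Suc.prems by (intro S.trace_mem)
  have "coef ?t {#} = 0"
  proof (rule ccontr)
    assume *: "coef ?t {#} \<noteq> 0"
    have "a0 * ?t + (\<Sum>i\<in>I. a i * S.trace (h i)) = S.trace (a0 * h0 + (\<Sum>i\<in>I. a i * h i))"
      using a0 a by (simp add: S.trace_add S.trace_sum S.trace_mult)
    also have "\<dots> = 0" unfolding Suc.prems(3) by (simp add: S.trace_def S.bij)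
    finally have "?t * a0 = (\<Sum>i\<in>I. - S.trace (h i) * a i)"
      by (simp add: sum_negf eq_neg_iff_add_eq_0 mult.commute)
    moreover have "- S.trace (h i) \<in> A" if "i \<in> I" for i
      using that Suc.prems by (intro S.invariants_uminus S.trace_mem)
    ultimately show False using not_ideal[OF t *, of "\<lambda>i. - S.trace (h i)"] by blast
  qed
  then have "?t * 1 \<in> AV" using t
    by (intro plus_ideal_mult_mem is_subringD(1)[OF is_subring_zpolys])
  then have "?t \<in> sat_AV" using satq_superset[OF prime_or_zero_0] by simp
  moreover have "- (\<Sum>\<sigma>\<in>\<Sigma>. permute_poly \<sigma> h0 - h0) \<in> sat_AV"
    using sat_AV_mult[of "- 1", OF _ sat_AV_sum[OF diff]] is_subring_of_int[OF is_subring_zpolys, of "- 1"]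
    by simp
  ultimately have "?t + - (\<Sum>\<sigma>\<in>\<Sigma>. permute_poly \<sigma> h0 - h0) \<in> sat_AV" by (rule sat_AV_add)
  also have "?t + - (\<Sum>\<sigma>\<in>\<Sigma>. permute_poly \<sigma> h0 - h0) = of_int (int (card \<Sigma>)) * h0"
    by (simp add: S.trace_def sum_subtractf)
  finally have "of_int (int (card \<Sigma>)) * h0 \<in> sat_AV" .
  then show ?case using S.card_pos
    by (intro satq_idem[OF prime_or_zero_0, of "int (card \<Sigma>)" h0 "of_int (int (card \<Sigma>)) * h0"])
      simp_all
qed

text \<open>
  Modulo \<open>A\<^sub>+ W\<close>, an element of \<open>A\<close> acts through its constant term.
\<close>

lemma minus_const_mem:
  assumes "a \<in> A" "w \<in> W" "\<And>k w. w \<in> W \<Longrightarrow> of_int k * w \<in> W"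
  shows "(a - of_int (coef a {#})) * w \<in> plus_ideal A W"
  using assms by (intro plus_ideal_mult_mem S.invariants_diff S.invariants_of_int)
    (auto simp: lookup_minus lookup_of_int)

text \<open>
  Freeness of the polynomial ring over \<open>A\<close> in characteristic zero. Since \<open>\<theta> j0\<close> is not in
  \<open>A\<^sub>+ \<int>[V]\<close>, not even up to an integer factor, Chevalley's lemma gives \<open>u a\<^sub>j\<^sub>0 = \<Sum> b\<^sub>i a\<^sub>i\<close> for some
  \<open>u\<close> with nonzero constant term. Substituting this removes \<open>j0\<close> from the relation and replaces the
  other \<open>\<theta> i\<close> by \<open>u (\<theta> i) + b\<^sub>i (\<theta> j0)\<close>. Modulo \<open>A\<^sub>+ \<int>[V]\<close> these are integer combinations of the old
  family, and independent because the constant term of \<open>u\<close> is nonzero.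
\<close>

lemma independent_of_independent_mod_AV:
  assumes "finite J" and "\<And>j. j \<in> J \<Longrightarrow> \<theta> j \<in> zpolys n"
    and "\<And>z j. (\<Sum>j\<in>J. of_int (z j) * \<theta> j) \<in> sat_AV \<Longrightarrow> j \<in> J \<Longrightarrow> z j = 0"
    and "\<And>j. j \<in> J \<Longrightarrow> a j \<in> A" and "(\<Sum>j\<in>J. a j * \<theta> j) = 0" and "j \<in> J"
  shows "a j = 0"
  using assms
proof (induction J arbitrary: \<theta> a j rule: finite_induct)
  case (insert j0 J)
  have "\<theta> j0 \<notin> sat_AV"
  proof
    assume "\<theta> j0 \<in> sat_AV"
    then have "(\<Sum>j\<in>insert j0 J. of_int (if j = j0 then 1 else 0) * \<theta> j) \<in> sat_AV"
      using insert.hyps by (simp add: sum.neutral)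
    from insert.prems(2)[OF this, of j0] show False by simp
  qed
  moreover have "size m < Suc (Max (size ` monoms (\<theta> j0)))" if "m \<in> monoms (\<theta> j0)" for m
    using that by (simp add: less_Suc_eq_le)
  moreover have "a j0 * \<theta> j0 + (\<Sum>i\<in>J. a i * \<theta> i) = 0" using insert by simp
  ultimately obtain u b where u: "u \<in> A" "coef u {#} \<noteq> 0" and b: "\<And>i. i \<in> J \<Longrightarrow> b i \<in> A"
    and ub: "u * a j0 = (\<Sum>i\<in>J. b i * a i)"
    using chevalley[of J "a j0" a "\<theta> j0" \<theta>] insert.hyps insert.prems by blast
  define \<theta>' where "\<theta>' i = u * \<theta> i + b i * \<theta> j0" for i
  have a0: "a i = 0" if "i \<in> J" for i
  proof (rule insert.IH[of \<theta>' a, OF _ _ _ _ that])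
    show "\<theta>' j \<in> zpolys n" if "j \<in> J" for j
      using that u b insert.prems unfolding \<theta>'_def
      by (intro zpolys_add zpolys_mult) (auto intro: S.invariants_zpolys)
    show "a j \<in> A" if "j \<in> J" for j using that insert.prems by auto
    have "(\<Sum>j\<in>J. a j * \<theta>' j) = u * (\<Sum>j\<in>J. a j * \<theta> j) + (\<Sum>j\<in>J. b j * a j) * \<theta> j0"
      by (simp add: \<theta>'_def algebra_simps sum.distrib sum_distrib_left sum_distrib_right)
    also have "\<dots> = u * (\<Sum>j\<in>insert j0 J. a j * \<theta> j)"
      unfolding ub[symmetric] using insert.hyps by (simp add: algebra_simps)
    finally show "(\<Sum>j\<in>J. a j * \<theta>' j) = 0" using insert.prems by simp
    show "z j = 0" if z: "(\<Sum>j\<in>J. of_int (z j) * \<theta>' j) \<in> sat_AV" and j: "j \<in> J" for z j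
    proof -
      define z' where "z' i = (if i = j0 then \<Sum>i\<in>J. z i * coef (b i) {#} else z i * coef u {#})" for i
      \<comment> \<open>The part of the new relation that lies in \<open>A\<^sub>+ \<int>[V]\<close>; what remains has the integer
        coefficients \<open>z'\<close> in the old family.\<close>
      define r where "r i = (u - of_int (coef u {#})) * \<theta> i + (b i - of_int (coef (b i) {#})) * \<theta> j0" for i
      have r: "of_int (z i) * r i \<in> AV" if "i \<in> J" for i
        unfolding r_def using that u b insert.prems
        by (intro AV_of_int plus_ideal_add minus_const_mem)
          (auto intro!: zpolys_mult is_subring_of_int[OF is_subring_zpolys])
      have "(\<Sum>i\<in>J. of_int (z' i) * \<theta> i) = (\<Sum>i\<in>J. of_int (z i * coef u {#}) * \<theta> i)"
        using insert.hyps by (intro sum.cong) (auto simp: z'_def)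
      then have "(\<Sum>j\<in>insert j0 J. of_int (z' j) * \<theta> j) =
        (\<Sum>i\<in>J. of_int (z i) * \<theta>' i) + (\<Sum>i\<in>J. of_int (- z i) * r i)"
        using insert.hyps
        by (simp add: z'_def \<theta>'_def r_def algebra_simps sum.distrib sum_subtractf sum_distrib_left
            sum_distrib_right)
      also have "\<dots> \<in> sat_AV"
        using r by (intro sat_AV_add z satq_superset[OF prime_or_zero_0] plus_ideal_sum)
          (use AV_of_int[of _ "- 1"] in fastforce)
      finally have "z' j = 0" using insert.prems(2) j by blast
      then show ?thesis using insert.hyps j u by (auto simp: z'_def split: if_splits)
    qed
  qed
  have "u * a j0 = 0" unfolding ub using a0 by simp
  moreover have "u \<noteq> 0" using u by auto
  ultimately have "a j0 = 0" by simp
  then show ?case using a0 insert.prems by auto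
qed simp

text \<open>
  The trace over \<open>G\<close> maps \<open>A\<^sub>+ \<int>[V]\<close> to \<open>A\<^sub>+ M\<close> and multiplies elements of \<open>M\<close> by the order of \<open>G\<close>, a
  nonzero integer.
\<close>

lemma sat_AV_Int_M:
  assumes "f \<in> sat_AV" "f \<in> M" shows "f \<in> satq 0 AM"
proof -
  have tr: "G.trace g \<in> AM" if "g \<in> AV" for g
    using that
  proof induction
    case (add a w f)
    have "G.trace (a * w + f) = a * G.trace w + G.trace f"
      using add by (simp add: G.trace_add G.trace_mult A_subset_M)
    then show ?case using add by (auto intro: plus_ideal.add G.trace_mem)
  qed (auto simp: G.trace_def G.bij intro: plus_ideal.zero)
  obtain k where k: "k \<noteq> 0" "of_int k * f \<in> AV" using assms by (auto simp: satq_0)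
  have "G.trace (of_int k * f) = of_int (int (card G) * k) * f"
    using assms by (simp add: G.trace_invariant G.invariants_mult G.invariants_of_int mult.assoc)
  then show ?thesis using tr[OF k(2)] k(1) G.card_pos unfolding satq_0
    by (intro CollectI exI[of _ "int (card G) * k"]) auto
qed

end

section \<open>Orbit sums and the graded Nakayama lemma\<close>

definition lincombs :: "zpoly set \<Rightarrow> zpoly set \<Rightarrow> zpoly set"
  where "lincombs A B = {\<Sum>b\<in>B. c b * b | c. \<forall>b\<in>B. c b \<in> A}"

lemma lincombsI: "(\<And>b. b \<in> B \<Longrightarrow> c b \<in> A) \<Longrightarrow> (\<Sum>b\<in>B. c b * b) \<in> lincombs A B"
  by (auto simp: lincombs_def)

lemma lincombs_0: "is_subring A \<Longrightarrow> 0 \<in> lincombs A B"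
  using lincombsI[of B "\<lambda>_. 0" A] is_subringD(2)[of A] by simp

lemma lincombs_add:
  assumes A: "is_subring A" and "f \<in> lincombs A B" "g \<in> lincombs A B"
  shows "f + g \<in> lincombs A B"
proof -
  obtain c d where c: "f = (\<Sum>b\<in>B. c b * b)" "\<forall>b\<in>B. c b \<in> A"
    and d: "g = (\<Sum>b\<in>B. d b * b)" "\<forall>b\<in>B. d b \<in> A"
    using assms by (auto simp: lincombs_def)
  have "f + g = (\<Sum>b\<in>B. (c b + d b) * b)" by (simp add: c d distrib_right sum.distrib)
  then show ?thesis using c d lincombsI[of B "\<lambda>b. c b + d b" A] by (auto intro: is_subringD(6)[OF A])
qed

lemma lincombs_mult:
  assumes A: "is_subring A" and "f \<in> lincombs A B" "a \<in> A"
  shows "a * f \<in> lincombs A B"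
proof -
  obtain c where c: "f = (\<Sum>b\<in>B. c b * b)" "\<forall>b\<in>B. c b \<in> A"
    using assms by (auto simp: lincombs_def)
  have "a * f = (\<Sum>b\<in>B. (a * c b) * b)" by (simp add: c sum_distrib_left mult.assoc)
  then show ?thesis using c lincombsI[of B "\<lambda>b. a * c b" A] assms by (auto intro: is_subringD(4)[OF A])
qed

definition orbit_sum :: "(nat \<Rightarrow> nat) set \<Rightarrow> nat multiset \<Rightarrow> zpoly"
  where "orbit_sum H m = (\<Sum>m'\<in>(\<lambda>\<sigma>. image_mset \<sigma> m) ` H. zterm m' 1)"

context perm_group
begin

abbreviation mset_orbit :: "nat multiset \<Rightarrow> nat multiset set"
  where "mset_orbit m \<equiv> (\<lambda>\<sigma>. image_mset \<sigma> m) ` H"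

lemma coef_orbit_sum: "coef (orbit_sum H m) m' = (if m' \<in> mset_orbit m then 1 else 0)"
  using finite_group by (simp add: orbit_sum_def lookup_sum lookup_single when_def)

lemma orbit_image_mset: assumes "\<sigma> \<in> H" "m' \<in> mset_orbit m" shows "image_mset \<sigma> m' \<in> mset_orbit m"
proof -
  obtain \<tau> where "\<tau> \<in> H" "m' = image_mset \<tau> m" using assms by auto
  then have "image_mset \<sigma> m' = image_mset (\<sigma> \<circ> \<tau>) m" by (simp add: multiset.map_comp)
  then show ?thesis using comp_mem[OF assms(1) \<open>\<tau> \<in> H\<close>] by blast
qed

lemma orbit_self: "m \<in> mset_orbit m"
  by (intro image_eqI[OF _ id_mem]) simp

lemma orbit_sum_mem: assumes "set_mset m \<subseteq> {1..n}" shows "orbit_sum H m \<in> zinvariants n H"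
proof -
  have "permute_poly \<sigma> (orbit_sum H m) = orbit_sum H m" if \<sigma>: "\<sigma> \<in> H" for \<sigma>
  proof (rule poly_mapping_eqI)
    fix m'
    have "image_mset (Hilbert_Choice.inv \<sigma>) m' \<in> mset_orbit m \<longleftrightarrow> m' \<in> mset_orbit m"
    proof
      assume "image_mset (Hilbert_Choice.inv \<sigma>) m' \<in> mset_orbit m"
      from orbit_image_mset[OF \<sigma> this] show "m' \<in> mset_orbit m"
        using bij[OF \<sigma>] by (simp add: multiset.map_comp surj_iff[THEN iffD1, OF bij_is_surj])
    qed (rule orbit_image_mset[OF inv_mem[OF \<sigma>]])
    then show "coef (permute_poly \<sigma> (orbit_sum H m)) m' = coef (orbit_sum H m) m'"
      by (simp add: coef_permute_poly bij \<sigma> coef_orbit_sum)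
  qed
  moreover have "set_mset (image_mset \<sigma> m) \<subseteq> {1..n}" if "\<sigma> \<in> H" for \<sigma>
    using assms permutes_in_image[OF permutes[OF that]] by (auto simp del: atLeastAtMost_iff)
  then have "zterm m' 1 \<in> zpolys n" if "m' \<in> mset_orbit m" for m'
    using that unfolding zpolys_zterm by blast
  then have "orbit_sum H m \<in> zpolys n" unfolding orbit_sum_def
    by (intro is_subring_sum[OF is_subring_zpolys])
  ultimately show ?thesis by (simp add: zinvariants_def)
qed

lemma hcomp_orbit_sum: "hcomp (size m) (orbit_sum H m) = orbit_sum H m"
  by (rule poly_mapping_eqI) (auto simp: coef_hcomp coef_orbit_sum)

text \<open>
  The coefficients of an invariant are constant on orbits of monomials, so subtracting a multiple of
  an orbit sum removes a whole orbit from it.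
\<close>

lemma orbit_sums_generate:
  assumes "f \<in> zinvariants n H" "hcomp d f = f"
  shows "\<exists>w. f = (\<Sum>b\<in>orbit_sum H ` multisets_of_size {1..n} d. of_int (w b) * b)"
  using assms
proof (induction "card (monoms f)" arbitrary: f rule: less_induct)
  case less
  let ?B = "orbit_sum H ` multisets_of_size {1..n} d"
  have finB: "finite ?B" by blast
  show ?case
  proof (cases "f = 0")
    case False
    then obtain m where m: "m \<in> monoms f" by (metis keys_eq_empty ex_in_conv)
    then have size: "size m = d" and sub: "set_mset m \<subseteq> {1..n}"
      using monoms_hcomp[of d f] less.prems by (auto simp: zinvariants_def zpolys_def)
    define f' where "f' = f - of_int (coef f m) * orbit_sum H m"
    have const: "coef f m' = coef f m" if "m' \<in> mset_orbit m" for m'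
    proof -
      from that obtain \<sigma> where \<sigma>: "\<sigma> \<in> H" "m' = image_mset \<sigma> m" by auto
      have "coef f m' = coef (permute_poly \<sigma> f) m'" using \<sigma> less.prems by (simp add: invariantsD)
      also have "\<dots> = coef f m"
        using bij[OF \<sigma>(1)] \<sigma> by (simp add: coef_permute_poly multiset.map_comp bij_is_inj)
      finally show ?thesis .
    qed
    have coef': "coef f' m' = (if m' \<in> mset_orbit m then 0 else coef f m')" for m'
      using const by (simp add: f'_def lookup_minus coef_orbit_sum)
    have "m \<notin> monoms f'" using coef'[of m] orbit_self[of m] by (simp add: in_keys_iff)
    moreover have "monoms f' \<subseteq> monoms f" using coef' by (auto simp: in_keys_iff split: if_splits)
    ultimately have "monoms f' \<subset> monoms f" using m by blast
    then have "card (monoms f') < card (monoms f)" by (intro psubset_card_mono) auto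
    moreover have "f' \<in> zinvariants n H" unfolding f'_def using less.prems sub
      by (intro invariants_diff invariants_mult invariants_of_int orbit_sum_mem)
    moreover have "hcomp d f' = f'"
      using less.prems hcomp_orbit_sum[of m] size by (simp add: f'_def hcomp_diff hcomp_of_int_mult)
    ultimately obtain w where w: "f' = (\<Sum>b\<in>?B. of_int (w b) * b)" using less.hyps by blast
    have "f = f' + (\<Sum>b\<in>?B. of_int (if b = orbit_sum H m then coef f m else 0) * b)"
    proof -
      have "orbit_sum H m \<in> ?B" using size sub by (auto simp: multisets_of_size_def)
      then have "(\<Sum>b\<in>?B. of_int (if b = orbit_sum H m then coef f m else 0) * b) =
        of_int (coef f m) * orbit_sum H m"
        using finB by (subst sum.remove[of _ "orbit_sum H m"]) (auto intro!: sum.neutral)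
      then show ?thesis by (simp add: f'_def)
    qed
    also have "\<dots> = (\<Sum>b\<in>?B. of_int (w b + (if b = orbit_sum H m then coef f m else 0)) * b)"
      unfolding w of_int_add distrib_right sum.distrib ..
    finally show ?thesis by (rule exI[where x = "\<lambda>b. w b + (if b = orbit_sum H m then coef f m else 0)"])
  qed (auto intro!: exI[of _ "\<lambda>_. 0"])
qed

end

lemma of_int_dvd_hcomp: "of_int q dvd f \<Longrightarrow> of_int q dvd hcomp d f"
  by (auto simp: dvd_def hcomp_of_int_mult)

context young_pair
begin

text \<open>
  The components of degree \<open>d\<close> of an element of \<open>A\<^sub>+ M\<close> only involve elements of \<open>M\<close> of degree less
  than \<open>d\<close>, because elements of \<open>A\<^sub>+\<close> have no component of degree zero. The set \<open>W\<close> is arbitrary so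
  that the lemma shows both that \<open>A\<^sub>+ M\<close> is graded and the induction step of the Nakayama lemma.
\<close>

lemma hcomp_AM:
  assumes "f \<in> AM" and "0 \<in> W" and "\<And>x y. x \<in> W \<Longrightarrow> y \<in> W \<Longrightarrow> x + y \<in> W"
    and W: "\<And>e a w. 0 < e \<Longrightarrow> e \<le> d \<Longrightarrow> a \<in> A \<Longrightarrow> coef a {#} = 0 \<Longrightarrow> w \<in> M \<Longrightarrow> hcomp (d - e) w = w \<Longrightarrow>
      a * w \<in> W"
  shows "hcomp d f \<in> W"
  using assms(1)
proof induction
  case (add a w f)
  have sumW: "(\<Sum>i\<in>I. g i) \<in> W" if "\<And>i. i \<in> I \<Longrightarrow> g i \<in> W" for I :: "nat set" and g
    using that by (induction I rule: infinite_finite_induct) (auto intro: assms)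
  have "hcomp e a * hcomp (d - e) w \<in> W" if "e \<le> d" for e
  proof (cases "e = 0")
    case True
    have "hcomp 0 a = 0" using add by (intro poly_mapping_eqI) (simp add: coef_hcomp)
    then show ?thesis using True assms by simp
  next
    case False
    have "hcomp (d - e) (hcomp (d - e) w) = hcomp (d - e) w"
      by (rule poly_mapping_eqI) (simp add: coef_hcomp)
    then show ?thesis using False that add
      by (intro W[of e]) (auto simp: coef_hcomp intro: S.invariants_hcomp G.invariants_hcomp)
  qed
  then have "(\<Sum>e\<le>d. hcomp e a * hcomp (d - e) w) \<in> W" by (intro sumW) simp
  from assms(3)[OF this add.IH] show ?case by (simp add: hcomp_add hcomp_mult)
qed (use assms in simp)

text \<open>
  Homogeneous elements that generate \<open>M\<close> modulo \<open>A\<^sub>+ M\<close> generate it over \<open>A\<close>, by induction on the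
  degree. The generation is over the integers and up to factors prime to \<open>q\<close>, which is generation over
  the fraction field of \<open>\<int>/q\<close>.
\<close>

theorem graded_nakayama:
  assumes q: "prime_or_zero q" and hom: "\<And>b. b \<in> B \<Longrightarrow> \<exists>d. hcomp d b = b"
    and gen: "\<And>f. f \<in> M \<Longrightarrow> \<exists>k \<alpha> z. \<not> q dvd k \<and> \<alpha> \<in> AM \<and>
      of_int q dvd of_int k * f - (\<alpha> + (\<Sum>b\<in>B. of_int (z b) * b))"
    and f: "f \<in> M"
  shows "f \<in> satq q (lincombs A B)"
proof -
  let ?W = "satq q (lincombs A B)"
  note A = S.is_subring_invariants
  have lin_of_int: "of_int k * f \<in> lincombs A B" if "f \<in> lincombs A B" for f k
    by (rule lincombs_mult[OF A that S.invariants_of_int])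
  note W_add = satq_add[OF q _ _ lincombs_add[OF A] lin_of_int]
  have W_0: "0 \<in> ?W" by (rule satq_superset[OF q lincombs_0[OF A]])
  have W_mult: "a * w \<in> ?W" if "a \<in> A" "w \<in> ?W" for a w
    using that by (intro satq_mult) (auto intro: lincombs_mult[OF A])
  have hom_W: "f \<in> ?W" if "f \<in> M" "hcomp d f = f" for f d
    using that
  proof (induction d arbitrary: f rule: less_induct)
    case (less d)
    obtain k \<alpha> z where k: "\<not> q dvd k" and \<alpha>: "\<alpha> \<in> AM"
      and dvd: "of_int q dvd of_int k * f - (\<alpha> + (\<Sum>b\<in>B. of_int (z b) * b))"
      using gen[OF less.prems(1)] by blast
    have dvd': "of_int q dvd of_int k * f - (hcomp d \<alpha> + (\<Sum>b\<in>B. of_int (z b) * hcomp d b))"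
      using of_int_dvd_hcomp[OF dvd, of d] less.prems(2)
      by (simp add: hcomp_diff hcomp_add hcomp_of_int_mult hcomp_sum)
    have "hcomp d \<alpha> \<in> ?W"
      by (rule hcomp_AM[OF \<alpha> W_0 W_add]) (auto intro!: W_mult less.IH)
    moreover have "(\<Sum>b\<in>B. of_int (z b) * hcomp d b) \<in> ?W"
    proof -
      have "hcomp d b = of_int (if hcomp d b = b then 1 else 0) * b" if b: "b \<in> B" for b
      proof -
        obtain e where "hcomp e b = b" using hom b by blast
        moreover have "hcomp d (hcomp e b) = (if d = e then hcomp e b else 0)"
          by (rule poly_mapping_eqI) (auto simp: coef_hcomp)
        ultimately show ?thesis by auto
      qed
      then have "(\<Sum>b\<in>B. of_int (z b) * hcomp d b) =
        (\<Sum>b\<in>B. of_int (z b * (if hcomp d b = b then 1 else 0)) * b)"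
        by (intro sum.cong) (auto split: if_splits)
      also have "\<dots> \<in> lincombs A B" by (intro lincombsI S.invariants_of_int)
      finally show ?thesis by (rule satq_superset[OF q])
    qed
    ultimately have "hcomp d \<alpha> + (\<Sum>b\<in>B. of_int (z b) * hcomp d b) \<in> ?W" by (rule W_add)
    then show ?case by (rule satq_idem[OF q k dvd'])
  qed
  define D where "D = Max (size ` monoms f)"
  have "f = (\<Sum>d\<le>D. hcomp d f)" by (rule sum_hcomp) (simp add: D_def)
  moreover have "(\<Sum>d\<le>D. hcomp d f) \<in> ?W"
  proof (rule satq_sum[OF q _ lincombs_0[OF A] lincombs_add[OF A] lin_of_int])
    fix d
    have "hcomp d (hcomp d f) = hcomp d f" by (rule poly_mapping_eqI) (simp add: coef_hcomp)
    then show "hcomp d f \<in> ?W" using f by (intro hom_W[of _ d] G.invariants_hcomp)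
  qed
  ultimately show ?thesis by simp
qed

section \<open>Universal generators\<close>

text \<open>
  The preimage in \<open>M\<close> of the torsion subgroup of \<open>M / A\<^sub>+ M\<close>.
\<close>

abbreviation "sat_AM \<equiv> satq 0 AM"

lemma sat_AM_0: "0 \<in> sat_AM"
  by (rule satq_superset[OF prime_or_zero_0 plus_ideal.zero])

lemma sat_AM_add: "f \<in> sat_AM \<Longrightarrow> g \<in> sat_AM \<Longrightarrow> f + g \<in> sat_AM"
  by (rule satq_add[OF prime_or_zero_0 _ _ plus_ideal_add AM_of_int])

lemma sat_AM_of_int: "f \<in> sat_AM \<Longrightarrow> of_int k * f \<in> sat_AM"
  by (rule satq_mult) (auto intro: AM_of_int)

lemma sat_AM_sum: "(\<And>i. i \<in> I \<Longrightarrow> f i \<in> sat_AM) \<Longrightarrow> (\<Sum>i\<in>I. f i) \<in> sat_AM"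
  by (rule satq_sum[OF prime_or_zero_0 _ plus_ideal.zero plus_ideal_add AM_of_int])

lemma sat_AM_saturated: "k \<noteq> 0 \<Longrightarrow> of_int k * f \<in> sat_AM \<Longrightarrow> f \<in> sat_AM"
  by (rule satq_idem[OF prime_or_zero_0, of k f "of_int k * f"]) simp_all

lemma sat_AM_hcomp:
  assumes "f \<in> sat_AM" shows "hcomp d f \<in> sat_AM"
proof -
  obtain k where k: "k \<noteq> 0" "of_int k * f \<in> AM" using assms by (auto simp: satq_0)
  have "hcomp d (of_int k * f) \<in> AM"
    by (rule hcomp_AM[OF k(2)]) (auto intro: plus_ideal.zero plus_ideal_add plus_ideal_mult_mem)
  then show ?thesis using k(1) by (auto simp: satq_0 hcomp_of_int_mult)
qed

lemma homogeneous_basis: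
  obtains B where "finite B" "\<And>b. b \<in> B \<Longrightarrow> b \<in> M \<and> hcomp d b = b"
    "\<And>f. f \<in> M \<Longrightarrow> hcomp d f = f \<Longrightarrow> \<exists>w. f - (\<Sum>b\<in>B. of_int (w b) * b) \<in> sat_AM"
    "\<And>z b. (\<Sum>b\<in>B. of_int (z b) * b) \<in> sat_AM \<Longrightarrow> b \<in> B \<Longrightarrow> z b = 0"
proof -
  let ?L = "{f \<in> M. hcomp d f = f}" and ?B0 = "orbit_sum G ` multisets_of_size {1..n} d"
  have 1: "x + y \<in> ?L" if "x \<in> ?L" "y \<in> ?L" for x y
    using that by (auto simp: hcomp_add intro: G.invariants_add)
  have 2: "of_int k * x \<in> ?L" if "x \<in> ?L" for k x
    using that by (auto simp: hcomp_of_int_mult intro: G.invariants_mult G.invariants_of_int)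
  have 3: "?B0 \<subseteq> ?L"
    using G.orbit_sum_mem G.hcomp_orbit_sum by (auto simp: multisets_of_size_def)
  have 4: "\<exists>w. x = (\<Sum>b\<in>?B0. of_int (w b) * b)" if "x \<in> ?L" for x
    using that by (intro G.orbit_sums_generate) auto
  have 5: "finite ?B0" by blast
  show ?thesis
  proof (rule saturated_quotient_basis[OF sat_AM_0 sat_AM_add sat_AM_of_int sat_AM_saturated 1 2 5 3 4])
    fix B assume B: "finite B" "B \<subseteq> ?L" "\<And>x. x \<in> ?L \<Longrightarrow> \<exists>w. x - (\<Sum>b\<in>B. of_int (w b) * b) \<in> sat_AM"
      "\<And>z b. (\<Sum>b\<in>B. of_int (z b) * b) \<in> sat_AM \<Longrightarrow> b \<in> B \<Longrightarrow> z b = 0"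
    show thesis
      by (rule that[of B]) (use B(1-3) in \<open>auto intro: B(4)\<close>)
  qed
qed

lemma independent_mod_sat_AM_imp_independent:
  assumes "finite B" "B \<subseteq> M" "\<And>z b. (\<Sum>b\<in>B. of_int (z b) * b) \<in> sat_AM \<Longrightarrow> b \<in> B \<Longrightarrow> z b = 0"
  shows "independent_mod 0 A B"
  unfolding independent_mod_def
proof (intro allI impI ballI)
  fix c b assume c: "\<forall>b\<in>B. c b \<in> A" "of_int 0 dvd (\<Sum>b\<in>B. c b * b)" and b: "b \<in> B"
  have "c b = 0"
  proof (rule independent_of_independent_mod_AV[of B id c])
    show "z j = 0" if "(\<Sum>j\<in>B. of_int (z j) * id j) \<in> sat_AV" "j \<in> B" for z j
    proof (rule assms(3))
      show "(\<Sum>b\<in>B. of_int (z b) * b) \<in> sat_AM" using that assms(2)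
        by (intro sat_AV_Int_M G.invariants_sum G.invariants_mult G.invariants_of_int) auto
    qed (rule that)
  qed (use c b assms in \<open>auto intro: G.invariants_zpolys\<close>)
  then show "of_int 0 dvd c b" by simp
qed

text \<open>
  The union over all degrees of bases of \<open>M\<close> modulo \<open>sat_AM\<close>. Every finite part of it is independent
  over \<open>A\<close>, so the upper bound for the rank makes the union finite; it generates over \<open>\<rat>\<close> by the
  Nakayama lemma, so the lower bound determines its cardinality.
\<close>

theorem universal_generators:
  obtains \<Theta> where "finite \<Theta>" "card \<Theta> = card T" "\<Theta> \<subseteq> M" "\<And>b. b \<in> \<Theta> \<Longrightarrow> \<exists>d. hcomp d b = b"
    "\<And>f. f \<in> M \<Longrightarrow> f \<in> satq 0 (lincombs A \<Theta>)"
    "\<And>f. f \<in> M \<Longrightarrow> \<exists>w. f - (\<Sum>b\<in>\<Theta>. of_int (w b) * b) \<in> sat_AM"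
    "\<And>z b. (\<Sum>b\<in>\<Theta>. of_int (z b) * b) \<in> sat_AM \<Longrightarrow> b \<in> \<Theta> \<Longrightarrow> z b = 0"
proof -
  have "\<forall>d. \<exists>B. finite B \<and> (\<forall>b\<in>B. b \<in> M \<and> hcomp d b = b) \<and>
    (\<forall>f. f \<in> M \<and> hcomp d f = f \<longrightarrow> (\<exists>w. f - (\<Sum>b\<in>B. of_int (w b) * b) \<in> sat_AM)) \<and>
    (\<forall>z. (\<Sum>b\<in>B. of_int (z b) * b) \<in> sat_AM \<longrightarrow> (\<forall>b\<in>B. z b = 0))"
  proof
    fix d
    show "\<exists>B. finite B \<and> (\<forall>b\<in>B. b \<in> M \<and> hcomp d b = b) \<and>
      (\<forall>f. f \<in> M \<and> hcomp d f = f \<longrightarrow> (\<exists>w. f - (\<Sum>b\<in>B. of_int (w b) * b) \<in> sat_AM)) \<and>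
      (\<forall>z. (\<Sum>b\<in>B. of_int (z b) * b) \<in> sat_AM \<longrightarrow> (\<forall>b\<in>B. z b = 0))" (is ?ex)
    proof (rule homogeneous_basis[of d])
      fix B assume "finite B" "\<And>b. b \<in> B \<Longrightarrow> b \<in> M \<and> hcomp d b = b"
        "\<And>f. f \<in> M \<Longrightarrow> hcomp d f = f \<Longrightarrow> \<exists>w. f - (\<Sum>b\<in>B. of_int (w b) * b) \<in> sat_AM"
        "\<And>z b. (\<Sum>b\<in>B. of_int (z b) * b) \<in> sat_AM \<Longrightarrow> b \<in> B \<Longrightarrow> z b = 0"
      then show ?ex by (intro exI[of _ B]) auto
    qed
  qed
  from choice[OF this] obtain Bs where Bs: "\<forall>d. finite (Bs d) \<and> (\<forall>b\<in>Bs d. b \<in> M \<and> hcomp d b = b) \<and>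
    (\<forall>f. f \<in> M \<and> hcomp d f = f \<longrightarrow> (\<exists>w. f - (\<Sum>b\<in>Bs d. of_int (w b) * b) \<in> sat_AM)) \<and>
    (\<forall>z. (\<Sum>b\<in>Bs d. of_int (z b) * b) \<in> sat_AM \<longrightarrow> (\<forall>b\<in>Bs d. z b = 0))" ..
  then have fin: "finite (Bs d)" and memM: "b \<in> Bs d \<Longrightarrow> b \<in> M" and hom: "b \<in> Bs d \<Longrightarrow> hcomp d b = b"
    and gens: "f \<in> M \<Longrightarrow> hcomp d f = f \<Longrightarrow> \<exists>w. f - (\<Sum>b\<in>Bs d. of_int (w b) * b) \<in> sat_AM"
    and indep: "(\<Sum>b\<in>Bs d. of_int (z b) * b) \<in> sat_AM \<Longrightarrow> b \<in> Bs d \<Longrightarrow> z b = 0" for d b f z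
    by blast+
  define \<Theta> where "\<Theta> = (\<Union>d. Bs d)"
  have nonzero: "b \<noteq> 0" if "b \<in> Bs d" for b d
  proof
    assume "b = 0"
    have "(\<Sum>x\<in>Bs d. of_int (if x = b then 1 else 0) * x) = 0"
      using \<open>b = 0\<close> by (intro sum.neutral) auto
    then show False using indep[of "\<lambda>x. if x = b then 1 else 0" d b] that sat_AM_0 by simp
  qed
  have hcomp_other: "hcomp d b = (if b \<in> Bs d then b else 0)" if "b \<in> \<Theta>" for b d
  proof -
    from that obtain e where e: "b \<in> Bs e" by (auto simp: \<Theta>_def)
    have *: "hcomp d (hcomp e b) = (if d = e then hcomp e b else 0)"
      by (rule poly_mapping_eqI) (auto simp: coef_hcomp)
    show ?thesis
    proof (cases "d = e")
      case False
      then have "hcomp d b = 0" using * hom[OF e] by simp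
      then show ?thesis using hom[of b d] nonzero[OF e] by auto
    qed (use e hom in simp)
  qed
  have \<Theta>M: "\<Theta> \<subseteq> M" using memM by (auto simp: \<Theta>_def)
  have indep_fin: "z b = 0" if F: "finite F" "F \<subseteq> \<Theta>" "(\<Sum>b\<in>F. of_int (z b) * b) \<in> sat_AM" "b \<in> F" for F z b
  proof -
    obtain d where d: "b \<in> Bs d" using F by (auto simp: \<Theta>_def)
    have "hcomp d (\<Sum>b\<in>F. of_int (z b) * b) = (\<Sum>b\<in>F. if b \<in> Bs d then of_int (z b) * b else 0)"
      unfolding hcomp_sum hcomp_of_int_mult
      by (intro sum.cong refl) (use F(2) hcomp_other in auto)
    also have "\<dots> = (\<Sum>b\<in>F \<inter> Bs d. of_int (z b) * b)"
      using F(1) by (simp add: sum.inter_restrict)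
    also have "\<dots> = (\<Sum>b\<in>Bs d. of_int (if b \<in> F then z b else 0) * b)"
    proof -
      have "(\<Sum>b\<in>Bs d. of_int (if b \<in> F then z b else 0) * b) =
        (\<Sum>b\<in>Bs d. if b \<in> F then of_int (z b) * b else 0)" by (intro sum.cong) auto
      also have "\<dots> = (\<Sum>b\<in>Bs d \<inter> F. of_int (z b) * b)" by (simp add: sum.inter_restrict[OF fin])
      finally show ?thesis by (simp add: Int_commute)
    qed
    finally have "(\<Sum>b\<in>Bs d. of_int (if b \<in> F then z b else 0) * b) \<in> sat_AM" using sat_AM_hcomp[OF F(3), of d] by simp
    from indep[OF this d] F(4) show ?thesis by simp
  qed
  have bound: "card F \<le> card T" if F: "finite F" "F \<subseteq> \<Theta>" for F
  proof (rule card_independent_le[OF prime_or_zero_0])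
    show "independent_mod 0 A F"
      using F \<Theta>M indep_fin[OF F] by (intro independent_mod_sat_AM_imp_independent) auto
  qed (use F \<Theta>M in auto)
  then have fin\<Theta>: "finite \<Theta>" and card_le: "card \<Theta> \<le> card T"
    using finite_if_finite_subsets_card_bdd[of \<Theta> "card T"] by auto
  have gen\<Theta>: "\<exists>w. f - (\<Sum>b\<in>\<Theta>. of_int (w b) * b) \<in> sat_AM" if f: "f \<in> M" for f
  proof -
    have "\<exists>w. hcomp d f - (\<Sum>b\<in>\<Theta>. of_int (w b) * b) \<in> sat_AM" for d
    proof -
      have "hcomp d (hcomp d f) = hcomp d f" by (rule poly_mapping_eqI) (simp add: coef_hcomp)
      then obtain w where w: "hcomp d f - (\<Sum>b\<in>Bs d. of_int (w b) * b) \<in> sat_AM"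
        using gens G.invariants_hcomp[OF f] by blast
      have "(\<Sum>b\<in>\<Theta>. of_int (if b \<in> Bs d then w b else 0) * b) = (\<Sum>b\<in>Bs d. of_int (w b) * b)"
        using fin\<Theta> by (intro sum.mono_neutral_cong_right) (auto simp: \<Theta>_def)
      then show ?thesis using w by (intro exI[of _ "\<lambda>b. if b \<in> Bs d then w b else 0"]) simp
    qed
    then obtain w where w: "\<And>d. hcomp d f - (\<Sum>b\<in>\<Theta>. of_int (w d b) * b) \<in> sat_AM" by metis
    define D where "D = Max (size ` monoms f)"
    have f_eq: "f = (\<Sum>d\<le>D. hcomp d f)" by (rule sum_hcomp) (simp add: D_def)
    have "(\<Sum>b\<in>\<Theta>. of_int (\<Sum>d\<le>D. w d b) * b) = (\<Sum>d\<le>D. \<Sum>b\<in>\<Theta>. of_int (w d b) * b)"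
      by (subst sum.swap) (simp add: sum_distrib_right)
    then have "f - (\<Sum>b\<in>\<Theta>. of_int (\<Sum>d\<le>D. w d b) * b) =
      (\<Sum>d\<le>D. hcomp d f - (\<Sum>b\<in>\<Theta>. of_int (w d b) * b))"
      by (subst f_eq) (simp add: sum_subtractf)
    also have "\<dots> \<in> sat_AM" by (intro sat_AM_sum w)
    finally show ?thesis by (rule exI[where x = "\<lambda>b. \<Sum>d\<le>D. w d b"])
  qed
  have span0: "f \<in> satq 0 (lincombs A \<Theta>)" if f: "f \<in> M" for f
  proof (rule graded_nakayama[OF prime_or_zero_0 _ _ f])
    show "\<exists>d. hcomp d b = b" if "b \<in> \<Theta>" for b using that hom by (auto simp: \<Theta>_def)
    fix g assume "g \<in> M"
    then obtain w where "g - (\<Sum>b\<in>\<Theta>. of_int (w b) * b) \<in> sat_AM" using gen\<Theta> by blast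
    then obtain k where k: "k \<noteq> 0" "of_int k * (g - (\<Sum>b\<in>\<Theta>. of_int (w b) * b)) \<in> AM"
      by (auto simp: satq_0)
    have "of_int k * g - (of_int k * (g - (\<Sum>b\<in>\<Theta>. of_int (w b) * b)) + (\<Sum>b\<in>\<Theta>. of_int (k * w b) * b)) = 0"
      by (simp add: algebra_simps sum_distrib_left)
    then show "\<exists>k \<alpha> z. \<not> 0 dvd k \<and> \<alpha> \<in> AM \<and>
      of_int 0 dvd of_int k * g - (\<alpha> + (\<Sum>b\<in>\<Theta>. of_int (z b) * b))"
      using k by (intro exI[of _ k] exI[of _ "of_int k * (g - (\<Sum>b\<in>\<Theta>. of_int (w b) * b))"]
          exI[of _ "\<lambda>b. k * w b"]) auto
  qed
  have "card T \<le> card \<Theta>"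
  proof (rule card_spanning_ge[OF prime_or_zero_0 fin\<Theta>])
    fix f assume "f \<in> M"
    from span0[OF this] obtain k c where "k \<noteq> 0" "\<forall>b\<in>\<Theta>. c b \<in> A" "of_int k * f = (\<Sum>b\<in>\<Theta>. c b * b)"
      by (auto simp: satq_0 lincombs_def)
    then show "\<exists>s\<in>A. \<not> of_int 0 dvd s \<and>
      (\<exists>c. (\<forall>b\<in>\<Theta>. c b \<in> A) \<and> of_int 0 dvd s * f - (\<Sum>b\<in>\<Theta>. c b * b))"
      by (intro bexI[of _ "of_int k"] conjI exI[of _ c]) (auto intro: S.invariants_of_int)
  qed
  with card_le have "card \<Theta> = card T" by simp
  then show ?thesis
    using fin\<Theta> \<Theta>M hom span0 gen\<Theta> indep_fin[OF fin\<Theta> order_refl]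
    by (intro that[of \<Theta>]) (auto simp: \<Theta>_def)
qed

text \<open>
  For \<open>f\<close> in \<open>M\<close> outside \<open>\<Theta>\<close>, the \<open>\<ell> + 1\<close> elements \<open>f\<close> and \<open>\<theta> \<in> \<Theta>\<close> are, modulo \<open>p\<close> and \<open>A\<^sub>+ M\<close>, combinations
  of the at most \<open>\<ell>\<close> elements of \<open>B\<close>, so some combination of them with coefficients not all divisible
  by \<open>p\<close> vanishes there. If the coefficient of \<open>f\<close> is prime to \<open>p\<close>, this expresses \<open>f\<close> as the Nakayama
  lemma requires. Otherwise it is a relation among the \<open>\<theta>\<close> modulo \<open>p M + A\<^sub>+ M\<close>; writing the multiple
  of \<open>p\<close> in terms of \<open>\<Theta>\<close> modulo \<open>sat_AM\<close> turns it into a relation modulo \<open>sat_AM\<close>, whose integer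
  coefficients vanish, so that \<open>p\<close> divided all coefficients after all.
\<close>

theorem generators_mod_good_prime:
  assumes p: "prime_or_zero p" "p \<noteq> 0" and \<Theta>: "finite \<Theta>" "card \<Theta> = card T" "\<Theta> \<subseteq> M"
    and hom: "\<And>b. b \<in> \<Theta> \<Longrightarrow> \<exists>d. hcomp d b = b"
    and gen: "\<And>f. f \<in> M \<Longrightarrow> \<exists>w. f - (\<Sum>b\<in>\<Theta>. of_int (w b) * b) \<in> sat_AM"
    and indep: "\<And>z b. (\<Sum>b\<in>\<Theta>. of_int (z b) * b) \<in> sat_AM \<Longrightarrow> b \<in> \<Theta> \<Longrightarrow> z b = 0"
    and B: "finite B" "B \<subseteq> M" "independent_mod p A B"
    and span: "\<And>f. f \<in> M \<Longrightarrow> f \<in> satq p (lincombs A B)"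
    and f: "f \<in> M"
  shows "f \<in> satq p (lincombs A \<Theta>)"
proof (rule graded_nakayama[OF p(1) hom _ f])
  fix f assume f: "f \<in> M"
  show "\<exists>k \<alpha> z. \<not> p dvd k \<and> \<alpha> \<in> AM \<and> of_int p dvd of_int k * f - (\<alpha> + (\<Sum>b\<in>\<Theta>. of_int (z b) * b))"
  proof (cases "f \<in> \<Theta>")
    case True
    have "(\<Sum>b\<in>\<Theta>. of_int (if b = f then 1 else 0) * b) = f"
      using \<Theta>(1) True by (subst sum.remove[of _ f]) (auto intro!: sum.neutral)
    then show ?thesis using p
      by (intro exI[of _ 1] exI[of _ 0] exI[of _ "\<lambda>b. if b = f then 1 else 0"])
        (auto simp: prime_or_zero_def intro: plus_ideal.zero)
  next
    case False
    let ?J = "insert f \<Theta>"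
    have JM: "?J \<subseteq> M" using f \<Theta> by auto
    have reduce: "\<exists>k t. \<not> p dvd k \<and> (\<exists>\<alpha>\<in>AM. of_int p dvd of_int k * g - (\<alpha> + (\<Sum>b\<in>B. of_int (t b) * b)))"
      if "g \<in> M" for g
    proof -
      from span[OF that] obtain k c where k: "\<not> p dvd k" and c: "\<forall>b\<in>B. c b \<in> A"
        and dvd: "of_int p dvd of_int k * g - (\<Sum>b\<in>B. c b * b)"
        by (auto simp: satq_def lincombs_def)
      let ?\<alpha> = "\<Sum>b\<in>B. (c b - of_int (coef (c b) {#})) * b"
      have "?\<alpha> \<in> AM" using c B
        by (intro plus_ideal_sum minus_const_mem) (auto intro: G.invariants_mult G.invariants_of_int)
      moreover have "?\<alpha> + (\<Sum>b\<in>B. of_int (coef (c b) {#}) * b) = (\<Sum>b\<in>B. c b * b)"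
        by (simp add: sum.distrib[symmetric] algebra_simps)
      ultimately show ?thesis using k dvd
        by (intro exI[of _ k] exI[of _ "\<lambda>b. coef (c b) {#}"] conjI bexI[of _ ?\<alpha>]) simp_all
    qed
    have "\<forall>g\<in>?J. \<exists>k t \<alpha>. \<not> p dvd k \<and> \<alpha> \<in> AM \<and>
      of_int p dvd of_int k * g - (\<alpha> + (\<Sum>b\<in>B. of_int (t b) * b))"
    proof
      fix g assume "g \<in> ?J"
      with JM have "g \<in> M" by blast
      from reduce[OF this] show "\<exists>k t \<alpha>. \<not> p dvd k \<and> \<alpha> \<in> AM \<and>
        of_int p dvd of_int k * g - (\<alpha> + (\<Sum>b\<in>B. of_int (t b) * b))"
        by (elim exE bexE conjE) (intro exI conjI)
    qed
    from bchoice[OF this] obtain k where "\<forall>g\<in>?J. \<exists>t \<alpha>. \<not> p dvd k g \<and> \<alpha> \<in> AM \<and>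
      of_int p dvd of_int (k g) * g - (\<alpha> + (\<Sum>b\<in>B. of_int (t b) * b))" ..
    from bchoice[OF this] obtain t where "\<forall>g\<in>?J. \<exists>\<alpha>. \<not> p dvd k g \<and> \<alpha> \<in> AM \<and>
      of_int p dvd of_int (k g) * g - (\<alpha> + (\<Sum>b\<in>B. of_int (t g b) * b))" ..
    from bchoice[OF this] obtain \<alpha> where "\<forall>g\<in>?J. \<not> p dvd k g \<and> \<alpha> g \<in> AM \<and>
      of_int p dvd of_int (k g) * g - (\<alpha> g + (\<Sum>b\<in>B. of_int (t g b) * b))" ..
    then have k: "\<And>g. g \<in> ?J \<Longrightarrow> \<not> p dvd k g" and \<alpha>: "\<And>g. g \<in> ?J \<Longrightarrow> \<alpha> g \<in> AM"
      and t: "\<And>g. g \<in> ?J \<Longrightarrow> of_int p dvd of_int (k g) * g - (\<alpha> g + (\<Sum>b\<in>B. of_int (t g b) * b))"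
      by blast+
    have "card B \<le> card T" by (rule card_independent_le[OF p(1) B])
    then have "card B < card ?J" using \<Theta> False by simp
    then have "\<exists>z. (\<forall>g\<in>?J. z g \<in> UNIV) \<and> (\<exists>g\<in>?J. \<not> p dvd z g) \<and>
        (\<forall>b\<in>B. p dvd (\<Sum>g\<in>?J. z g * t g b))"
      using p(1) B \<Theta> by (intro underdetermined_system) (auto simp: prime_or_zero_def is_subring_def)
    then obtain z where nz: "\<exists>g\<in>?J. \<not> p dvd z g"
      and sol: "\<And>b. b \<in> B \<Longrightarrow> p dvd (\<Sum>g\<in>?J. z g * t g b)" by blast
    define \<beta> where "\<beta> = (\<Sum>g\<in>?J. of_int (z g) * \<alpha> g)"
    have \<beta>: "\<beta> \<in> AM" unfolding \<beta>_def by (intro plus_ideal_sum AM_of_int \<alpha>)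
    have rel: "of_int p dvd (\<Sum>g\<in>?J. of_int (z g * k g) * g) - \<beta>"
    proof -
      have swap: "(\<Sum>g\<in>?J. \<Sum>b\<in>B. of_int (z g) * (of_int (t g b) * b)) =
        (\<Sum>b\<in>B. of_int (\<Sum>g\<in>?J. z g * t g b) * b)"
        by (subst sum.swap) (simp add: sum_distrib_right mult.assoc)
      have "(\<Sum>g\<in>?J. of_int (z g * k g) * g) - \<beta> =
        (\<Sum>g\<in>?J. of_int (z g) * (of_int (k g) * g - (\<alpha> g + (\<Sum>b\<in>B. of_int (t g b) * b)))) +
        (\<Sum>g\<in>?J. \<Sum>b\<in>B. of_int (z g) * (of_int (t g b) * b))"
        unfolding \<beta>_def sum_distrib_left right_diff_distrib distrib_left sum_subtractf sum.distrib
        by (simp only: of_int_mult mult.assoc) simp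
      also have "of_int p dvd \<dots>"
        unfolding swap
      proof (intro dvd_add dvd_sum)
        fix b assume "b \<in> B"
        then have "of_int p dvd (of_int (\<Sum>g\<in>?J. z g * t g b) :: zpoly)"
          unfolding of_int_dvd_of_int_zpoly by (rule sol)
        then show "of_int p dvd of_int (\<Sum>g\<in>?J. z g * t g b) * b" by (rule dvd_mult2)
      qed (intro dvd_mult t)
      finally show ?thesis .
    qed
    have split: "(\<Sum>g\<in>?J. of_int (z g * k g) * g) =
      of_int (z f * k f) * f + (\<Sum>b\<in>\<Theta>. of_int (z b * k b) * b)" using \<Theta>(1) False by simp
    show ?thesis
    proof (cases "p dvd z f")
      case False
      have eq: "of_int (z f * k f) * f - (\<beta> + (\<Sum>b\<in>\<Theta>. of_int (- (z b * k b)) * b)) =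
        (\<Sum>g\<in>?J. of_int (z g * k g) * g) - \<beta>" unfolding split by (simp add: sum_negf)
      have "of_int p dvd of_int (z f * k f) * f - (\<beta> + (\<Sum>b\<in>\<Theta>. of_int (- (z b * k b)) * b))"
        unfolding eq by (rule rel)
      moreover have "\<not> p dvd z f * k f" using p(1) False k[of f] by (auto simp: prime_or_zero_def)
      ultimately show ?thesis using \<beta>
        by (intro exI[of _ "z f * k f"] exI[of _ \<beta>] exI[of _ "\<lambda>b. - (z b * k b)"] conjI)
    next
      case True
      then obtain b0 where b0: "b0 \<in> \<Theta>" "\<not> p dvd z b0" using nz by auto
      have "of_int p dvd (of_int (z f * k f) * f :: zpoly)" using True
        by (intro dvd_mult2) (simp only: of_int_dvd_of_int_zpoly dvd_mult2)
      from dvd_diff[OF rel this] have "of_int p dvd (\<Sum>b\<in>\<Theta>. of_int (z b * k b) * b) - \<beta>"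
        unfolding split by (simp add: algebra_simps)
      then obtain m where m: "(\<Sum>b\<in>\<Theta>. of_int (z b * k b) * b) - \<beta> = of_int p * m" by (auto simp: dvd_def)
      have "of_int p * m \<in> M" unfolding m[symmetric] using \<Theta> AM_subset[OF \<beta>]
        by (intro G.invariants_diff G.invariants_sum G.invariants_mult G.invariants_of_int) auto
      then have "m \<in> M" using G.invariants_of_int_dvd p by blast
      then obtain w where w: "m - (\<Sum>b\<in>\<Theta>. of_int (w b) * b) \<in> sat_AM" using gen by blast
      have "(\<Sum>b\<in>\<Theta>. of_int (z b * k b - p * w b) * b) =
        (\<Sum>b\<in>\<Theta>. of_int (z b * k b) * b) - of_int p * (\<Sum>b\<in>\<Theta>. of_int (w b) * b)"
        by (simp add: algebra_simps sum_subtractf sum_distrib_left)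
      also have "\<dots> = \<beta> + of_int p * (m - (\<Sum>b\<in>\<Theta>. of_int (w b) * b))"
        using m by (simp add: algebra_simps)
      also have "\<dots> \<in> sat_AM" by (intro sat_AM_add sat_AM_of_int w satq_superset[OF prime_or_zero_0 \<beta>])
      finally have "(\<Sum>b\<in>\<Theta>. of_int (z b * k b - p * w b) * b) \<in> sat_AM" .
      from indep[of "\<lambda>b. z b * k b - p * w b", OF this b0(1)] have "z b0 * k b0 - p * w b0 = 0" .
      then have "p dvd z b0 * k b0" by simp
      then show ?thesis using p(1) b0 k[of b0] by (auto simp: prime_or_zero_def)
    qed
  qed
qed

end

section \<open>Polynomials over other coefficient rings\<close>

context ring
begin

lemma carrier_mpoly_ring:
  "carrier (mpoly_ring R n) = {f. (\<forall>m. f m \<in> carrier R) \<and> finite {m. f m \<noteq> \<zero>} \<and>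
    (\<forall>m. f m \<noteq> \<zero> \<longrightarrow> set_mset m \<subseteq> {1..n})}" (is "_ = ?S")
proof
  have "f \<in> ?S" if "f \<in> indexed_pset {1..n} (carrier R)" for f
    using that
  proof induction
    case (indexed_const k)
    have "finite {m. indexed_const k m \<noteq> \<zero>}"
      by (rule finite_subset[of _ "{{#}}"]) (auto simp: indexed_const_def)
    then show ?case using indexed_const by (auto simp: indexed_const_def)
  next
    case (indexed_padd f g)
    have "finite {m. indexed_padd f g m \<noteq> \<zero>}"
      by (rule finite_subset[of _ "{m. f m \<noteq> \<zero>} \<union> {m. g m \<noteq> \<zero>}"])
        (use indexed_padd.IH in \<open>auto simp: indexed_padd_def\<close>)
    moreover have "set_mset m \<subseteq> {1..n}" if "indexed_padd f g m \<noteq> \<zero>" for m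
    proof -
      have "f m \<noteq> \<zero> \<or> g m \<noteq> \<zero>" using that by (auto simp: indexed_padd_def)
      with indexed_padd.IH show ?thesis by blast
    qed
    ultimately show ?case using indexed_padd.IH by (auto simp: indexed_padd_def)
  next
    case (indexed_pmult f i)
    have sub: "{m. indexed_pmult f i m \<noteq> \<zero>} \<subseteq> add_mset i ` {m. f m \<noteq> \<zero>}"
    proof
      fix m assume "m \<in> {m. indexed_pmult f i m \<noteq> \<zero>}"
      then have "m = add_mset i (m - {#i#})" "f (m - {#i#}) \<noteq> \<zero>"
        by (auto simp: indexed_pmult_def split: if_splits)
      then show "m \<in> add_mset i ` {m. f m \<noteq> \<zero>}" by blast
    qed
    then have "finite {m. indexed_pmult f i m \<noteq> \<zero>}"
      using indexed_pmult.IH by (intro finite_subset[OF sub]) auto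
    moreover have "set_mset m \<subseteq> {1..n}" if "indexed_pmult f i m \<noteq> \<zero>" for m
    proof -
      from sub that obtain m' where "m = add_mset i m'" "f m' \<noteq> \<zero>" by blast
      then show ?thesis using indexed_pmult.IH indexed_pmult.hyps by simp
    qed
    moreover have "indexed_pmult f i m \<in> carrier R" for m
      using indexed_pmult.IH by (auto simp: indexed_pmult_def)
    ultimately show ?case by blast
  qed
  then show "carrier (mpoly_ring R n) \<subseteq> ?S" by (auto simp: mpoly_ring_def)
  have mono: "(\<lambda>m'. if m' = m then k else \<zero>) \<in> indexed_pset {1..n} (carrier R)"
    if "set_mset m \<subseteq> {1..n}" "k \<in> carrier R" for m k
    using that
  proof (induction m)
    case empty
    have "(\<lambda>m'. if m' = ({#} :: nat multiset) then k else \<zero>) = indexed_const k" by (simp add: indexed_const_def)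
    then show ?case using empty by (simp only: indexed_pset.indexed_const)
  next
    case (add i m)
    have eq: "(\<lambda>m'. if m' = add_mset i m then k else \<zero>) = indexed_pmult (\<lambda>m'. if m' = m then k else \<zero>) i"
      by (auto simp: indexed_pmult_def fun_eq_iff)
    show ?case unfolding eq using add by (intro indexed_pset.indexed_pmult) auto
  qed
  have "f \<in> indexed_pset {1..n} (carrier R)"
    if "finite S" "\<And>m. m \<in> S \<Longrightarrow> set_mset m \<subseteq> {1..n}" "\<And>m. f m \<in> carrier R" "\<And>m. m \<notin> S \<Longrightarrow> f m = \<zero>" for f S
    using that
  proof (induction S arbitrary: f rule: finite_induct)
    case empty
    then have "f = indexed_const \<zero>" by (auto simp: indexed_const_def)
    then show ?case by (simp only: indexed_pset.indexed_const zero_closed)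
  next
    case (insert m S)
    have eq: "f = indexed_padd (\<lambda>m'. if m' = m then f m else \<zero>) (f(m := \<zero>))"
      using insert.prems by (auto simp: indexed_padd_def fun_eq_iff)
    have "f(m := \<zero>) \<in> indexed_pset {1..n} (carrier R)"
      by (rule insert.IH) (use insert.prems in auto)
    moreover have "(\<lambda>m'. if m' = m then f m else \<zero>) \<in> indexed_pset {1..n} (carrier R)"
      by (rule mono) (use insert.prems in auto)
    ultimately show ?case by (subst eq) (rule indexed_pset.indexed_padd)
  qed
  note gen = this
  show "?S \<subseteq> carrier (mpoly_ring R n)"
  proof
    fix f assume f: "f \<in> ?S"
    have "f \<in> indexed_pset {1..n} (carrier R)"
      by (rule gen[of "{m. f m \<noteq> \<zero>}"]) (use f in auto)
    then show "f \<in> carrier (mpoly_ring R n)" by (simp add: mpoly_ring_def)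
  qed
qed

lemma inv_carrier:
  "carrier (inv_ring R n H) = {f \<in> carrier (mpoly_ring R n). \<forall>\<sigma>\<in>H. permute_vars \<sigma> f = f}"
  "carrier (inv_module R n H) = carrier (inv_ring R n H)"
  by (simp_all add: inv_ring_def inv_module_def)

lemma inv_ops:
  "\<zero>\<^bsub>inv_module R n H\<^esub> = (\<lambda>_. \<zero>)" "\<zero>\<^bsub>inv_ring R n H\<^esub> = (\<lambda>_. \<zero>)"
  "f \<oplus>\<^bsub>inv_module R n H\<^esub> g = (\<lambda>m. f m \<oplus> g m)"
  "f \<odot>\<^bsub>inv_module R n H\<^esub> g = (\<lambda>m. \<Oplus>a\<in>{a. a \<subseteq># m}. f a \<otimes> g (m - a))"
  by (simp_all add: inv_ring_def inv_module_def mpoly_ring_def indexed_zero_def indexed_padd_def)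

lemma abelian_group_inv_module: "abelian_group (inv_module R n H)"
proof (rule abelian_groupI)
  fix f g assume f: "f \<in> carrier (inv_module R n H)" and g: "g \<in> carrier (inv_module R n H)"
  have "finite {m. f m \<oplus> g m \<noteq> \<zero>}"
    by (rule finite_subset[of _ "{m. f m \<noteq> \<zero>} \<union> {m. g m \<noteq> \<zero>}"])
      (use f g in \<open>auto simp: inv_carrier carrier_mpoly_ring\<close>)
  moreover have "set_mset m \<subseteq> {1..n}" if "f m \<oplus> g m \<noteq> \<zero>" for m
  proof -
    have "f m \<noteq> \<zero> \<or> g m \<noteq> \<zero>" using that by auto
    then show ?thesis using f g unfolding inv_carrier carrier_mpoly_ring by blast
  qed
  ultimately show "f \<oplus>\<^bsub>inv_module R n H\<^esub> g \<in> carrier (inv_module R n H)"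
    using f g by (simp add: inv_ops inv_carrier carrier_mpoly_ring permute_vars_def fun_eq_iff)
  show "f \<oplus>\<^bsub>inv_module R n H\<^esub> g = g \<oplus>\<^bsub>inv_module R n H\<^esub> f"
    using f g by (simp add: inv_ops inv_carrier carrier_mpoly_ring a_comm)
next
  fix f g h
  assume "f \<in> carrier (inv_module R n H)" "g \<in> carrier (inv_module R n H)" "h \<in> carrier (inv_module R n H)"
  then show "f \<oplus>\<^bsub>inv_module R n H\<^esub> g \<oplus>\<^bsub>inv_module R n H\<^esub> h =
      f \<oplus>\<^bsub>inv_module R n H\<^esub> (g \<oplus>\<^bsub>inv_module R n H\<^esub> h)"
    by (simp add: inv_ops inv_carrier carrier_mpoly_ring a_assoc)
next
  show "\<zero>\<^bsub>inv_module R n H\<^esub> \<in> carrier (inv_module R n H)"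
    by (simp add: inv_ops inv_carrier carrier_mpoly_ring permute_vars_def)
next
  fix f assume f: "f \<in> carrier (inv_module R n H)"
  then show "\<zero>\<^bsub>inv_module R n H\<^esub> \<oplus>\<^bsub>inv_module R n H\<^esub> f = f"
    by (simp add: inv_ops inv_carrier carrier_mpoly_ring)
  have "{m. \<ominus> f m \<noteq> \<zero>} = {m. f m \<noteq> \<zero>}"
    using f by (auto simp: inv_carrier carrier_mpoly_ring)
  then have "(\<lambda>m. \<ominus> f m) \<in> carrier (inv_module R n H)"
    using f by (auto simp: inv_carrier carrier_mpoly_ring permute_vars_def fun_eq_iff)
  moreover have "(\<lambda>m. \<ominus> f m) \<oplus>\<^bsub>inv_module R n H\<^esub> f = \<zero>\<^bsub>inv_module R n H\<^esub>"
    using f by (auto simp: inv_ops inv_carrier carrier_mpoly_ring l_neg)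
  ultimately show "\<exists>g\<in>carrier (inv_module R n H). g \<oplus>\<^bsub>inv_module R n H\<^esub> f = \<zero>\<^bsub>inv_module R n H\<^esub>"
    by blast
qed

lemma finsum_inv_module:
  assumes "finite I" "\<And>i. i \<in> I \<Longrightarrow> f i \<in> carrier (inv_module R n H)"
  shows "(\<Oplus>\<^bsub>inv_module R n H\<^esub>i\<in>I. f i) = (\<lambda>m. \<Oplus>i\<in>I. f i m)"
proof -
  interpret M: abelian_group "inv_module R n H" by (rule abelian_group_inv_module)
  show ?thesis using assms
  proof (induction I rule: finite_induct)
    case (insert i I)
    have "f j m \<in> carrier R" if "j \<in> insert i I" for j m
      using insert.prems[OF that] by (auto simp: inv_carrier carrier_mpoly_ring)
    then show ?case using insert
      by (subst M.finsum_insert) (auto simp: inv_ops Pi_def)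
  qed (simp add: inv_ops)
qed

end

text \<open>
  The maps from \<open>\<int>\<close> to \<open>\<int>\<close> and \<open>\<rat>\<close> (\<open>q = 0\<close>) and to a prime field (\<open>q = p\<close>), applied to coefficients. The
  kernel on polynomials is then divisibility by \<open>q\<close>.
\<close>

locale coeff_hom = cring R for R :: "('a, 'r) ring_scheme" (structure) +
  fixes \<phi> :: "int \<Rightarrow> 'a" and q :: int
  assumes hom: "\<phi> \<in> ring_hom \<Z> R" and ker: "\<phi> x = \<zero> \<longleftrightarrow> q dvd x"
begin

definition red :: "zpoly \<Rightarrow> 'a mpoly"
  where "red f = (\<lambda>m. \<phi> (coef f m))"

lemma phi_closed [simp]: "\<phi> x \<in> carrier R"
  and phi_mult: "\<phi> (x * y) = \<phi> x \<otimes> \<phi> y" and phi_add: "\<phi> (x + y) = \<phi> x \<oplus> \<phi> y"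
  using hom by (auto simp: ring_hom_def)

lemma phi_0 [simp]: "\<phi> 0 = \<zero>"
  using ker[of 0] by simp

lemma phi_sum: "finite I \<Longrightarrow> \<phi> (\<Sum>i\<in>I. x i) = (\<Oplus>i\<in>I. \<phi> (x i))"
  by (induction I rule: finite_induct) (auto simp: phi_add)

lemma phi_eq_iff: "\<phi> x = \<phi> y \<longleftrightarrow> q dvd x - y"
proof -
  have "\<phi> x = \<phi> (x - y) \<oplus> \<phi> y" by (simp flip: phi_add)
  then have "\<phi> x = \<phi> y \<longleftrightarrow> \<phi> (x - y) \<oplus> \<phi> y = \<zero> \<oplus> \<phi> y" by simp
  also have "\<dots> \<longleftrightarrow> \<phi> (x - y) = \<zero>" by (simp only: add.right_cancel phi_closed zero_closed)
  finally have "\<phi> x = \<phi> y \<longleftrightarrow> \<phi> (x - y) = \<zero>" .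
  then show ?thesis by (simp add: ker)
qed

lemma red_eq_iff: "red f = red g \<longleftrightarrow> of_int q dvd f - g"
  by (simp add: red_def fun_eq_iff phi_eq_iff of_int_dvd_zpoly_iff lookup_minus)

lemma zero_eq_red:
  "\<zero>\<^bsub>inv_module R n H\<^esub> = red 0" "\<zero>\<^bsub>inv_ring R n H\<^esub> = red 0"
  by (simp_all add: inv_ops red_def)

lemma red_mem:
  assumes H: "\<And>\<sigma>. \<sigma> \<in> H \<Longrightarrow> bij \<sigma>" and f: "f \<in> zinvariants n H"
  shows "red f \<in> carrier (inv_ring R n H)"
proof -
  have sub: "{m. \<phi> (coef f m) \<noteq> \<zero>} \<subseteq> monoms f" by (auto simp: in_keys_iff)
  then have "finite {m. \<phi> (coef f m) \<noteq> \<zero>}" by (rule finite_subset) simp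
  moreover have "permute_vars \<sigma> (red f) = red f" if \<sigma>: "\<sigma> \<in> H" for \<sigma>
  proof -
    have "permute_vars \<sigma> (red f) = red (permute_poly \<sigma> f)"
      by (simp add: permute_vars_def red_def coef_permute_poly H[OF \<sigma>])
    then show ?thesis using f \<sigma> by (simp add: zinvariants_def)
  qed
  moreover have "set_mset m \<subseteq> {1..n}" if "\<phi> (coef f m) \<noteq> \<zero>" for m
    using sub that f unfolding zinvariants_def zpolys_def by blast
  ultimately show ?thesis by (auto simp: inv_carrier carrier_mpoly_ring red_def)
qed

lemma red_smult: "red f \<odot>\<^bsub>inv_module R n H\<^esub> red g = red (f * g)"
  by (simp add: inv_ops red_def coef_mult phi_sum finite_submultisets phi_mult)

lemma red_sum:
  assumes "finite I" "\<And>\<sigma>. \<sigma> \<in> H \<Longrightarrow> bij \<sigma>" "\<And>i. i \<in> I \<Longrightarrow> f i \<in> zinvariants n H"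
  shows "(\<Oplus>\<^bsub>inv_module R n H\<^esub>i\<in>I. red (f i)) = red (\<Sum>i\<in>I. f i)"
  using assms by (subst finsum_inv_module) (auto simp: inv_carrier(2) red_mem, simp add: red_def lookup_sum phi_sum)

text \<open>
  Invariance under permutations of the variables only says that certain coefficients agree. So it is
  preserved by any function on coefficients, in particular by a choice of integer representatives or
  by clearing denominators.
\<close>

lemma invariant_lift:
  assumes H: "perm_group n H" and P: "P \<in> carrier (inv_ring R n H)"
    and g: "g \<zero> = 0"
  obtains f where "f \<in> zinvariants n H" "\<And>m. coef f m = g (P m)"
proof -
  interpret H: perm_group n H by (rule H)
  have P': "finite {m. P m \<noteq> \<zero>}" "\<And>m. P m \<noteq> \<zero> \<Longrightarrow> set_mset m \<subseteq> {1..n}"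
    "\<And>\<sigma>. \<sigma> \<in> H \<Longrightarrow> permute_vars \<sigma> P = P"
    using P unfolding inv_carrier carrier_mpoly_ring by blast+
  define f where "f = Abs_poly_mapping (\<lambda>m. g (P m))"
  have sub: "{m. g (P m) \<noteq> 0} \<subseteq> {m. P m \<noteq> \<zero>}" using g by auto
  then have f: "coef f m = g (P m)" for m
    using finite_subset[OF sub P'(1)] by (simp add: f_def Abs_poly_mapping_inverse)
  have "permute_poly \<sigma> f = f" if \<sigma>: "\<sigma> \<in> H" for \<sigma>
    using fun_cong[OF P'(3)[OF \<sigma>]]
    by (intro poly_mapping_eqI) (simp add: coef_permute_poly H.bij[OF \<sigma>] f permute_vars_def)
  moreover have "f \<in> zpolys n" unfolding zpolys_def
  proof safe
    fix m i assume m: "m \<in> monoms f" "i \<in># m"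
    then have "P m \<noteq> \<zero>" using g by (auto simp: in_keys_iff f)
    from P'(2)[OF this] m(2) show "i \<in> {1..n}" by blast
  qed
  ultimately show ?thesis using f by (intro that[of f]) (auto simp: zinvariants_def)
qed

end

section \<open>Reduction modulo a good prime\<close>

lemma coeff_hom_int: "coeff_hom \<Z> id 0"
proof -
  interpret cring \<Z> by (rule int_is_cring)
  show ?thesis by unfold_locales (auto simp: ring_hom_def)
qed

lemma coeff_hom_rat: "coeff_hom rat_ring of_int 0"
proof -
  interpret cring rat_ring by (rule cring_from_type_algebra)
  show ?thesis by unfold_locales (auto simp: ring_hom_def ring_of_type_algebra_def)
qed

lemma coeff_hom_residue:
  assumes "Factorial_Ring.prime p"
  shows "coeff_hom (residue_ring (int p)) (\<lambda>x. x mod int p) (int p)"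
proof -
  have p: "int p > 1" using assms prime_gt_1_nat by simp
  interpret residues "int p" "residue_ring (int p)" by unfold_locales (use p in auto)
  interpret cring "residue_ring (int p)" by (rule cring)
  show ?thesis
    by unfold_locales
      (use p in \<open>auto simp: ring_hom_def residue_ring_def mod_mult_eq mod_add_eq mod_eq_0_iff_dvd\<close>)
qed

context young_pair
begin

context
  fixes p :: nat
  assumes p: "Factorial_Ring.prime p"
begin

interpretation F: coeff_hom "residue_ring (int p)" "\<lambda>x. x mod int p" "int p"
  by (rule coeff_hom_residue[OF p])

abbreviation (input) "FS \<equiv> inv_ring (residue_ring (int p)) n \<Sigma>"
abbreviation (input) "FG \<equiv> inv_module (residue_ring (int p)) n G"

lemma residue_lift:
  assumes "perm_group n H" "P \<in> carrier (inv_ring (residue_ring (int p)) n H)"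
  shows "\<exists>f\<in>zinvariants n H. F.red f = P"
proof -
  obtain f where f: "f \<in> zinvariants n H" "\<And>m. coef f m = id (P m)"
    using F.invariant_lift[OF assms, of id] by (auto simp: residue_ring_def)
  have "P m \<in> carrier (residue_ring (int p))" for m
    using assms(2) by (auto simp: F.inv_carrier F.carrier_mpoly_ring)
  then have "P m mod int p = P m" for m by (simp add: residue_ring_def)
  then have "F.red f = P" by (simp add: F.red_def f(2))
  with f show ?thesis by blast
qed

lemma red_A: "a \<in> A \<Longrightarrow> F.red a \<in> carrier FS"
  by (rule F.red_mem[OF S.bij])

lemma red_M: "f \<in> M \<Longrightarrow> F.red f \<in> carrier FG"
  unfolding F.inv_carrier(2) by (rule F.red_mem[OF G.bij])

text \<open>
  A basis over the prime field may be infinite and inhomogeneous a priori. The upper bound for the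
  rank applies to its finite subsets and shows that it is finite.
\<close>

lemma basis_lift:
  assumes basis: "module_basis FS FG B0"
  obtains B where "finite B" "B \<subseteq> M" "independent_mod (int p) A B"
    "\<And>f. f \<in> M \<Longrightarrow> f \<in> satq (int p) (lincombs A B)"
proof -
  have sub: "B0 \<subseteq> carrier FG" and span: "module_span FS FG B0 = carrier FG"
    and indep: "\<And>E c. finite E \<Longrightarrow> E \<subseteq> B0 \<Longrightarrow> c \<in> E \<rightarrow> carrier FS \<Longrightarrow>
       (\<Oplus>\<^bsub>FG\<^esub>b\<in>E. c b \<odot>\<^bsub>FG\<^esub> b) = \<zero>\<^bsub>FG\<^esub> \<Longrightarrow> \<forall>b\<in>E. c b = \<zero>\<^bsub>FS\<^esub>"
    using basis unfolding module_basis_def by blast+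
  have "\<forall>P\<in>B0. \<exists>f. f \<in> M \<and> F.red f = P"
    using residue_lift[OF G.perm_group_axioms] sub unfolding F.inv_carrier(2) by blast
  from bchoice[OF this] obtain h where h: "\<And>P. P \<in> B0 \<Longrightarrow> h P \<in> M" "\<And>P. P \<in> B0 \<Longrightarrow> F.red (h P) = P"
    by blast
  have inj: "inj_on h B0" by (rule inj_on_inverseI[of _ F.red]) (rule h)
  have red_eq: "(\<Oplus>\<^bsub>FG\<^esub>b\<in>E. F.red (c b) \<odot>\<^bsub>FG\<^esub> b) = F.red (\<Sum>b\<in>E. c b * h b)"
    if E: "finite E" "E \<subseteq> B0" and c: "\<And>b. b \<in> E \<Longrightarrow> c b \<in> A" for E c
  proof -
    interpret FG: abelian_group FG by (rule F.abelian_group_inv_module)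
    have eq: "F.red (c b) \<odot>\<^bsub>FG\<^esub> b = F.red (c b * h b)" if "b \<in> E" for b
    proof -
      have "F.red (h b) = b" using h(2) E(2) that by blast
      then show ?thesis using F.red_smult[of n G "c b" "h b"] by simp
    qed
    have mem: "c b * h b \<in> M" if "b \<in> E" for b
      using that E(2) h(1) c by (intro G.invariants_mult) (auto intro: A_subset_M)
    have "(\<Oplus>\<^bsub>FG\<^esub>b\<in>E. F.red (c b) \<odot>\<^bsub>FG\<^esub> b) = (\<Oplus>\<^bsub>FG\<^esub>b\<in>E. F.red (c b * h b))"
      by (intro FG.finsum_cong') (auto simp: eq mem intro: red_M)
    also have "\<dots> = F.red (\<Sum>b\<in>E. c b * h b)" by (rule F.red_sum[OF E(1) G.bij mem])
    finally show ?thesis .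
  qed
  have indep_lift: "independent_mod (int p) A (h ` E)" if E: "finite E" "E \<subseteq> B0" for E
    unfolding independent_mod_def
  proof (intro allI impI)
    fix c assume c: "\<forall>b\<in>h ` E. c b \<in> A" and dvd: "of_int (int p) dvd (\<Sum>b\<in>h ` E. c b * b)"
    have "(\<Sum>b\<in>h ` E. c b * b) = (\<Sum>b\<in>E. c (h b) * h b)"
      using inj_on_subset[OF inj E(2)] by (simp add: sum.reindex)
    then have "F.red (\<Sum>b\<in>E. c (h b) * h b) = F.red 0" using dvd by (simp add: F.red_eq_iff)
    then have "(\<Oplus>\<^bsub>FG\<^esub>b\<in>E. F.red (c (h b)) \<odot>\<^bsub>FG\<^esub> b) = \<zero>\<^bsub>FG\<^esub>"
      unfolding F.zero_eq_red by (subst red_eq[OF E]) (use c in auto)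
    then have "\<forall>b\<in>E. F.red (c (h b)) = \<zero>\<^bsub>FS\<^esub>"
      using c by (intro indep[OF E]) (auto intro: red_A)
    then show "\<forall>b\<in>h ` E. of_int (int p) dvd c b" by (simp add: F.zero_eq_red F.red_eq_iff)
  qed
  have "card E \<le> card T" if E: "E \<subseteq> B0" "finite E" for E
  proof -
    have "card (h ` E) \<le> card T"
      using E h by (intro card_independent_le[OF prime_or_zero_prime[OF p]] indep_lift) auto
    then show ?thesis using card_image[OF inj_on_subset[OF inj E(1)]] by simp
  qed
  then have fin: "finite B0" using finite_if_finite_subsets_card_bdd[of B0 "card T"] by blast
  have "f \<in> satq (int p) (lincombs A (h ` B0))" if f: "f \<in> M" for f
  proof -
    have "F.red f \<in> module_span FS FG B0" unfolding span by (rule red_M[OF f])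
    then obtain E c where E: "finite E" "E \<subseteq> B0" "c \<in> E \<rightarrow> carrier FS"
      "F.red f = (\<Oplus>\<^bsub>FG\<^esub>b\<in>E. c b \<odot>\<^bsub>FG\<^esub> b)" by (auto simp: module_span_def)
    have "\<forall>b\<in>E. \<exists>a. a \<in> A \<and> F.red a = c b"
      using residue_lift[OF S.perm_group_axioms] E(3) by blast
    from bchoice[OF this] obtain a where a: "\<And>b. b \<in> E \<Longrightarrow> a b \<in> A" "\<And>b. b \<in> E \<Longrightarrow> F.red (a b) = c b"
      by blast
    interpret FG: abelian_group FG by (rule F.abelian_group_inv_module)
    have "F.red (a b) \<odot>\<^bsub>FG\<^esub> b \<in> carrier FG" if "b \<in> E" for b
    proof -
      have "F.red (h b) = b" using h(2) E(2) that by blast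
      then have "F.red (a b) \<odot>\<^bsub>FG\<^esub> b = F.red (a b * h b)" using F.red_smult[of n G "a b" "h b"] by simp
      also have "\<dots> \<in> carrier FG" using that E(2) h(1) a(1)
        by (intro red_M G.invariants_mult) (auto intro: A_subset_M)
      finally show ?thesis .
    qed
    then have "F.red f = (\<Oplus>\<^bsub>FG\<^esub>b\<in>E. F.red (a b) \<odot>\<^bsub>FG\<^esub> b)"
      unfolding E(4) using a by (intro FG.finsum_cong') auto
    also have "\<dots> = F.red (\<Sum>b\<in>E. a b * h b)" by (rule red_eq[OF E(1,2) a(1)])
    finally have dvd: "of_int (int p) dvd f - (\<Sum>b\<in>E. a b * h b)" by (simp add: F.red_eq_iff)
    define a' where "a' x = (if F.red x \<in> E then a (F.red x) else 0)" for x
    have "(\<Sum>x\<in>h ` B0. a' x * x) = (\<Sum>b\<in>B0. (if b \<in> E then a b else 0) * h b)"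
      unfolding sum.reindex[OF inj] by (intro sum.cong) (use h in \<open>auto simp: a'_def\<close>)
    also have "\<dots> = (\<Sum>b\<in>E. a b * h b)"
      using E fin by (intro sum.mono_neutral_cong_right) auto
    finally have eq: "(\<Sum>x\<in>h ` B0. a' x * x) = (\<Sum>b\<in>E. a b * h b)" .
    have "a' x \<in> A" for x using a(1) S.invariants_0 by (simp add: a'_def)
    then have "(\<Sum>b\<in>E. a b * h b) \<in> lincombs A (h ` B0)"
      unfolding eq[symmetric] by (intro lincombsI)
    then show ?thesis using p dvd by (intro satqI[of _ 1]) (auto dest: not_prime_unit)
  qed
  then show ?thesis using fin h indep_lift[OF fin order_refl] by (intro that[of "h ` B0"]) auto
qed

lemma cyclic_submodule_red:
  assumes "b \<in> M"
  shows "cyclic_submodule FS FG (F.red b) = {F.red (a * b) | a. a \<in> A}"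
proof -
  have carrier: "carrier FS = F.red ` A"
    using residue_lift[OF S.perm_group_axioms] red_A by blast
  show ?thesis
    unfolding cyclic_submodule_def Setcompr_eq_image carrier image_image F.red_smult ..
qed

lemma submodule_cyclic:
  assumes b: "b \<in> M"
  shows "submodule (cyclic_submodule FS FG (F.red b)) FS FG"
proof -
  interpret FG: abelian_group FG by (rule F.abelian_group_inv_module)
  have mem: "F.red (a * b) \<in> carrier FG" if "a \<in> A" for a
    using that b by (intro red_M G.invariants_mult) (auto intro: A_subset_M)
  have add: "F.red f \<oplus>\<^bsub>FG\<^esub> F.red g = F.red (f + g)" for f g
    by (simp add: F.inv_ops F.red_def lookup_add F.phi_add)
  note zero = F.zero_eq_red(1)
  have minus: "\<ominus>\<^bsub>FG\<^esub> F.red (a * b) = F.red (- a * b)" if "a \<in> A" for a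
    using that by (intro FG.minus_equality mem S.invariants_uminus) (simp_all add: add zero)
  have "subgroup {F.red (a * b) | a. a \<in> A} (add_monoid FG)"
  proof (rule FG.add.subgroupI)
    show "{F.red (a * b) | a. a \<in> A} \<subseteq> carrier FG" using mem by auto
    show "{F.red (a * b) | a. a \<in> A} \<noteq> {}" using S.invariants_1 by auto
    fix x assume x: "x \<in> {F.red (a * b) | a. a \<in> A}"
    then show "\<ominus>\<^bsub>FG\<^esub> x \<in> {F.red (a * b) | a. a \<in> A}"
      using minus S.invariants_uminus by blast
    fix y assume "y \<in> {F.red (a * b) | a. a \<in> A}"
    with x obtain a a' where a: "a \<in> A" "a' \<in> A" "x = F.red (a * b)" "y = F.red (a' * b)" by blast
    then have "x \<oplus>\<^bsub>FG\<^esub> y = F.red ((a + a') * b)" by (simp add: add distrib_right)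
    then show "x \<oplus>\<^bsub>FG\<^esub> y \<in> {F.red (a * b) | a. a \<in> A}" using S.invariants_add a by blast
  qed
  moreover have "c \<odot>\<^bsub>FG\<^esub> x \<in> {F.red (a * b) | a. a \<in> A}"
    if c: "c \<in> carrier FS" and x: "x \<in> {F.red (a * b) | a. a \<in> A}" for c x
  proof -
    obtain a where a: "a \<in> A" "x = F.red (a * b)" using x by blast
    obtain a' where a': "a' \<in> A" "F.red a' = c" using residue_lift[OF S.perm_group_axioms c] by blast
    have "c \<odot>\<^bsub>FG\<^esub> x = F.red ((a' * a) * b)" by (simp add: a(2) a'(2)[symmetric] F.red_smult mult.assoc)
    then show ?thesis using S.invariants_mult[OF a'(1) a(1)] by blast
  qed
  ultimately show ?thesis unfolding cyclic_submodule_red[OF b]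
    by (intro submodule.intro submodule_axioms.intro)
qed

text \<open>
  Spanning modulo \<open>p\<close> gives the decomposition once the integer factor prime to \<open>p\<close> is inverted by
  Bezout's identity; independence modulo \<open>p\<close> gives its uniqueness.
\<close>

lemma direct_sum_mod_prime:
  assumes e: "bij_betw e I \<Theta>" and \<Theta>: "finite \<Theta>" "\<Theta> \<subseteq> M"
    and span: "\<And>f. f \<in> M \<Longrightarrow> f \<in> satq (int p) (lincombs A \<Theta>)"
    and indep: "independent_mod (int p) A \<Theta>"
  shows "internal_direct_sum FS FG I (\<lambda>i. cyclic_submodule FS FG (F.red (e i)))"
  unfolding internal_direct_sum_def
proof (intro conjI ballI)
  have inj: "inj_on e I" and img: "e ` I = \<Theta>" using e by (auto simp: bij_betw_def)
  have eM: "e i \<in> M" if "i \<in> I" for i using that \<Theta> img by auto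
  show fin: "finite I" using e \<Theta>(1) bij_betw_finite by blast
  show "submodule (cyclic_submodule FS FG (F.red (e i))) FS FG" if "i \<in> I" for i
    by (rule submodule_cyclic[OF eM[OF that]])
  fix x assume x: "x \<in> carrier FG"
  obtain f where f: "f \<in> M" "F.red f = x"
    using residue_lift[OF G.perm_group_axioms, of x] x unfolding F.inv_carrier(2) by blast
  interpret FG: abelian_group FG by (rule F.abelian_group_inv_module)
  have sum_red: "(\<Oplus>\<^bsub>FG\<^esub>i\<in>I. F.red (c i * e i)) = F.red (\<Sum>i\<in>I. c i * e i)" if "\<And>i. i \<in> I \<Longrightarrow> c i \<in> A" for c
    using that eM fin by (intro F.red_sum G.bij G.invariants_mult) (auto intro: A_subset_M)
  have cyc: "cyclic_submodule FS FG (F.red (e i)) = {F.red (a * e i) | a. a \<in> A}" if "i \<in> I" for i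
    by (rule cyclic_submodule_red[OF eM[OF that]])
  have lift_fam: "\<exists>c. (\<forall>i\<in>I. c i \<in> A) \<and> y = (\<lambda>i\<in>I. F.red (c i * e i)) \<and>
      (\<Oplus>\<^bsub>FG\<^esub>i\<in>I. y i) = F.red (\<Sum>i\<in>I. c i * e i)"
    if y: "y \<in> (\<Pi>\<^sub>E i\<in>I. cyclic_submodule FS FG (F.red (e i)))" for y
  proof -
    have "\<forall>i\<in>I. \<exists>a. a \<in> A \<and> y i = F.red (a * e i)"
      using y cyc by (auto simp: PiE_iff)
    from bchoice[OF this] obtain c where c: "\<And>i. i \<in> I \<Longrightarrow> c i \<in> A" "\<And>i. i \<in> I \<Longrightarrow> y i = F.red (c i * e i)"
      by blast
    have "F.red (c i * e i) \<in> carrier FG" if "i \<in> I" for i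
      using that c eM by (intro red_M G.invariants_mult) (auto intro: A_subset_M)
    then have "(\<Oplus>\<^bsub>FG\<^esub>i\<in>I. y i) = (\<Oplus>\<^bsub>FG\<^esub>i\<in>I. F.red (c i * e i))"
      using c by (intro FG.finsum_cong') auto
    then have "(\<Oplus>\<^bsub>FG\<^esub>i\<in>I. y i) = F.red (\<Sum>i\<in>I. c i * e i)" using sum_red[of c] c(1) by simp
    moreover have "y = (\<lambda>i\<in>I. F.red (c i * e i))"
      by (rule ext) (use c PiE_arb[OF y] in auto)
    ultimately show ?thesis using c(1) by blast
  qed
  show "\<exists>!y. y \<in> (\<Pi>\<^sub>E i\<in>I. cyclic_submodule FS FG (F.red (e i))) \<and> x = (\<Oplus>\<^bsub>FG\<^esub>i\<in>I. y i)"
  proof (rule ex_ex1I)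
    obtain k c where k: "\<not> int p dvd k" and c: "\<forall>b\<in>\<Theta>. c b \<in> A"
      and dvd: "of_int (int p) dvd of_int k * f - (\<Sum>b\<in>\<Theta>. c b * b)"
      using span[OF f(1)] by (auto simp: satq_def lincombs_def)
    have "coprime (int p) k" using p k by (intro prime_imp_coprime) auto
    then obtain u v where uv: "u * int p + v * k = 1" using bezout_int[of "int p" k] by (auto simp: coprime_iff_gcd_eq_1)
    define a where "a i = of_int v * c (e i)" for i
    have a: "a i \<in> A" if "i \<in> I" for i
      unfolding a_def using c img that by (intro S.invariants_mult S.invariants_of_int) auto
    have aM: "a i * e i \<in> M" if "i \<in> I" for i
      using G.invariants_mult[OF A_subset_M[OF a[OF that]] eM[OF that]] .
    have "(\<Sum>b\<in>\<Theta>. c b * b) = (\<Sum>i\<in>I. c (e i) * e i)"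
      using sum.reindex[OF inj, of "\<lambda>b. c b * b"] img by simp
    then have "(\<Sum>i\<in>I. a i * e i) = of_int v * (\<Sum>b\<in>\<Theta>. c b * b)"
      by (simp add: a_def sum_distrib_left mult.assoc)
    moreover have "f = of_int (u * int p + v * k) * f" unfolding uv by simp
    ultimately have "f - (\<Sum>i\<in>I. a i * e i) = of_int (int p) * (of_int u * f) +
        of_int v * (of_int k * f - (\<Sum>b\<in>\<Theta>. c b * b))"
      by (simp add: algebra_simps)
    also have "of_int (int p) dvd \<dots>" by (intro dvd_add dvd_mult[OF dvd] dvd_triv_left)
    finally have "F.red f = F.red (\<Sum>i\<in>I. a i * e i)" by (simp only: F.red_eq_iff)
    also have "\<dots> = (\<Oplus>\<^bsub>FG\<^esub>i\<in>I. F.red (a i * e i))" using sum_red[of a] a by simp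
    also have "\<dots> = (\<Oplus>\<^bsub>FG\<^esub>i\<in>I. (\<lambda>i\<in>I. F.red (a i * e i)) i)"
      by (intro FG.finsum_cong') (auto intro!: red_M aM)
    finally have "x = (\<Oplus>\<^bsub>FG\<^esub>i\<in>I. (\<lambda>i\<in>I. F.red (a i * e i)) i)" using f by simp
    moreover have "(\<lambda>i\<in>I. F.red (a i * e i)) \<in> (\<Pi>\<^sub>E i\<in>I. cyclic_submodule FS FG (F.red (e i)))"
      using a cyc by (intro restrict_PiE_iff[THEN iffD2]) auto
    ultimately show "\<exists>y. y \<in> (\<Pi>\<^sub>E i\<in>I. cyclic_submodule FS FG (F.red (e i))) \<and> x = (\<Oplus>\<^bsub>FG\<^esub>i\<in>I. y i)"
      by blast
  next
    fix y y'
    assume y: "y \<in> (\<Pi>\<^sub>E i\<in>I. cyclic_submodule FS FG (F.red (e i))) \<and> x = (\<Oplus>\<^bsub>FG\<^esub>i\<in>I. y i)"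
      and y': "y' \<in> (\<Pi>\<^sub>E i\<in>I. cyclic_submodule FS FG (F.red (e i))) \<and> x = (\<Oplus>\<^bsub>FG\<^esub>i\<in>I. y' i)"
    from lift_fam[OF conjunct1[OF y]] obtain c where c: "\<forall>i\<in>I. c i \<in> A" "y = (\<lambda>i\<in>I. F.red (c i * e i))"
      "(\<Oplus>\<^bsub>FG\<^esub>i\<in>I. y i) = F.red (\<Sum>i\<in>I. c i * e i)" by (elim exE conjE)
    from lift_fam[OF conjunct1[OF y']] obtain c' where c': "\<forall>i\<in>I. c' i \<in> A" "y' = (\<lambda>i\<in>I. F.red (c' i * e i))"
      "(\<Oplus>\<^bsub>FG\<^esub>i\<in>I. y' i) = F.red (\<Sum>i\<in>I. c' i * e i)" by (elim exE conjE)
    have "F.red (\<Sum>i\<in>I. c i * e i) = F.red (\<Sum>i\<in>I. c' i * e i)"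
      using conjunct2[OF y] conjunct2[OF y'] c(3) c'(3) by (simp only:)
    then have "of_int (int p) dvd (\<Sum>i\<in>I. c i * e i) - (\<Sum>i\<in>I. c' i * e i)"
      by (simp only: F.red_eq_iff)
    also have "(\<Sum>i\<in>I. c i * e i) - (\<Sum>i\<in>I. c' i * e i) = (\<Sum>i\<in>I. (c i - c' i) * e i)"
      by (simp add: left_diff_distrib sum_subtractf)
    also have "(\<Sum>i\<in>I. (c i - c' i) * e i) = (\<Sum>b\<in>\<Theta>. (c (the_inv_into I e b) - c' (the_inv_into I e b)) * b)"
      unfolding img[symmetric] by (simp add: sum.reindex[OF inj] the_inv_into_f_f[OF inj])
    finally have "of_int (int p) dvd (\<Sum>b\<in>\<Theta>. (c (the_inv_into I e b) - c' (the_inv_into I e b)) * b)" .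
    moreover have "\<forall>b\<in>\<Theta>. c (the_inv_into I e b) - c' (the_inv_into I e b) \<in> A"
      unfolding img[symmetric] using c(1) c'(1)
      by (auto simp: the_inv_into_f_f[OF inj] intro!: S.invariants_diff)
    ultimately have "\<forall>b\<in>\<Theta>. of_int (int p) dvd c (the_inv_into I e b) - c' (the_inv_into I e b)"
      using indep[unfolded independent_mod_def, THEN spec,
          of "\<lambda>b. c (the_inv_into I e b) - c' (the_inv_into I e b)"] by iprover
    then have "of_int (int p) dvd c i - c' i" if "i \<in> I" for i
      using that img by (auto simp: the_inv_into_f_f[OF inj])
    then have "F.red (c i * e i) = F.red (c' i * e i)" if "i \<in> I" for i
      using that by (simp add: F.red_eq_iff flip: left_diff_distrib)
    then show "y = y'" unfolding c(2) c'(2) by auto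
  qed
qed

end

end

section \<open>Rational secondary invariants\<close>

interpretation Q: coeff_hom rat_ring of_int 0
  by (rule coeff_hom_rat)

lemma rat_zero: "\<zero>\<^bsub>rat_ring\<^esub> = 0"
  by (simp add: ring_of_type_algebra_def)

lemma rat_finsum: "finite I \<Longrightarrow> (\<Oplus>\<^bsub>rat_ring\<^esub>i\<in>I. f i) = (\<Sum>i\<in>I. f i)"
proof (induction I rule: finite_induct)
  case (insert i I)
  then have "(\<Oplus>\<^bsub>rat_ring\<^esub>j\<in>insert i I. f j) = f i \<oplus>\<^bsub>rat_ring\<^esub> (\<Oplus>\<^bsub>rat_ring\<^esub>j\<in>I. f j)"
    by (intro Q.finsum_insert) (auto simp: ring_of_type_algebra_def)
  with insert show ?case by (simp add: ring_of_type_algebra_def)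
qed (simp add: rat_zero)

lemma rat_smult:
  "f \<odot>\<^bsub>inv_module rat_ring n H\<^esub> g = (\<lambda>m. \<Sum>a\<in>{a. a \<subseteq># m}. f a * g (m - a))"
  unfolding Q.inv_ops by (simp add: rat_finsum finite_submultisets) (simp add: ring_of_type_algebra_def)

lemma red_rat: "Q.red f = to_rat (coef f)"
  by (simp add: Q.red_def to_rat_def)

lemma inv_ring_rat_scale:
  assumes "f \<in> carrier (inv_ring rat_ring n H)"
  shows "(\<lambda>m. r * f m) \<in> carrier (inv_ring rat_ring n H)"
proof -
  have "finite {m. f m \<noteq> 0}" and supp: "\<forall>m. f m \<noteq> 0 \<longrightarrow> set_mset m \<subseteq> {1..n}"
    and inv: "\<forall>\<sigma>\<in>H. permute_vars \<sigma> f = f"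
    using assms unfolding Q.inv_carrier Q.carrier_mpoly_ring rat_zero by blast+
  then have "finite {m. r * f m \<noteq> 0}" by (elim finite_subset[rotated]) auto
  moreover have "\<forall>m. r * f m \<noteq> 0 \<longrightarrow> set_mset m \<subseteq> {1..n}" using supp by simp
  moreover have "r * f m \<in> carrier rat_ring" for m by (simp add: ring_of_type_algebra_def)
  moreover have "permute_vars \<sigma> (\<lambda>m. r * f m) = (\<lambda>m. r * f m)" if "\<sigma> \<in> H" for \<sigma>
    using fun_cong[OF bspec[OF inv that]] by (simp add: permute_vars_def fun_eq_iff)
  ultimately show ?thesis unfolding Q.inv_carrier Q.carrier_mpoly_ring rat_zero by blast
qed

lemma rat_common_denominator:
  fixes S :: "rat set"
  assumes "finite S" shows "\<exists>k\<noteq>0. \<forall>x\<in>S. \<exists>y. of_int k * x = of_int y"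
  using assms
proof (induction S rule: finite_induct)
  case (insert x S)
  then obtain k where k: "k \<noteq> 0" "\<forall>x\<in>S. \<exists>y. of_int k * x = of_int y" by blast
  obtain a b where x: "x = Rat.Fract a b" "b > 0" using Rat_cases[of x] by metis
  have "of_int (b * k) * x = of_int (a * k)" using x(2) by (simp add: x(1) Fract_of_int_quotient)
  moreover have "\<exists>z. of_int (b * k) * y = of_int z" if "y \<in> S" for y
  proof -
    from that k(2) obtain z where "of_int k * y = of_int z" by blast
    then have "of_int (b * k) * y = of_int (b * z)" by (simp add: mult.assoc)
    then show ?thesis by blast
  qed
  moreover have "b * k \<noteq> 0" using k(1) x(2) by simp
  ultimately show ?case by blast
qed (auto intro: exI[of _ 1])

text \<open>
  One denominator for finitely many invariants at once, so that a linear combination over \<open>\<rat>\<close> becomes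
  one over \<open>\<int>\<close> after multiplication by a single integer.
\<close>

lemma rat_lift:
  assumes H: "perm_group n H" and "finite I" and P: "\<And>i. i \<in> I \<Longrightarrow> P i \<in> carrier (inv_ring rat_ring n H)"
  shows "\<exists>k f. k \<noteq> 0 \<and> (\<forall>i\<in>I. f i \<in> zinvariants n H \<and> (\<forall>m. of_int (coef (f i) m) = of_int k * P i m))"
proof -
  have "finite (range (P i))" if "i \<in> I" for i
  proof (rule finite_subset)
    show "range (P i) \<subseteq> insert 0 (P i ` {m. P i m \<noteq> 0})" by auto
    show "finite (insert 0 (P i ` {m. P i m \<noteq> 0}))"
      using P[OF that] by (simp add: Q.inv_carrier Q.carrier_mpoly_ring rat_zero)
  qed
  then have "finite (\<Union>i\<in>I. range (P i))" using \<open>finite I\<close> by blast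
  from rat_common_denominator[OF this] obtain k where k: "k \<noteq> 0"
    "\<And>i m. i \<in> I \<Longrightarrow> \<exists>y. of_int k * P i m = of_int y" by blast
  define g where "g x = \<lfloor>of_int k * x\<rfloor>" for x :: rat
  have "\<forall>i\<in>I. \<exists>f. f \<in> zinvariants n H \<and> (\<forall>m. of_int (coef f m) = of_int k * P i m)"
  proof
    fix i assume i: "i \<in> I"
    show "\<exists>f. f \<in> zinvariants n H \<and> (\<forall>m. of_int (coef f m) = of_int k * P i m)"
    proof (rule Q.invariant_lift[OF H P[OF i], of g])
      fix f assume f: "f \<in> zinvariants n H" "\<And>m. coef f m = g (P i m)"
      have "of_int (g (P i m)) = of_int k * P i m" for m
        using k(2)[OF i, of m] by (auto simp: g_def)
      then show ?thesis using f by (intro exI[of _ f]) simp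
    qed (simp add: g_def rat_zero)
  qed
  from bchoice[OF this] k(1) show ?thesis by blast
qed

lemma rat_smult_lift:
  assumes c: "\<And>m. of_int (coef a m) = of_int k * c m" and t: "t = Q.red b"
  shows "of_int k * (c \<odot>\<^bsub>inv_module rat_ring n H\<^esub> t) m = of_int (coef (a * b) m)"
proof -
  have "of_int k * (c \<odot>\<^bsub>inv_module rat_ring n H\<^esub> t) m =
    (\<Sum>x\<in>{x. x \<subseteq># m}. (of_int k * c x) * of_int (coef b (m - x)))"
    by (simp add: rat_smult sum_distrib_left mult.assoc t red_rat to_rat_def)
  also have "\<dots> = of_int (coef (a * b) m)"
    by (simp add: coef_mult flip: c)
  finally show ?thesis .
qed

context young_pair
begin

abbreviation (input) "QS \<equiv> inv_ring rat_ring n \<Sigma>"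
abbreviation (input) "QG \<equiv> inv_module rat_ring n G"

lemma rat_smult_closed:
  assumes c: "c \<in> carrier QS" and t: "t = Q.red b" "b \<in> M"
  shows "c \<odot>\<^bsub>QG\<^esub> t \<in> carrier QG"
proof -
  obtain k a where k: "k \<noteq> 0" and a: "a \<in> A" "\<And>m. of_int (coef a m) = of_int k * c m"
    using rat_lift[OF S.perm_group_axioms, of "{()}" "\<lambda>_. c"] c by auto
  have "(c \<odot>\<^bsub>QG\<^esub> t) m = (1 / of_int k) * Q.red (a * b) m" for m
    using rat_smult_lift[OF a(2) t(1), where H = G and n = n and m = m] k
    by (simp add: red_rat to_rat_def field_simps)
  then have "c \<odot>\<^bsub>QG\<^esub> t = (\<lambda>m. (1 / of_int k) * Q.red (a * b) m)" by blast
  also have "\<dots> \<in> carrier QG" unfolding Q.inv_carrier(2)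
    using G.invariants_mult[OF A_subset_M[OF a(1)] t(2)]
    by (intro inv_ring_rat_scale Q.red_mem G.bij)
  finally show ?thesis .
qed

lemma rat_lincomb:
  assumes "finite E" "\<And>t. t \<in> E \<Longrightarrow> c t \<in> carrier QS" "\<And>t. t \<in> E \<Longrightarrow> \<exists>b\<in>M. t = Q.red b"
  shows "(\<Oplus>\<^bsub>QG\<^esub>t\<in>E. c t \<odot>\<^bsub>QG\<^esub> t) m = (\<Sum>t\<in>E. (c t \<odot>\<^bsub>QG\<^esub> t) m)"
proof -
  have "(\<Oplus>\<^bsub>QG\<^esub>t\<in>E. c t \<odot>\<^bsub>QG\<^esub> t) = (\<lambda>m. \<Oplus>\<^bsub>rat_ring\<^esub>t\<in>E. (c t \<odot>\<^bsub>QG\<^esub> t) m)"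
    using assms by (intro Q.finsum_inv_module) (auto intro: rat_smult_closed)
  then show ?thesis using assms(1) by (simp add: rat_finsum)
qed

text \<open>
  Minimality is the lower bound for the rank: a proper subset has fewer than \<open>\<ell>\<close> elements.
\<close>

lemma secondary_invariants_rat:
  assumes \<Theta>: "finite \<Theta>" "card \<Theta> = card T" "\<Theta> \<subseteq> M" "\<And>b. b \<in> \<Theta> \<Longrightarrow> \<exists>d. hcomp d b = b"
    and span: "\<And>f. f \<in> M \<Longrightarrow> f \<in> satq 0 (lincombs A \<Theta>)"
  shows "secondary_invariants rat_ring n \<Sigma> G (Q.red ` \<Theta>)"
  unfolding secondary_invariants_def
proof (intro conjI ballI allI impI)
  have inj: "inj_on Q.red U" for U
    by (rule inj_onI) (simp add: Q.red_eq_iff)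
  interpret QG: abelian_group QG by (rule Q.abelian_group_inv_module)
  show "Q.red ` \<Theta> \<subseteq> carrier (inv_ring rat_ring n G)"
    using \<Theta>(3) by (auto intro!: Q.red_mem G.bij)
  show "homogeneous rat_ring t" if "t \<in> Q.red ` \<Theta>" for t
  proof -
    from that obtain b where b: "b \<in> \<Theta>" "t = Q.red b" by blast
    obtain d where d: "hcomp d b = b" using \<Theta>(4)[OF b(1)] by blast
    have "size m = d" if "t m \<noteq> 0" for m
    proof -
      have "coef (hcomp d b) m \<noteq> 0" unfolding d using that b(2) by (simp add: red_rat to_rat_def)
      then show ?thesis by (simp add: coef_hcomp split: if_splits)
    qed
    then show ?thesis unfolding homogeneous_def rat_zero by blast
  qed
  show "module_span QS QG (Q.red ` \<Theta>) = carrier QG"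
  proof
    show "module_span QS QG (Q.red ` \<Theta>) \<subseteq> carrier QG"
    proof
      fix x assume "x \<in> module_span QS QG (Q.red ` \<Theta>)"
      then obtain E c where E: "finite E" "E \<subseteq> Q.red ` \<Theta>" "c \<in> E \<rightarrow> carrier QS"
        and x: "x = (\<Oplus>\<^bsub>QG\<^esub>t\<in>E. c t \<odot>\<^bsub>QG\<^esub> t)" by (auto simp: module_span_def)
      have "c t \<odot>\<^bsub>QG\<^esub> t \<in> carrier QG" if t: "t \<in> E" for t
      proof -
        obtain b where "b \<in> \<Theta>" "t = Q.red b" using E(2) t by blast
        then show ?thesis using E(3) t \<Theta>(3) by (intro rat_smult_closed[of _ _ b]) auto
      qed
      then show "x \<in> carrier QG" unfolding x by (intro QG.finsum_closed) auto
    qed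
    show "carrier QG \<subseteq> module_span QS QG (Q.red ` \<Theta>)"
    proof
      fix x assume x: "x \<in> carrier QG"
      obtain k f where k: "k \<noteq> 0" and f: "f \<in> M" "\<And>m. of_int (coef f m) = of_int k * x m"
        using rat_lift[OF G.perm_group_axioms, of "{()}" "\<lambda>_. x"] x unfolding Q.inv_carrier(2) by auto
      obtain l a where l: "l \<noteq> 0" and a: "\<forall>b\<in>\<Theta>. a b \<in> A" "of_int l * f = (\<Sum>b\<in>\<Theta>. a b * b)"
        using span[OF f(1)] by (auto simp: satq_0 lincombs_def)
      define c where "c t = (\<lambda>m. (1 / of_int (k * l)) * Q.red (a (the_inv_into \<Theta> Q.red t)) m)" for t
      have c_mem: "c t \<in> carrier QS" if "t \<in> Q.red ` \<Theta>" for t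
        unfolding c_def using that a(1) the_inv_into_into[OF inj that, of \<Theta>]
        by (intro inv_ring_rat_scale Q.red_mem S.bij) auto
      have c_red: "of_int (coef (a b) m) = of_int (k * l) * c (Q.red b) m" if "b \<in> \<Theta>" for b m
        using k l the_inv_into_f_f[OF inj that] by (simp add: c_def) (simp add: red_rat to_rat_def)
      have "(\<Oplus>\<^bsub>QG\<^esub>t\<in>Q.red ` \<Theta>. c t \<odot>\<^bsub>QG\<^esub> t) m = x m" for m
      proof -
        have "of_int (k * l) * (\<Oplus>\<^bsub>QG\<^esub>t\<in>Q.red ` \<Theta>. c t \<odot>\<^bsub>QG\<^esub> t) m =
          (\<Sum>t\<in>Q.red ` \<Theta>. of_int (k * l) * (c t \<odot>\<^bsub>QG\<^esub> t) m)"
          using \<Theta>(1,3) c_mem by (subst rat_lincomb) (auto simp: sum_distrib_left)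
        also have "\<dots> = (\<Sum>b\<in>\<Theta>. of_int (k * l) * (c (Q.red b) \<odot>\<^bsub>QG\<^esub> Q.red b) m)"
          by (simp add: sum.reindex[OF inj])
        also have "\<dots> = (\<Sum>b\<in>\<Theta>. of_int (coef (a b * b) m))"
          by (intro sum.cong rat_smult_lift refl c_red)
        also have "\<dots> = of_int (coef (\<Sum>b\<in>\<Theta>. a b * b) m)" by (simp add: lookup_sum)
        also have "\<dots> = of_int (k * l) * x m" by (simp add: f(2) flip: a(2))
        finally show ?thesis using k l by simp
      qed
      then have "x = (\<Oplus>\<^bsub>QG\<^esub>t\<in>Q.red ` \<Theta>. c t \<odot>\<^bsub>QG\<^esub> t)" by (intro ext) simp
      then show "x \<in> module_span QS QG (Q.red ` \<Theta>)"
        unfolding module_span_def using c_mem \<Theta>(1) by blast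
    qed
  qed
  show "module_span QS QG U \<noteq> carrier QG" if U: "U \<subset> Q.red ` \<Theta>" for U
  proof
    assume spanU: "module_span QS QG U = carrier QG"
    define \<Theta>' where "\<Theta>' = {b \<in> \<Theta>. Q.red b \<in> U}"
    have "\<Theta>' \<subset> \<Theta>" using U by (auto simp: \<Theta>'_def)
    then have less: "card \<Theta>' < card T" using \<Theta> by (metis psubset_card_mono)
    have fin: "finite \<Theta>'" using \<Theta>(1) by (simp add: \<Theta>'_def)
    have "card T \<le> card \<Theta>'"
    proof (rule card_spanning_ge[OF prime_or_zero_0 fin])
      fix f assume f: "f \<in> M"
      have "Q.red f \<in> module_span QS QG U" unfolding spanU Q.inv_carrier(2)
        by (rule Q.red_mem[OF G.bij f])
      then obtain E c where E: "finite E" "E \<subseteq> U" "c \<in> E \<rightarrow> carrier QS"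
        and x: "Q.red f = (\<Oplus>\<^bsub>QG\<^esub>t\<in>E. c t \<odot>\<^bsub>QG\<^esub> t)" by (auto simp: module_span_def)
      have "\<exists>k g. k \<noteq> 0 \<and> (\<forall>t\<in>E. g t \<in> A \<and> (\<forall>m. of_int (coef (g t) m) = of_int k * c t m))"
        using E by (intro rat_lift[OF S.perm_group_axioms]) auto
      then obtain k g where k: "k \<noteq> 0" and g: "\<And>t. t \<in> E \<Longrightarrow> g t \<in> A"
        "\<And>t m. t \<in> E \<Longrightarrow> of_int (coef (g t) m) = of_int k * c t m" by blast
      define E' where "E' = {b \<in> \<Theta>'. Q.red b \<in> E}"
      have E': "E = Q.red ` E'" using E(2) U by (auto simp: E'_def \<Theta>'_def)
      have ex: "\<exists>b\<in>M. t = Q.red b" if "t \<in> E" for t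
        using that \<Theta>(3) unfolding E' by (auto simp: E'_def \<Theta>'_def)
      have gE': "of_int (coef (g (Q.red b)) m) = of_int k * c (Q.red b) m" if "b \<in> E'" for b m
        using that by (intro g(2)) (simp add: E'_def)
      have "of_int k * f = (\<Sum>b\<in>E'. g (Q.red b) * b)"
      proof (rule poly_mapping_eqI)
        fix m
        have "of_int (k * coef f m) = of_int k * (\<Oplus>\<^bsub>QG\<^esub>t\<in>E. c t \<odot>\<^bsub>QG\<^esub> t) m"
          unfolding x[symmetric] by (simp add: red_rat to_rat_def)
        also have "\<dots> = (\<Sum>t\<in>E. of_int k * (c t \<odot>\<^bsub>QG\<^esub> t) m)"
          using rat_lincomb[OF E(1) _ ex, of c] E(3) by (simp add: sum_distrib_left Pi_iff)
        also have "\<dots> = (\<Sum>b\<in>E'. of_int k * (c (Q.red b) \<odot>\<^bsub>QG\<^esub> Q.red b) m)"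
          unfolding E' by (simp add: sum.reindex[OF inj])
        also have "\<dots> = (\<Sum>b\<in>E'. of_int (coef (g (Q.red b) * b) m))"
          by (intro sum.cong rat_smult_lift refl gE')
        also have "\<dots> = of_int (coef (\<Sum>b\<in>E'. g (Q.red b) * b) m)" by (simp add: lookup_sum)
        finally show "coef (of_int k * f) m = coef (\<Sum>b\<in>E'. g (Q.red b) * b) m"
          by (simp only: coef_of_int_mult of_int_eq_iff)
      qed
      also have "\<dots> = (\<Sum>b\<in>\<Theta>'. (if Q.red b \<in> E then g (Q.red b) else 0) * b)"
        unfolding E'_def using fin by (intro sum.mono_neutral_cong_left) auto
      finally have eq: "of_int k * f = (\<Sum>b\<in>\<Theta>'. (if Q.red b \<in> E then g (Q.red b) else 0) * b)" .
      show "\<exists>s\<in>A. \<not> of_int 0 dvd s \<and>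
        (\<exists>c. (\<forall>b\<in>\<Theta>'. c b \<in> A) \<and> of_int 0 dvd s * f - (\<Sum>b\<in>\<Theta>'. c b * b))"
        using k g(1) eq
        by (intro bexI[of _ "of_int k"] conjI exI[of _ "\<lambda>b. if Q.red b \<in> E then g (Q.red b) else 0"])
          (auto intro: S.invariants_of_int S.invariants_0)
    qed
    with less show False by simp
  qed
qed

end

section \<open>Young subgroups and the universal secondaries\<close>

lemma group_sym_restrict:
  assumes "perm_group n \<Sigma>" shows "group ((sym_group n)\<lparr>carrier := \<Sigma>\<rparr>)"
proof -
  interpret perm_group n \<Sigma> by (rule assms)
  show ?thesis
  proof (rule groupI)
    fix \<sigma> assume "\<sigma> \<in> carrier ((sym_group n)\<lparr>carrier := \<Sigma>\<rparr>)"
    then show "\<exists>\<tau>\<in>carrier ((sym_group n)\<lparr>carrier := \<Sigma>\<rparr>). \<tau> \<otimes>\<^bsub>(sym_group n)\<lparr>carrier := \<Sigma>\<rparr>\<^esub> \<sigma> = \<one>\<^bsub>(sym_group n)\<lparr>carrier := \<Sigma>\<rparr>\<^esub>"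
      by (intro bexI[of _ "Hilbert_Choice.inv \<sigma>"])
        (auto simp: sym_group_def inv_mem bij bij_is_inj)
  qed (auto simp: sym_group_def comp_mem id_mem o_assoc)
qed

text \<open>
  The points \<open>i\<close> and \<open>\<sigma> i\<close> lie in the same block, so their transposition preserves all blocks.
\<close>

lemma perm_group_young:
  assumes "young_subgroup n \<Sigma>"
  shows "perm_group n \<Sigma>" and "\<sigma> \<in> \<Sigma> \<Longrightarrow> Transposition.transpose i (\<sigma> i) \<in> \<Sigma>"
proof -
  obtain \<P> where part: "partition_on {1..n} \<P>"
    and \<Sigma>: "\<Sigma> = {\<sigma>. \<sigma> permutes {1..n} \<and> (\<forall>B\<in>\<P>. \<sigma> ` B = B)}"
    using assms by (auto simp: young_subgroup_def sym_group_carrier)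
  show pg: "perm_group n \<Sigma>"
  proof
    fix \<sigma> \<tau> assume \<sigma>: "\<sigma> \<in> \<Sigma>"
    then show "\<sigma> permutes {1..n}" by (simp add: \<Sigma>)
    then have inj: "inj \<sigma>" by (rule permutes_inj)
    have "Hilbert_Choice.inv \<sigma> ` B = B" if "B \<in> \<P>" for B
    proof -
      have "Hilbert_Choice.inv \<sigma> ` (\<sigma> ` B) = B" using inj by (simp add: image_comp)
      then show ?thesis using \<sigma> that by (simp add: \<Sigma>)
    qed
    then show "Hilbert_Choice.inv \<sigma> \<in> \<Sigma>" using \<sigma> by (simp add: \<Sigma> permutes_inv)
    assume "\<tau> \<in> \<Sigma>"
    then show "\<sigma> \<circ> \<tau> \<in> \<Sigma>" using \<sigma> by (auto simp: \<Sigma> permutes_compose simp flip: image_image)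
  qed (simp add: \<Sigma> permutes_id)
  show "Transposition.transpose i (\<sigma> i) \<in> \<Sigma>" if \<sigma>: "\<sigma> \<in> \<Sigma>"
  proof (cases "\<sigma> i = i")
    case True
    then show ?thesis using perm_group.id_mem[OF pg] by simp
  next
    case False
    have perm: "\<sigma> permutes {1..n}" using \<sigma> by (simp add: \<Sigma>)
    have i: "i \<in> {1..n}" using permutes_not_in[OF perm] False by blast
    have \<sigma>i: "\<sigma> i \<in> {1..n}" using permutes_in_image[OF perm] i by blast
    have "Transposition.transpose i (\<sigma> i) ` B = B" if B: "B \<in> \<P>" for B
    proof -
      have "i \<in> B \<longleftrightarrow> \<sigma> i \<in> B"
      proof
        assume "i \<in> B"
        then have "\<sigma> i \<in> \<sigma> ` B" by blast
        then show "\<sigma> i \<in> B" using \<sigma> B by (simp add: \<Sigma>)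
      next
        assume "\<sigma> i \<in> B"
        then have "\<sigma> i \<in> \<sigma> ` B" using \<sigma> B by (simp add: \<Sigma>)
        then show "i \<in> B" using permutes_inj[OF perm] by (auto simp: inj_eq)
      qed
      then show ?thesis by (simp add: transpose_image_eq)
    qed
    then show ?thesis using permutes_swap_id[OF i \<sigma>i] by (simp add: \<Sigma>)
  qed
qed

lemma perm_group_subgroup:
  assumes S: "perm_group n \<Sigma>" and G: "subgroup G ((sym_group n)\<lparr>carrier := \<Sigma>\<rparr>)"
  shows "perm_group n G"
proof -
  interpret S: perm_group n \<Sigma> by (rule S)
  interpret grp: group "(sym_group n)\<lparr>carrier := \<Sigma>\<rparr>" by (rule group_sym_restrict[OF S])
  have sub: "G \<subseteq> \<Sigma>" using subgroup.subset[OF G] by simp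
  show ?thesis
  proof
    fix \<sigma> \<tau> assume \<sigma>: "\<sigma> \<in> G"
    then show "\<sigma> permutes {1..n}" using sub S.permutes by blast
    have "inv\<^bsub>(sym_group n)\<lparr>carrier := \<Sigma>\<rparr>\<^esub> \<sigma> = Hilbert_Choice.inv \<sigma>"
      using \<sigma> sub S.inv_mem S.bij
      by (intro grp.inv_equality) (auto simp: sym_group_def bij_is_inj subset_iff)
    then show "Hilbert_Choice.inv \<sigma> \<in> G" using subgroup.m_inv_closed[OF G \<sigma>] by simp
    assume "\<tau> \<in> G"
    then show "\<sigma> \<circ> \<tau> \<in> G" using subgroup.m_closed[OF G \<sigma>] by (simp add: sym_group_def)
  next
    show "id \<in> G" using subgroup.one_closed[OF G] by (simp add: sym_group_def)
  qed
qed

lemma coset_transversal: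
  assumes S: "perm_group n \<Sigma>" and G: "perm_group n G" and sub: "G \<subseteq> \<Sigma>"
  obtains T where "group_pair n \<Sigma> G T"
    "card T = card (rcosets\<^bsub>(sym_group n)\<lparr>carrier := \<Sigma>\<rparr>\<^esub> G)"
proof -
  interpret S: perm_group n \<Sigma> by (rule S)
  interpret G: perm_group n G by (rule G)
  define coset where "coset x = (\<lambda>g. g \<circ> x) ` G" for x :: "nat \<Rightarrow> nat"
  have rcosets: "rcosets\<^bsub>(sym_group n)\<lparr>carrier := \<Sigma>\<rparr>\<^esub> G = coset ` \<Sigma>"
    by (auto simp: RCOSETS_def r_coset_def coset_def sym_group_def)
  have self: "x \<in> coset x" for x unfolding coset_def
    by (rule image_eqI[OF _ G.id_mem]) simp
  have eq: "coset y = coset x" if y: "y \<in> coset x" for x y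
  proof -
    have sub: "coset (g \<circ> x) \<subseteq> coset x" if "g \<in> G" for g x
      using G.comp_mem[OF _ that] by (auto simp: coset_def o_assoc)
    obtain g where g: "g \<in> G" "y = g \<circ> x" using y by (auto simp: coset_def)
    have "x = Hilbert_Choice.inv g \<circ> y" using G.bij[OF g(1)] by (simp add: g(2) o_assoc bij_is_inj)
    then show ?thesis using sub[OF g(1), of x] sub[OF G.inv_mem[OF g(1)], of y] g(2) by auto
  qed
  define r where "r C = (SOME x. x \<in> C)" for C :: "(nat \<Rightarrow> nat) set"
  have r: "r (coset x) \<in> coset x" for x unfolding r_def by (rule someI[of _ x]) (rule self)
  have coset_r: "coset (r (coset x)) = coset x" for x by (rule eq[OF r])
  define T where "T = r ` coset ` \<Sigma>"
  have "inj_on r (coset ` \<Sigma>)"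
    by (rule inj_onI) (metis coset_r imageE)
  then have card: "card T = card (rcosets\<^bsub>(sym_group n)\<lparr>carrier := \<Sigma>\<rparr>\<^esub> G)"
    unfolding rcosets T_def by (rule card_image)
  have "group_pair n \<Sigma> G T"
  proof
    show "T \<subseteq> \<Sigma>"
    proof
      fix t assume "t \<in> T"
      then obtain x where x: "x \<in> \<Sigma>" "t = r (coset x)" by (auto simp: T_def)
      then obtain g where "g \<in> G" "t = g \<circ> x" using r[of x] by (auto simp: coset_def)
      then show "t \<in> \<Sigma>" using x sub S.comp_mem by auto
    qed
    fix \<sigma> assume \<sigma>: "\<sigma> \<in> \<Sigma>"
    have "\<sigma> \<in> coset (r (coset \<sigma>))" using self coset_r by blast
    then obtain g where "g \<in> G" "\<sigma> = g \<circ> r (coset \<sigma>)" by (auto simp: coset_def)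
    then show "\<exists>t\<in>T. \<exists>g\<in>G. \<sigma> = g \<circ> t" using \<sigma> by (auto simp: T_def)
  next
    fix t g assume "t \<in> T" "g \<in> G" "g \<circ> t \<in> T"
    then obtain x y where xy: "t = r (coset x)" "g \<circ> t = r (coset y)" by (auto simp: T_def)
    have "coset (g \<circ> t) = coset t" using \<open>g \<in> G\<close> by (intro eq) (auto simp: coset_def)
    then have "coset x = coset y" unfolding xy(2) coset_r unfolding xy(1) coset_r by simp
    then show "g \<circ> t = t" using xy by simp
  qed (use sub in auto)
  with card show ?thesis by (rule that[rotated])
qed

theorem theorem5p1:
  fixes n l :: nat and \<Sigma> G :: "(nat \<Rightarrow> nat) set"
  assumes "young_subgroup n \<Sigma>"
    and "subgroup G ((sym_group n)\<lparr>carrier := \<Sigma>\<rparr>)"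
    and "l = card (rcosets\<^bsub>(sym_group n)\<lparr>carrier := \<Sigma>\<rparr>\<^esub> G)"
  shows "\<exists>\<theta> :: nat \<Rightarrow> int mpoly.
    (\<forall>i\<in>{1..l}. \<theta> i \<in> carrier (inv_ring int_ring n G)) \<and>
    inj_on (\<lambda>i. to_rat (\<theta> i)) {1..l} \<and>
    secondary_invariants rat_ring n \<Sigma> G ((\<lambda>i. to_rat (\<theta> i)) ` {1..l}) \<and>
    (\<forall>p. good_prime n \<Sigma> G p \<longrightarrow>
      internal_direct_sum
        (inv_ring (residue_ring (int p)) n \<Sigma>) (inv_module (residue_ring (int p)) n G) {1..l}
        (\<lambda>i. cyclic_submodule
          (inv_ring (residue_ring (int p)) n \<Sigma>) (inv_module (residue_ring (int p)) n G)
          (reduce_mod p (\<theta> i))))"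
proof -
  note S = perm_group_young[OF assms(1)]
  have G: "perm_group n G" by (rule perm_group_subgroup[OF S(1) assms(2)])
  have sub: "G \<subseteq> \<Sigma>" using subgroup.subset[OF assms(2)] by simp
  obtain T where T: "group_pair n \<Sigma> G T" "card T = l"
    using coset_transversal[OF S(1) G sub] assms(3) by metis
  interpret group_pair n \<Sigma> G T by (rule T(1))
  interpret young_pair n \<Sigma> G T by unfold_locales (rule S(2))
  obtain \<Theta> where \<Theta>: "finite \<Theta>" "card \<Theta> = card T" "\<Theta> \<subseteq> M" "\<And>b. b \<in> \<Theta> \<Longrightarrow> \<exists>d. hcomp d b = b"
    "\<And>f. f \<in> M \<Longrightarrow> f \<in> satq 0 (lincombs A \<Theta>)"
    "\<And>f. f \<in> M \<Longrightarrow> \<exists>w. f - (\<Sum>b\<in>\<Theta>. of_int (w b) * b) \<in> sat_AM"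
    "\<And>z b. (\<Sum>b\<in>\<Theta>. of_int (z b) * b) \<in> sat_AM \<Longrightarrow> b \<in> \<Theta> \<Longrightarrow> z b = 0"
    by (rule universal_generators) blast
  obtain e where e: "bij_betw e {1..l} \<Theta>"
    using ex_bij_betw_nat_finite_1[OF \<Theta>(1)] \<Theta>(2) T(2) by auto
  have img: "e ` {1..l} = \<Theta>" and inj: "inj_on e {1..l}" using e by (auto simp: bij_betw_def)
  define \<theta> where "\<theta> i = coef (e i)" for i
  interpret Z: coeff_hom \<Z> id 0 by (rule coeff_hom_int)
  show ?thesis
  proof (intro exI[of _ \<theta>] conjI ballI allI impI)
    show "\<theta> i \<in> carrier (inv_ring \<Z> n G)" if "i \<in> {1..l}" for i
    proof -
      have "e i \<in> M" using that img \<Theta>(3) by blast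
      then have "Z.red (e i) \<in> carrier (inv_ring \<Z> n G)" by (rule Z.red_mem[rotated]) (rule G.bij)
      then show ?thesis by (simp add: Z.red_def \<theta>_def)
    qed
    have to_rat: "to_rat (\<theta> i) = Q.red (e i)" for i by (simp add: red_rat \<theta>_def)
    show "inj_on (\<lambda>i. to_rat (\<theta> i)) {1..l}"
    proof (rule inj_onI)
      fix i j assume ij: "i \<in> {1..l}" "j \<in> {1..l}" "to_rat (\<theta> i) = to_rat (\<theta> j)"
      then have "e i = e j" unfolding to_rat Q.red_eq_iff by simp
      then show "i = j" using inj_onD[OF inj] ij(1,2) by blast
    qed
    have "(\<lambda>i. to_rat (\<theta> i)) ` {1..l} = Q.red ` \<Theta>"
      unfolding to_rat img[symmetric] image_image ..
    then show "secondary_invariants rat_ring n \<Sigma> G ((\<lambda>i. to_rat (\<theta> i)) ` {1..l})"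
      using secondary_invariants_rat[OF \<Theta>(1-5)] by simp
    fix p assume "good_prime n \<Sigma> G p"
    then have p: "Factorial_Ring.prime p" and "\<exists>B0. module_basis (inv_ring (residue_ring (int p)) n \<Sigma>)
        (inv_module (residue_ring (int p)) n G) B0"
      by (auto simp: good_prime_def cohen_macaulay_def free_module_def)
    then obtain B where B: "finite B" "B \<subseteq> M" "independent_mod (int p) A B"
      "\<And>f. f \<in> M \<Longrightarrow> f \<in> satq (int p) (lincombs A B)" using basis_lift by blast
    have q: "prime_or_zero (int p)" "int p \<noteq> 0" using p by (auto intro: prime_or_zero_prime)
    have span: "f \<in> satq (int p) (lincombs A \<Theta>)" if "f \<in> M" for f
    proof (rule generators_mod_good_prime[OF q \<Theta>(1-4,6) _ B that])
      show "z b = 0" if "(\<Sum>b\<in>\<Theta>. of_int (z b) * b) \<in> sat_AM" "b \<in> \<Theta>" for z b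
        using that by (rule \<Theta>(7))
    qed
    have indep: "independent_mod (int p) A \<Theta>"
    proof (rule independent_of_spanning[OF q(1) \<Theta>(1)])
      fix f assume "f \<in> M"
      from span[OF this] obtain k c where k: "\<not> int p dvd k" "\<forall>b\<in>\<Theta>. c b \<in> A"
        "of_int (int p) dvd of_int k * f - (\<Sum>b\<in>\<Theta>. c b * b)"
        by (auto simp: satq_def lincombs_def)
      then show "\<exists>s\<in>A. \<not> of_int (int p) dvd s \<and>
        (\<exists>c. (\<forall>b\<in>\<Theta>. c b \<in> A) \<and> of_int (int p) dvd s * f - (\<Sum>b\<in>\<Theta>. c b * b))"
        by (intro bexI[of _ "of_int k"] conjI exI[of _ c])
          (simp_all only: of_int_dvd_of_int_zpoly S.invariants_of_int not_False_eq_True)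
    qed (use \<Theta>(2) in simp)
    interpret F: coeff_hom "residue_ring (int p)" "\<lambda>x. x mod int p" "int p"
      by (rule coeff_hom_residue[OF p])
    have red: "reduce_mod p (\<theta> i) = F.red (e i)" for i
      by (simp add: reduce_mod_def F.red_def \<theta>_def)
    show "internal_direct_sum
        (inv_ring (residue_ring (int p)) n \<Sigma>) (inv_module (residue_ring (int p)) n G) {1..l}
        (\<lambda>i. cyclic_submodule
          (inv_ring (residue_ring (int p)) n \<Sigma>) (inv_module (residue_ring (int p)) n G)
          (reduce_mod p (\<theta> i)))"
      unfolding red by (rule direct_sum_mod_prime[OF p e \<Theta>(1,3) span indep])
  qed
qed

end
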